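(* Let $E$ be a graph and let $R$ be a field. Then $$\left\{I(\Omega(M),B_{\Omega(M)}),\ I(\Omega(v),B_{\Omega(v)}\setminus\{v\}) : M\in M_\gamma(E),\ v\in BV(E)\right\}$$ is the set of (left, or right) primitive graded ideals of $L_R(E)$.
   Context: A graph $E=(E^0,E^1,r,s)$ consists of countable sets $E^0$ (vertices) and $E^1$ (edges) and range and source maps $r,s:E^1\to E^0$. A path of length $n\ge 1$ is $\alpha=e_1\cdots e_n$ with $r(e_i)=s(e_{i+1})$; $s(\alpha)=s(e_1)$, $r(\alpha)=r(e_n)$; vertices are paths of length $0$. Write $v\ge w$ if there is a path from $v$ to $w$. A closed simple path is a path $\alpha=e_1\cdots e_n$ ($n\ge1$) with $s(\alpha)=r(\alpha)$ and $s(e_i)\neq s(e_1)$ for $i>1$; it has an exit if there are $i$ and an edge $f\in s^{-1}(s(e_i))\setminus\{e_i\}$. Condition (L): every closed simple path has an exit. For a field $R$, $L_R(E)$ is the universal $R$-algebra generated by pairwise orthogonal idempotents $\{v:v\in E^0\}$ and elements $\{e,e^*:e\in E^1\}$ subject to: $s(e)e=er(e)=e$; $r(e)e^*=e^*s(e)=e^*$; $e^*f=\delta_{e,f}r(e)$; and $v=\sum_{s(e)=v}ee^*$ whenever $0<|s^{-1}(v)|<\infty$. For a path $\alpha=e_1\cdots e_n$, $\alpha^*:=e_n^*\cdots e_1^*$, and $v^*:=v$. $L_R(E)$ is $\mathbb Z$-graded with $L_R(E)_k=\mathrm{span}_R\{\alpha\beta^*: r(\alpha)=r(\beta),\ |\alpha|-|\beta|=k\}$;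 a (two-sided) ideal $I$ is graded if $I=\bigoplus_k (I\cap L_R(E)_k)$. $X\subseteq E^0$ is hereditary if $s(e)\in X$ implies $r(e)\in X$, and saturated if every $v$ with $0<|s^{-1}(v)|<\infty$ and $r(s^{-1}(v))\subseteq X$ lies in $X$. For $H$ saturated hereditary, $B_H:=\{v\in E^0\setminus H: |s^{-1}(v)|=\infty,\ 0<|s^{-1}(v)\cap r^{-1}(E^0\setminus H)|<\infty\}$ and, for $v\in B_H$, $v^H:=v-\sum_{s(e)=v,\,r(e)\notin H}ee^*$. For $S\subseteq B_H$, $I(H,S)$ is the ideal of $L_R(E)$ generated by $\{v:v\in H\}\cup\{v^H:v\in S\}$. A maximal tail is a nonempty $M\subseteq E^0$ such that (MT1) if $v\in E^0$, $w\in M$, $v\ge w$, then $v\in M$; (MT2) if $v\in M$ with $0<|s^{-1}(v)|<\infty$, there is $e\in E^1$ with $s(e)=v$ and $r(e)\in M$; (MT3) for all $v,w\in M$ there is $y\in M$ with $v\ge y$ and $w\ge y$. $M_\gamma(E)$ is the set of maximal tails $M$ such that the subgraph $(M,r^{-1}(M),r,s)$ satisfies Condition (L). For nonempty $X\subseteq E^0$, $\Omega(X):=\{w\in E^0\setminus X: w\not\ge v \text{ for every } v\in X\}$, and $\Omega(v):=\Omega(\{v\})$. If $M$ is a maximal tail, or if $v$ is an infinite emitter, then $\Omega(M)$, respectively $\Omega(v)$, is hereditary and saturated. The set of breaking vertices is $BV(E):=\{v\in E^0:|s^{-1}(v)|=\infty,\ 0<|s^{-1}(v)\setminus r^{-1}(\Omega(v))|<\infty\}$.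 A ring is left (right) primitive if it has a faithful simple left (right) module; an ideal $I$ of a ring $A$ is left (right) primitive if $A/I$ is a left (right) primitive ring. The claim holds for either side. *)

theory Defs
  imports
    "HOL-Library.Countable_Set"
    "HOL-Library.Poly_Mapping"
    "HOL-Algebra.Module"
    "HOL-Algebra.QuotRing"
    "Graph_Theory.Digraph"
    "Graph_Theory.Arc_Walk"
begin

section \<open>Rings without identity, ideals, primitivity\<close>

text \<open>
  Leavitt path algebras need not be unital.  They are represented by the records of HOL-Algebra, but
  the field \<^const>\<open>one\<close> is meaningless and never used; for the same reason the locales
  \<^locale>\<open>ring\<close> and \<^locale>\<open>ideal\<close> cannot be used.
\<close>

definition two_sided_ideal :: "'a set \<Rightarrow> ('a, 'b) ring_scheme \<Rightarrow> bool" where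
  "two_sided_ideal I A \<longleftrightarrow> additive_subgroup I A \<and>
     (\<forall>a\<in>carrier A. \<forall>x\<in>I. a \<otimes>\<^bsub>A\<^esub> x \<in> I \<and> x \<otimes>\<^bsub>A\<^esub> a \<in> I)"

definition ideal_generated :: "('a, 'b) ring_scheme \<Rightarrow> 'a set \<Rightarrow> 'a set" where
  "ideal_generated A X = \<Inter>{I. two_sided_ideal I A \<and> X \<subseteq> I}"

locale left_module = abelian_group M
  for A :: "('a, 'b) ring_scheme" and M :: "('a, 'm, 'c) module_scheme" +
  assumes act_closed: "\<lbrakk>a \<in> carrier A; m \<in> carrier M\<rbrakk> \<Longrightarrow> a \<odot>\<^bsub>M\<^esub> m \<in> carrier M"
    and act_add_ring: "\<lbrakk>a \<in> carrier A; b \<in> carrier A; m \<in> carrier M\<rbrakk>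
      \<Longrightarrow> (a \<oplus>\<^bsub>A\<^esub> b) \<odot>\<^bsub>M\<^esub> m = a \<odot>\<^bsub>M\<^esub> m \<oplus>\<^bsub>M\<^esub> b \<odot>\<^bsub>M\<^esub> m"
    and act_add_mod: "\<lbrakk>a \<in> carrier A; m \<in> carrier M; n \<in> carrier M\<rbrakk>
      \<Longrightarrow> a \<odot>\<^bsub>M\<^esub> (m \<oplus>\<^bsub>M\<^esub> n) = a \<odot>\<^bsub>M\<^esub> m \<oplus>\<^bsub>M\<^esub> a \<odot>\<^bsub>M\<^esub> n"
    and act_mult: "\<lbrakk>a \<in> carrier A; b \<in> carrier A; m \<in> carrier M\<rbrakk>
      \<Longrightarrow> (a \<otimes>\<^bsub>A\<^esub> b) \<odot>\<^bsub>M\<^esub> m = a \<odot>\<^bsub>M\<^esub> (b \<odot>\<^bsub>M\<^esub> m)"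

text \<open>In a right module, \<open>a \<odot> m\<close> stands for the product of \<open>m\<close> with \<open>a\<close> on the right.\<close>

locale right_module = abelian_group M
  for A :: "('a, 'b) ring_scheme" and M :: "('a, 'm, 'c) module_scheme" +
  assumes act_closed: "\<lbrakk>a \<in> carrier A; m \<in> carrier M\<rbrakk> \<Longrightarrow> a \<odot>\<^bsub>M\<^esub> m \<in> carrier M"
    and act_add_ring: "\<lbrakk>a \<in> carrier A; b \<in> carrier A; m \<in> carrier M\<rbrakk>
      \<Longrightarrow> (a \<oplus>\<^bsub>A\<^esub> b) \<odot>\<^bsub>M\<^esub> m = a \<odot>\<^bsub>M\<^esub> m \<oplus>\<^bsub>M\<^esub> b \<odot>\<^bsub>M\<^esub> m"
    and act_add_mod: "\<lbrakk>a \<in> carrier A; m \<in> carrier M; n \<in> carrier M\<rbrakk>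
      \<Longrightarrow> a \<odot>\<^bsub>M\<^esub> (m \<oplus>\<^bsub>M\<^esub> n) = a \<odot>\<^bsub>M\<^esub> m \<oplus>\<^bsub>M\<^esub> a \<odot>\<^bsub>M\<^esub> n"
    and act_mult: "\<lbrakk>a \<in> carrier A; b \<in> carrier A; m \<in> carrier M\<rbrakk>
      \<Longrightarrow> (a \<otimes>\<^bsub>A\<^esub> b) \<odot>\<^bsub>M\<^esub> m = b \<odot>\<^bsub>M\<^esub> (a \<odot>\<^bsub>M\<^esub> m)"

text \<open>
  As usual for rings without identity, a simple module is required to have nonzero action.
\<close>

definition simple_module :: "('a, 'b) ring_scheme \<Rightarrow> ('a, 'm, 'c) module_scheme \<Rightarrow> bool" where
  "simple_module A M \<longleftrightarrow>
     (\<exists>a\<in>carrier A. \<exists>m\<in>carrier M. a \<odot>\<^bsub>M\<^esub> m \<noteq> \<zero>\<^bsub>M\<^esub>) \<and>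
     (\<forall>N. submodule N A M \<longrightarrow> N = {\<zero>\<^bsub>M\<^esub>} \<or> N = carrier M)"

definition faithful_module :: "('a, 'b) ring_scheme \<Rightarrow> ('a, 'm, 'c) module_scheme \<Rightarrow> bool" where
  "faithful_module A M \<longleftrightarrow>
     (\<forall>a\<in>carrier A. (\<forall>m\<in>carrier M. a \<odot>\<^bsub>M\<^esub> m = \<zero>\<^bsub>M\<^esub>) \<longrightarrow> a = \<zero>\<^bsub>A\<^esub>)"

text \<open>
  HOL cannot quantify over the type of the elements of the module.  Taking the elements to be sets
  of ring elements is no restriction, since a simple module is a quotient of the ring by a
  one-sided ideal; see \<open>left_primitiveI\<close> and \<open>right_primitiveI\<close> below.
\<close>

definition left_primitive :: "('a, 'b) ring_scheme \<Rightarrow> bool" where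
  "left_primitive A \<longleftrightarrow>
     (\<exists>M :: ('a, 'a set) module. left_module A M \<and> simple_module A M \<and> faithful_module A M)"

definition right_primitive :: "('a, 'b) ring_scheme \<Rightarrow> bool" where
  "right_primitive A \<longleftrightarrow>
     (\<exists>M :: ('a, 'a set) module. right_module A M \<and> simple_module A M \<and> faithful_module A M)"

definition transported_module :: "('a, 'm, 'c) module_scheme \<Rightarrow> ('m \<Rightarrow> 'n) \<Rightarrow> ('a, 'n) module" where
  "transported_module M h =
     \<lparr>carrier = h ` carrier M, mult = undefined, one = undefined, zero = h \<zero>\<^bsub>M\<^esub>,
      add = (\<lambda>x y. h (the_inv_into (carrier M) h x \<oplus>\<^bsub>M\<^esub> the_inv_into (carrier M) h y)),
      smult = (\<lambda>a x. h (a \<odot>\<^bsub>M\<^esub> the_inv_into (carrier M) h x))\<rparr>"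

lemma transported_module_simps:
  assumes "inj_on h (carrier M)"
  shows "carrier (transported_module M h) = h ` carrier M"
    and "\<zero>\<^bsub>transported_module M h\<^esub> = h \<zero>\<^bsub>M\<^esub>"
    and "\<lbrakk>x \<in> carrier M; y \<in> carrier M\<rbrakk> \<Longrightarrow> h x \<oplus>\<^bsub>transported_module M h\<^esub> h y = h (x \<oplus>\<^bsub>M\<^esub> y)"
    and "x \<in> carrier M \<Longrightarrow> a \<odot>\<^bsub>transported_module M h\<^esub> h x = h (a \<odot>\<^bsub>M\<^esub> x)"
  using assms by (simp_all add: transported_module_def the_inv_into_f_f)

lemma transported_module_abelian_group:
  assumes "abelian_group M" and inj: "inj_on h (carrier M)"
  shows "abelian_group (transported_module M h)"
proof -
  interpret M: abelian_group M by fact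
  note simps = transported_module_simps[OF inj]
  show ?thesis
  proof (rule abelian_groupI)
    fix x assume "x \<in> carrier (transported_module M h)"
    then obtain m where m: "m \<in> carrier M" "x = h m" by (auto simp: simps)
    then have "h (\<ominus>\<^bsub>M\<^esub> m) \<oplus>\<^bsub>transported_module M h\<^esub> x = \<zero>\<^bsub>transported_module M h\<^esub>"
      by (simp add: simps M.l_neg)
    then show "\<exists>y\<in>carrier (transported_module M h).
        y \<oplus>\<^bsub>transported_module M h\<^esub> x = \<zero>\<^bsub>transported_module M h\<^esub>"
      using m by (auto simp: simps)
  qed (auto simp: simps M.a_ac)
qed

lemma transported_module_inv:
  assumes "abelian_group M" and inj: "inj_on h (carrier M)" and m: "m \<in> carrier M"
  shows "\<ominus>\<^bsub>transported_module M h\<^esub> h m = h (\<ominus>\<^bsub>M\<^esub> m)"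
proof -
  interpret M: abelian_group M by fact
  interpret T: abelian_group "transported_module M h"
    by (rule transported_module_abelian_group[OF assms(1,2)])
  note simps = transported_module_simps[OF inj]
  show ?thesis
    by (rule T.minus_equality) (use m in \<open>auto simp: simps M.l_neg\<close>)
qed

lemma transported_module_simple:
  assumes M: "abelian_group M" and inj: "inj_on h (carrier M)"
    and closed: "\<And>a m. \<lbrakk>a \<in> carrier A; m \<in> carrier M\<rbrakk> \<Longrightarrow> a \<odot>\<^bsub>M\<^esub> m \<in> carrier M"
    and simple: "simple_module A M"
  shows "simple_module A (transported_module M h)"
proof -
  interpret M: abelian_group M by fact
  interpret T: abelian_group "transported_module M h"
    by (rule transported_module_abelian_group[OF M inj])
  note simps = transported_module_simps[OF inj]
  from simple obtain a m where am: "a \<in> carrier A" "m \<in> carrier M" "a \<odot>\<^bsub>M\<^esub> m \<noteq> \<zero>\<^bsub>M\<^esub>"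
    unfolding simple_module_def by blast
  then have "a \<odot>\<^bsub>transported_module M h\<^esub> h m \<noteq> \<zero>\<^bsub>transported_module M h\<^esub>"
    using inj closed by (auto simp: simps dest: inj_onD)
  moreover have "N = {\<zero>\<^bsub>transported_module M h\<^esub>} \<or> N = carrier (transported_module M h)"
    if N: "submodule N A (transported_module M h)" for N
  proof -
    interpret N: submodule N A "transported_module M h" by fact
    have sub: "N \<subseteq> h ` carrier M" using N.subset by (simp add: simps)
    define N' where "N' = {m \<in> carrier M. h m \<in> N}"
    have img: "N = h ` N'" using sub by (auto simp: N'_def)
    have "submodule N' A M"
    proof (unfold_locales, goal_cases)
      case 1 show ?case by (auto simp: N'_def)
    next
      case (2 x y)
      then show ?case using N.m_closed[of "h x" "h y"] by (auto simp: N'_def simps)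
    next
      case 3
      show ?case using N.one_closed by (auto simp: N'_def simps)
    next
      case (4 x)
      then have "h x \<in> N" and x: "x \<in> carrier M" by (auto simp: N'_def)
      from N.m_inv_closed[OF this(1)] have "\<ominus>\<^bsub>transported_module M h\<^esub> h x \<in> N"
        by (simp add: a_inv_def)
      then have "h (\<ominus>\<^bsub>M\<^esub> x) \<in> N" by (simp add: transported_module_inv[OF M inj x])
      then show ?case using x by (simp add: N'_def flip: a_inv_def)
    next
      case (5 a x)
      then show ?case using N.smult_closed[of a "h x"] closed by (auto simp: N'_def simps)
    qed
    then have "N' = {\<zero>\<^bsub>M\<^esub>} \<or> N' = carrier M" using simple by (auto simp: simple_module_def)
    then show ?thesis by (auto simp: img simps)
  qed
  ultimately show ?thesis
    using am by (auto simp: simple_module_def simps)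
qed

lemma transported_module_faithful:
  assumes M: "abelian_group M" and inj: "inj_on h (carrier M)"
    and closed: "\<And>a m. \<lbrakk>a \<in> carrier A; m \<in> carrier M\<rbrakk> \<Longrightarrow> a \<odot>\<^bsub>M\<^esub> m \<in> carrier M"
    and faithful: "faithful_module A M"
  shows "faithful_module A (transported_module M h)"
proof -
  interpret M: abelian_group M by fact
  note simps = transported_module_simps[OF inj]
  show ?thesis
    using faithful inj closed by (auto simp: faithful_module_def simps inj_on_eq_iff)
qed

lemma left_module_transported:
  assumes "left_module A M" and inj: "inj_on h (carrier M)"
  shows "left_module A (transported_module M h)"
proof -
  interpret M: left_module A M by fact
  interpret T: abelian_group "transported_module M h"
    by (rule transported_module_abelian_group[OF M.abelian_group_axioms inj])
  note simps = transported_module_simps[OF inj]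
  show ?thesis
    by unfold_locales
       (auto simp: simps M.act_closed M.act_add_ring M.act_add_mod M.act_mult)
qed

lemma right_module_transported:
  assumes "right_module A M" and inj: "inj_on h (carrier M)"
  shows "right_module A (transported_module M h)"
proof -
  interpret M: right_module A M by fact
  interpret T: abelian_group "transported_module M h"
    by (rule transported_module_abelian_group[OF M.abelian_group_axioms inj])
  note simps = transported_module_simps[OF inj]
  show ?thesis
    by unfold_locales
       (auto simp: simps M.act_closed M.act_add_ring M.act_add_mod M.act_mult)
qed

lemma simple_module_cyclic:
  assumes A: "abelian_group A" and M: "abelian_group M"
    and closed: "\<And>a m. \<lbrakk>a \<in> carrier A; m \<in> carrier M\<rbrakk> \<Longrightarrow> a \<odot>\<^bsub>M\<^esub> m \<in> carrier M"
    and add: "\<And>a b m. \<lbrakk>a \<in> carrier A; b \<in> carrier A; m \<in> carrier M\<rbrakk>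
      \<Longrightarrow> (a \<oplus>\<^bsub>A\<^esub> b) \<odot>\<^bsub>M\<^esub> m = a \<odot>\<^bsub>M\<^esub> m \<oplus>\<^bsub>M\<^esub> b \<odot>\<^bsub>M\<^esub> m"
    and mult: "\<And>a b m. \<lbrakk>a \<in> carrier A; b \<in> carrier A; m \<in> carrier M\<rbrakk>
      \<Longrightarrow> \<exists>c\<in>carrier A. a \<odot>\<^bsub>M\<^esub> (b \<odot>\<^bsub>M\<^esub> m) = c \<odot>\<^bsub>M\<^esub> m"
    and simple: "simple_module A M"
  obtains m where "m \<in> carrier M" "carrier M = (\<lambda>a. a \<odot>\<^bsub>M\<^esub> m) ` carrier A"
proof -
  interpret A: abelian_group A by fact
  interpret M: abelian_group M by fact
  from simple obtain a m where am: "a \<in> carrier A" "m \<in> carrier M" "a \<odot>\<^bsub>M\<^esub> m \<noteq> \<zero>\<^bsub>M\<^esub>"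
    unfolding simple_module_def by blast
  define N where "N = (\<lambda>a. a \<odot>\<^bsub>M\<^esub> m) ` carrier A"
  have z: "\<zero>\<^bsub>A\<^esub> \<odot>\<^bsub>M\<^esub> m = \<zero>\<^bsub>M\<^esub>"
  proof -
    have "\<zero>\<^bsub>A\<^esub> \<odot>\<^bsub>M\<^esub> m \<oplus>\<^bsub>M\<^esub> \<zero>\<^bsub>A\<^esub> \<odot>\<^bsub>M\<^esub> m = \<zero>\<^bsub>A\<^esub> \<odot>\<^bsub>M\<^esub> m"
      using add[of "\<zero>\<^bsub>A\<^esub>" "\<zero>\<^bsub>A\<^esub>" m] am by simp
    then show ?thesis using closed[of "\<zero>\<^bsub>A\<^esub>" m] am by simp
  qed
  have neg: "\<ominus>\<^bsub>M\<^esub> (b \<odot>\<^bsub>M\<^esub> m) = (\<ominus>\<^bsub>A\<^esub> b) \<odot>\<^bsub>M\<^esub> m" if b: "b \<in> carrier A" for b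
  proof (rule M.minus_equality)
    show "(\<ominus>\<^bsub>A\<^esub> b) \<odot>\<^bsub>M\<^esub> m \<oplus>\<^bsub>M\<^esub> b \<odot>\<^bsub>M\<^esub> m = \<zero>\<^bsub>M\<^esub>"
      using add[of "\<ominus>\<^bsub>A\<^esub> b" b m] b am by (simp add: A.l_neg z)
  qed (use b am closed in auto)
  have "submodule N A M"
  proof (unfold_locales, goal_cases)
    case 1 show ?case using am closed by (auto simp: N_def)
  next
    case (2 x y)
    then obtain b c where bc: "b \<in> carrier A" "c \<in> carrier A" "x = b \<odot>\<^bsub>M\<^esub> m" "y = c \<odot>\<^bsub>M\<^esub> m"
      by (auto simp: N_def)
    then have "x \<oplus>\<^bsub>M\<^esub> y = (b \<oplus>\<^bsub>A\<^esub> c) \<odot>\<^bsub>M\<^esub> m" using add am by simp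
    then show ?case using bc by (auto simp: N_def)
  next
    case 3
    show ?case using z A.zero_closed by (force simp: N_def)
  next
    case (4 x)
    then obtain b where "b \<in> carrier A" "x = b \<odot>\<^bsub>M\<^esub> m" by (auto simp: N_def)
    then show ?case using neg[of b] by (auto simp: N_def simp flip: a_inv_def)
  next
    case (5 a x)
    then show ?case using mult am by (fastforce simp: N_def)
  qed
  moreover have "N \<noteq> {\<zero>\<^bsub>M\<^esub>}" using am by (auto simp: N_def)
  ultimately have "N = carrier M" using simple by (auto simp: simple_module_def)
  with am(2) show ?thesis by (intro that[of m]) (simp_all add: N_def)
qed

lemma inj_on_fibres: "inj_on (\<lambda>x. {a \<in> B. f a = x}) (f ` B)"
  by (rule inj_onI) blast

theorem left_primitiveI:
  fixes M :: "('a, 'm, 'c) module_scheme"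
  assumes A: "abelian_group A"
    and A_mult: "\<And>a b. \<lbrakk>a \<in> carrier A; b \<in> carrier A\<rbrakk> \<Longrightarrow> a \<otimes>\<^bsub>A\<^esub> b \<in> carrier A"
    and M: "left_module A M" "simple_module A M" "faithful_module A M"
  shows "left_primitive A"
proof -
  interpret M: left_module A M by fact
  obtain m where m: "m \<in> carrier M" "carrier M = (\<lambda>a. a \<odot>\<^bsub>M\<^esub> m) ` carrier A"
  proof (rule simple_module_cyclic[OF A M.abelian_group_axioms M.act_closed M.act_add_ring _ M(2)])
    fix a b m assume *: "a \<in> carrier A" "b \<in> carrier A" "m \<in> carrier M"
    show "\<exists>c\<in>carrier A. a \<odot>\<^bsub>M\<^esub> (b \<odot>\<^bsub>M\<^esub> m) = c \<odot>\<^bsub>M\<^esub> m"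
      by (rule bexI[of _ "a \<otimes>\<^bsub>A\<^esub> b"]) (use * A_mult M.act_mult in auto)
  qed auto
  define h where "h = (\<lambda>x. {a \<in> carrier A. a \<odot>\<^bsub>M\<^esub> m = x})"
  have inj: "inj_on h (carrier M)" unfolding h_def m(2) by (rule inj_on_fibres)
  show ?thesis
    unfolding left_primitive_def
    using left_module_transported[OF M(1) inj]
      transported_module_simple[OF M.abelian_group_axioms inj M.act_closed M(2)]
      transported_module_faithful[OF M.abelian_group_axioms inj M.act_closed M(3)]
    by blast
qed

theorem right_primitiveI:
  fixes M :: "('a, 'm, 'c) module_scheme"
  assumes A: "abelian_group A"
    and A_mult: "\<And>a b. \<lbrakk>a \<in> carrier A; b \<in> carrier A\<rbrakk> \<Longrightarrow> a \<otimes>\<^bsub>A\<^esub> b \<in> carrier A"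
    and M: "right_module A M" "simple_module A M" "faithful_module A M"
  shows "right_primitive A"
proof -
  interpret M: right_module A M by fact
  obtain m where m: "m \<in> carrier M" "carrier M = (\<lambda>a. a \<odot>\<^bsub>M\<^esub> m) ` carrier A"
  proof (rule simple_module_cyclic[OF A M.abelian_group_axioms M.act_closed M.act_add_ring _ M(2)])
    fix a b m assume *: "a \<in> carrier A" "b \<in> carrier A" "m \<in> carrier M"
    show "\<exists>c\<in>carrier A. a \<odot>\<^bsub>M\<^esub> (b \<odot>\<^bsub>M\<^esub> m) = c \<odot>\<^bsub>M\<^esub> m"
      by (rule bexI[of _ "b \<otimes>\<^bsub>A\<^esub> a"]) (use * A_mult M.act_mult in auto)
  qed auto
  define h where "h = (\<lambda>x. {a \<in> carrier A. a \<odot>\<^bsub>M\<^esub> m = x})"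
  have inj: "inj_on h (carrier M)" unfolding h_def m(2) by (rule inj_on_fibres)
  show ?thesis
    unfolding right_primitive_def
    using right_module_transported[OF M(1) inj]
      transported_module_simple[OF M.abelian_group_axioms inj M.act_closed M(2)]
      transported_module_faithful[OF M.abelian_group_axioms inj M.act_closed M(3)]
    by blast
qed

definition left_primitive_ideal :: "'a set \<Rightarrow> ('a, 'b) ring_scheme \<Rightarrow> bool" where
  "left_primitive_ideal I A \<longleftrightarrow> two_sided_ideal I A \<and> left_primitive (A Quot I)"

definition right_primitive_ideal :: "'a set \<Rightarrow> ('a, 'b) ring_scheme \<Rightarrow> bool" where
  "right_primitive_ideal I A \<longleftrightarrow> two_sided_ideal I A \<and> right_primitive (A Quot I)"

definition linear_span :: "('k, 'a, 'c) module_scheme \<Rightarrow> 'a set \<Rightarrow> 'a set" where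
  "linear_span A X = {(\<Oplus>\<^bsub>A\<^esub>x\<in>Y. c x \<odot>\<^bsub>A\<^esub> x) | c Y. finite Y \<and> Y \<subseteq> X}"

definition internal_direct_sum :: "('a, 'b) ring_scheme \<Rightarrow> 'a set \<Rightarrow> (int \<Rightarrow> 'a set) \<Rightarrow> bool" where
  "internal_direct_sum A I C \<longleftrightarrow>
     (\<forall>k. additive_subgroup (C k) A \<and> C k \<subseteq> I) \<and>
     (\<forall>x\<in>I. \<exists>!f. (\<forall>k. f k \<in> C k) \<and> finite {k. f k \<noteq> \<zero>\<^bsub>A\<^esub>} \<and>
        x = (\<Oplus>\<^bsub>A\<^esub>k\<in>{k. f k \<noteq> \<zero>\<^bsub>A\<^esub>}. f k))"


section \<open>Leavitt path algebras\<close>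

datatype ('v, 'e) generator = Vertex 'v | Edge 'e | Ghost 'e

text \<open>
  The free monoid, written additively so that the finitely supported functions on it, with the
  product of \<^theory>\<open>HOL-Library.Poly_Mapping\<close>, form the free unital algebra.
\<close>

datatype 'a word = Word (letters: "'a list")

instantiation word :: (type) monoid_add
begin
definition zero_word :: "'a word" where "0 = Word []"
definition plus_word :: "'a word \<Rightarrow> 'a word \<Rightarrow> 'a word" where
  "u + w = Word (letters u @ letters w)"
instance by standard (simp_all add: zero_word_def plus_word_def)
end

type_synonym ('v, 'e, 'k) free_elem = "('v, 'e) generator word \<Rightarrow>\<^sub>0 'k"

definition gen :: "('v, 'e) generator \<Rightarrow> ('v, 'e, 'k::field) free_elem" where
  "gen g = Poly_Mapping.single (Word [g]) 1"

definition generators :: "('v, 'e) pre_digraph \<Rightarrow> ('v, 'e) generator set" where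
  "generators E = Vertex ` verts E \<union> Edge ` arcs E \<union> Ghost ` arcs E"

text \<open>
  The free algebra without identity on the generators of \<open>E\<close>: only nonempty words occur.
\<close>

definition free_algebra :: "('v, 'e) pre_digraph \<Rightarrow> ('v, 'e, 'k::field) free_elem ring" where
  "free_algebra E =
     \<lparr>carrier = {x. \<forall>w\<in>Poly_Mapping.keys x. letters w \<noteq> [] \<and> set (letters w) \<subseteq> generators E},
      mult = (*), one = undefined, zero = 0, add = (+)\<rparr>"

inductive_set leavitt_relators ::
  "('v, 'e) pre_digraph \<Rightarrow> ('v, 'e, 'k::field) free_elem set" for E where
  idem: "v \<in> verts E \<Longrightarrow>
    gen (Vertex v) * gen (Vertex v) - gen (Vertex v) \<in> leavitt_relators E"
| orth: "\<lbrakk>v \<in> verts E; w \<in> verts E; v \<noteq> w\<rbrakk> \<Longrightarrow>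
    gen (Vertex v) * gen (Vertex w) \<in> leavitt_relators E"
| edge_source: "e \<in> arcs E \<Longrightarrow>
    gen (Vertex (tail E e)) * gen (Edge e) - gen (Edge e) \<in> leavitt_relators E"
| edge_range: "e \<in> arcs E \<Longrightarrow>
    gen (Edge e) * gen (Vertex (head E e)) - gen (Edge e) \<in> leavitt_relators E"
| ghost_range: "e \<in> arcs E \<Longrightarrow>
    gen (Vertex (head E e)) * gen (Ghost e) - gen (Ghost e) \<in> leavitt_relators E"
| ghost_source: "e \<in> arcs E \<Longrightarrow>
    gen (Ghost e) * gen (Vertex (tail E e)) - gen (Ghost e) \<in> leavitt_relators E"
| CK1: "\<lbrakk>e \<in> arcs E; f \<in> arcs E\<rbrakk> \<Longrightarrow>
    gen (Ghost e) * gen (Edge f) - (if e = f then gen (Vertex (head E e)) else 0)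
      \<in> leavitt_relators E"
| CK2: "\<lbrakk>v \<in> verts E; finite (out_arcs E v); out_arcs E v \<noteq> {}\<rbrakk> \<Longrightarrow>
    gen (Vertex v) - (\<Sum>e\<in>out_arcs E v. gen (Edge e) * gen (Ghost e)) \<in> leavitt_relators E"

definition scale :: "'k::field \<Rightarrow> ('v, 'e, 'k) free_elem \<Rightarrow> ('v, 'e, 'k) free_elem" where
  "scale c x = Poly_Mapping.map ((*) c) x"

text \<open>
  The algebra ideal generated by the relators; closure under scalars must be demanded here because
  the free algebra without identity has no local units.
\<close>

inductive_set leavitt_ideal ::
  "('v, 'e) pre_digraph \<Rightarrow> ('v, 'e, 'k::field) free_elem set" for E where
  zero: "0 \<in> leavitt_ideal E"
| relator: "x \<in> leavitt_relators E \<Longrightarrow> x \<in> leavitt_ideal E"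
| add: "\<lbrakk>x \<in> leavitt_ideal E; y \<in> leavitt_ideal E\<rbrakk> \<Longrightarrow> x + y \<in> leavitt_ideal E"
| scale: "x \<in> leavitt_ideal E \<Longrightarrow> scale c x \<in> leavitt_ideal E"
| mult_left: "\<lbrakk>a \<in> carrier (free_algebra E); x \<in> leavitt_ideal E\<rbrakk> \<Longrightarrow> a * x \<in> leavitt_ideal E"
| mult_right: "\<lbrakk>a \<in> carrier (free_algebra E); x \<in> leavitt_ideal E\<rbrakk> \<Longrightarrow> x * a \<in> leavitt_ideal E"

type_synonym ('v, 'e, 'k) lpa_elem = "('v, 'e, 'k) free_elem set"

definition lpa_class ::
  "('v, 'e) pre_digraph \<Rightarrow> ('v, 'e, 'k::field) free_elem \<Rightarrow> ('v, 'e, 'k) lpa_elem" where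
  "lpa_class E x = leavitt_ideal E +>\<^bsub>free_algebra E\<^esub> x"

definition lpa :: "('v, 'e) pre_digraph \<Rightarrow> ('k::field, ('v, 'e, 'k) lpa_elem) module" where
  "lpa E = ring.extend (free_algebra E Quot leavitt_ideal E)
     (module.fields (\<lambda>c X. \<Union>x\<in>X. lpa_class E (scale c x)))"

definition lpa_gen ::
  "('v, 'e) pre_digraph \<Rightarrow> ('v, 'e) generator \<Rightarrow> ('v, 'e, 'k::field) lpa_elem" where
  "lpa_gen E g = lpa_class E (gen g)"

text \<open>
  A path is a list of edges together with its source vertex, as in \<^const>\<open>pre_digraph.awalk\<close>; the
  vertex only matters for paths of length 0.
\<close>

fun path_elem ::
  "('v, 'e) pre_digraph \<Rightarrow> 'v \<Rightarrow> 'e list \<Rightarrow> ('v, 'e, 'k::field) lpa_elem" where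
  "path_elem E u [] = lpa_gen E (Vertex u)"
| "path_elem E u [e] = lpa_gen E (Edge e)"
| "path_elem E u (e # f # p) = lpa_gen E (Edge e) \<otimes>\<^bsub>lpa E\<^esub> path_elem E u (f # p)"

fun ghost_path_elem ::
  "('v, 'e) pre_digraph \<Rightarrow> 'v \<Rightarrow> 'e list \<Rightarrow> ('v, 'e, 'k::field) lpa_elem" where
  "ghost_path_elem E u [] = lpa_gen E (Vertex u)"
| "ghost_path_elem E u [e] = lpa_gen E (Ghost e)"
| "ghost_path_elem E u (e # f # p) = ghost_path_elem E u (f # p) \<otimes>\<^bsub>lpa E\<^esub> lpa_gen E (Ghost e)"

definition lpa_component ::
  "('v, 'e) pre_digraph \<Rightarrow> int \<Rightarrow> ('v, 'e, 'k::field) lpa_elem set" where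
  "lpa_component E k = linear_span (lpa E)
     {path_elem E u p \<otimes>\<^bsub>lpa E\<^esub> ghost_path_elem E v q | u p v q w.
        pre_digraph.awalk E u p w \<and> pre_digraph.awalk E v q w \<and>
        int (length p) - int (length q) = k}"

definition graded_ideal :: "('v, 'e) pre_digraph \<Rightarrow> ('v, 'e, 'k::field) lpa_elem set \<Rightarrow> bool" where
  "graded_ideal E I \<longleftrightarrow> two_sided_ideal I (lpa E) \<and>
     internal_direct_sum (lpa E) I (\<lambda>k. I \<inter> lpa_component E k)"


section \<open>Maximal tails and breaking vertices\<close>

definition closed_simple_path :: "('v, 'e) pre_digraph \<Rightarrow> 'e list \<Rightarrow> bool" where
  "closed_simple_path E p \<longleftrightarrow> p \<noteq> [] \<and> (\<exists>u. pre_digraph.awalk E u p u) \<and>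
     (\<forall>i. 0 < i \<and> i < length p \<longrightarrow> tail E (p ! i) \<noteq> tail E (p ! 0))"

definition has_exit :: "('v, 'e) pre_digraph \<Rightarrow> 'e list \<Rightarrow> bool" where
  "has_exit E p \<longleftrightarrow> (\<exists>i<length p. \<exists>f\<in>out_arcs E (tail E (p ! i)). f \<noteq> p ! i)"

definition condition_L :: "('v, 'e) pre_digraph \<Rightarrow> bool" where
  "condition_L E \<longleftrightarrow> (\<forall>p. closed_simple_path E p \<longrightarrow> has_exit E p)"

definition maximal_tail :: "('v, 'e) pre_digraph \<Rightarrow> 'v set \<Rightarrow> bool" where
  "maximal_tail E M \<longleftrightarrow> M \<noteq> {} \<and> M \<subseteq> verts E \<and>
     (\<forall>v\<in>verts E. \<forall>w\<in>M. v \<rightarrow>\<^sup>*\<^bsub>E\<^esub> w \<longrightarrow> v \<in> M) \<and>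
     (\<forall>v\<in>M. finite (out_arcs E v) \<and> out_arcs E v \<noteq> {} \<longrightarrow> (\<exists>e\<in>out_arcs E v. head E e \<in> M)) \<and>
     (\<forall>v\<in>M. \<forall>w\<in>M. \<exists>y\<in>M. v \<rightarrow>\<^sup>*\<^bsub>E\<^esub> y \<and> w \<rightarrow>\<^sup>*\<^bsub>E\<^esub> y)"

definition tail_subgraph :: "('v, 'e) pre_digraph \<Rightarrow> 'v set \<Rightarrow> ('v, 'e) pre_digraph" where
  "tail_subgraph E M =
     \<lparr>verts = M, arcs = {e \<in> arcs E. head E e \<in> M}, tail = tail E, head = head E\<rparr>"

definition M_gamma :: "('v, 'e) pre_digraph \<Rightarrow> 'v set set" where
  "M_gamma E = {M. maximal_tail E M \<and> condition_L (tail_subgraph E M)}"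

definition Omega :: "('v, 'e) pre_digraph \<Rightarrow> 'v set \<Rightarrow> 'v set" where
  "Omega E X = {w \<in> verts E - X. \<forall>v\<in>X. \<not> w \<rightarrow>\<^sup>*\<^bsub>E\<^esub> v}"

definition BV :: "('v, 'e) pre_digraph \<Rightarrow> 'v set" where
  "BV E = {v \<in> verts E. infinite (out_arcs E v) \<and>
     finite {e \<in> out_arcs E v. head E e \<notin> Omega E {v}} \<and>
     {e \<in> out_arcs E v. head E e \<notin> Omega E {v}} \<noteq> {}}"

text \<open>The set \<open>B\<^sub>H\<close> and the elements \<open>v\<^sup>H\<close>.\<close>

definition B_set :: "('v, 'e) pre_digraph \<Rightarrow> 'v set \<Rightarrow> 'v set" where
  "B_set E H = {v \<in> verts E - H. infinite (out_arcs E v) \<and>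
     finite {e \<in> out_arcs E v. head E e \<in> verts E - H} \<and>
     {e \<in> out_arcs E v. head E e \<in> verts E - H} \<noteq> {}}"

definition breaking_elem ::
  "('v, 'e) pre_digraph \<Rightarrow> 'v set \<Rightarrow> 'v \<Rightarrow> ('v, 'e, 'k::field) lpa_elem" where
  "breaking_elem E H v = lpa_gen E (Vertex v) \<ominus>\<^bsub>lpa E\<^esub>
     (\<Oplus>\<^bsub>lpa E\<^esub>e\<in>{e \<in> out_arcs E v. head E e \<notin> H}. lpa_gen E (Edge e) \<otimes>\<^bsub>lpa E\<^esub> lpa_gen E (Ghost e))"

definition I_HS :: "('v, 'e) pre_digraph \<Rightarrow> 'v set \<Rightarrow> 'v set \<Rightarrow> ('v, 'e, 'k::field) lpa_elem set" where
  "I_HS E H S = ideal_generated (lpa E)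
     ((\<lambda>v. lpa_gen E (Vertex v)) ` H \<union> breaking_elem E H ` S)"

end

theory Submission
  imports Defs
begin

text \<open>
  Multiplying by paths and ghost paths reduces a graded ideal \<open>I\<close> to its part of degree \<open>0\<close>; there an
  induction on path length shows that \<open>I\<close> is generated by the vertices \<open>H\<close> and the elements \<open>v\<^sup>H\<close>
  that it contains.

  If \<open>I\<close> is primitive, then it is prime, so the vertices outside \<open>H\<close> form a maximal tail.  For distinct
  breaking vertices \<open>v\<^sup>H A w\<^sup>H\<close> lies in \<open>I\<close>, so at most one \<open>v\<^sup>H\<close> is not in \<open>I\<close>, and if there is one, then
  all vertices outside \<open>H\<close> reach \<open>v\<close>.  If there is none, then a cycle without exit would make a corner
  of the primitive ring \<open>A / I\<close> a ring of Laurent polynomials, which is commutative but not a field.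

  Conversely, each ideal of the list is the annihilator of a simple module with a basis of paths: the
  finite paths that end at a fixed vertex, or the infinite paths that are tail equivalent to an
  aperiodic one.  Path length grades these modules, so their annihilators are graded and can be read off
  from the vertices and the elements \<open>v\<^sup>H\<close> that they contain.  Condition (L) and the countability of \<open>E\<close>
  provide the aperiodic path.  The involution of \<open>A\<close> exchanges left and right modules.
\<close>

section \<open>Operations on the free algebra\<close>

text \<open>Which path module is used depends on whether the tail \<open>M\<close> has a dead end,
  that is, a vertex \<open>y\<close> none of whose edges ends in \<open>M\<close>. By (MT2) a dead
  end is a sink or an infinite emitter, so CK2 imposes nothing at \<open>y\<close>, and the finite
  paths ending at \<open>y\<close> carry a representation. Without a dead end infinite paths take
  over; aperiodicity makes the shift between two tail equivalent paths unique, and this shift is the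
  degree on the module.

  A breaking element v^H fixes a path of length 0 at \<open>v\<close> and kills every basis path
  that starts with an edge at \<open>v\<close>. So the module of finite paths ending at a vertex
  \<open>v\<close> of \<open>BV E\<close> is killed by all breaking elements except v^H itself,
  which explains the set difference in the second family.

  The algebra has no identity. Finite sums of vertices act as local units, and a simple module is
  described inside the algebra by the annihilator \<open>m\<close> of one of its vectors, so that no
  type of modules has to be fixed.\<close>

lemma poly_mapping_add_induct [case_names zero single add]:
  fixes x :: "'a \<Rightarrow>\<^sub>0 'b::comm_monoid_add"
  assumes "P 0" and "\<And>w c. w \<in> Poly_Mapping.keys x \<Longrightarrow> P (Poly_Mapping.single w c)"
    and "\<And>y z. P y \<Longrightarrow> P z \<Longrightarrow> P (y + z)"
  shows "P x"
proof -
  have "P (\<Sum>w\<in>K. Poly_Mapping.single w (Poly_Mapping.lookup x w))"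
    if "finite K" "K \<subseteq> Poly_Mapping.keys x" for K
    using that by (induction K) (auto simp: assms)
  from this[of "Poly_Mapping.keys x"]
  have "P (\<Sum>w\<in>Poly_Mapping.keys x. Poly_Mapping.single w (Poly_Mapping.lookup x w))" by simp
  moreover have "(\<Sum>w\<in>Poly_Mapping.keys x. Poly_Mapping.single w (Poly_Mapping.lookup x w)) = x"
    by (rule poly_mapping_eqI) (auto simp: lookup_sum lookup_single in_keys_iff when_def)
  ultimately show ?thesis by simp
qed

abbreviation fcarrier :: "('v, 'e) pre_digraph \<Rightarrow> ('v, 'e, 'k::field) free_elem set" where
  "fcarrier E \<equiv> carrier (free_algebra E)"

abbreviation word_ok :: "('v, 'e) pre_digraph \<Rightarrow> ('v, 'e) generator word \<Rightarrow> bool" where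
  "word_ok E w \<equiv> letters w \<noteq> [] \<and> set (letters w) \<subseteq> generators E"

lemma fcarrier_iff: "x \<in> fcarrier E \<longleftrightarrow> (\<forall>w\<in>Poly_Mapping.keys x. word_ok E w)"
  by (simp add: free_algebra_def)

lemma fcarrier_iff_lookup:
  "x \<in> fcarrier E \<longleftrightarrow> (\<forall>w. Poly_Mapping.lookup x w \<noteq> 0 \<longrightarrow> word_ok E w)"
  by (auto simp: fcarrier_iff in_keys_iff)

lemma fcarrier_0 [simp]: "0 \<in> fcarrier E"
  by (simp add: fcarrier_iff)

lemma fcarrier_single [simp]: "word_ok E w \<Longrightarrow> Poly_Mapping.single w c \<in> fcarrier E"
  by (auto simp: fcarrier_iff split: if_splits)

lemma fcarrier_add [simp]: "x \<in> fcarrier E \<Longrightarrow> y \<in> fcarrier E \<Longrightarrow> x + y \<in> fcarrier E"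
  using keys_add[of x y] by (auto simp: fcarrier_iff)

lemma fcarrier_uminus [simp]: "x \<in> fcarrier E \<Longrightarrow> - x \<in> fcarrier E"
  by (auto simp: fcarrier_iff in_keys_iff)

lemma fcarrier_diff [simp]: "x \<in> fcarrier E \<Longrightarrow> y \<in> fcarrier E \<Longrightarrow> x - y \<in> fcarrier E"
  using fcarrier_add[of x E "- y"] by simp

lemma fcarrier_scale [simp]: "x \<in> fcarrier E \<Longrightarrow> scale c x \<in> fcarrier E"
  by (auto simp: fcarrier_iff in_keys_iff scale_def Poly_Mapping.map.rep_eq when_def split: if_splits)

lemma fcarrier_mult [simp]:
  assumes "x \<in> fcarrier E" "y \<in> fcarrier E" shows "x * y \<in> fcarrier E"
  using assms keys_mult[of x y] by (fastforce simp: fcarrier_iff plus_word_def)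

lemma fcarrier_gen [simp]: "g \<in> generators E \<Longrightarrow> gen g \<in> fcarrier E"
  by (simp add: gen_def)

text \<open>The constant at the empty word exists in the ambient free unital algebra although it is
  not in \<open>fcarrier\<close>; through it most scalar laws become ring laws.\<close>

lemma scale_conv: "scale c x = Poly_Mapping.single 0 c * x"
  by (simp add: scale_def mult_map_scale_conv_mult)

lemma scale_single [simp]: "scale c (Poly_Mapping.single w d) = Poly_Mapping.single w (c * d)"
  by (simp add: scale_conv mult_single)

lemma scale_add: "scale c (x + y) = scale c x + scale c y"
  by (simp add: scale_conv distrib_left)

lemma scale_diff: "scale c (x - y) = scale c x - scale c y"
  by (simp add: scale_conv right_diff_distrib)

lemma scale_mult_left: "scale c x * y = scale c (x * y)"
  by (simp add: scale_conv mult.assoc)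

lemma scale_0 [simp]: "scale c 0 = 0"
  by (simp add: scale_conv)

text \<open>Centrality of the constants rests on commutativity of the coefficients, not on
  associativity, and is therefore checked on monomials.\<close>

lemma scale_mult_right: "x * scale c y = scale c (x * y)"
proof (induction x rule: poly_mapping_add_induct)
  case (single w d)
  show ?case
    by (induction y rule: poly_mapping_add_induct)
      (simp_all add: mult_single scale_add distrib_left mult_ac)
qed (simp_all add: scale_add distrib_right)

lemma scale_minus_one: "scale (- 1) x = - x"
  by (induction x rule: poly_mapping_add_induct) (simp_all add: scale_add single_uminus)

lemma leavitt_ideal_uminus: "x \<in> leavitt_ideal E \<Longrightarrow> - x \<in> leavitt_ideal E"
  using leavitt_ideal.scale[of x E "- 1"] by (simp add: scale_minus_one)

lemma leavitt_ideal_diff: "x \<in> leavitt_ideal E \<Longrightarrow> y \<in> leavitt_ideal E \<Longrightarrow> x - y \<in> leavitt_ideal E"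
  using leavitt_ideal.add[of x E "- y"] by (simp add: leavitt_ideal_uminus)

section \<open>The involution of the free algebra\<close>

fun dual_gen :: "('v, 'e) generator \<Rightarrow> ('v, 'e) generator" where
  "dual_gen (Vertex v) = Vertex v"
| "dual_gen (Edge e) = Ghost e"
| "dual_gen (Ghost e) = Edge e"

definition dual_word :: "('v, 'e) generator word \<Rightarrow> ('v, 'e) generator word" where
  "dual_word w = Word (rev (map dual_gen (letters w)))"

lemma dual_gen_dual_gen [simp]: "dual_gen (dual_gen g) = g"
  by (cases g) auto

lemma dual_word_dual_word [simp]: "dual_word (dual_word w) = w"
  by (simp add: dual_word_def rev_map comp_def)

lemma inj_dual_word [simp]: "inj dual_word"
  by (metis injI dual_word_dual_word)

lemma dual_word_plus: "dual_word (u + w) = dual_word w + dual_word u"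
  by (simp add: dual_word_def plus_word_def)

lemma dual_gen_generators [simp]: "dual_gen g \<in> generators E \<longleftrightarrow> g \<in> generators E"
  by (cases g) (auto simp: generators_def)

lemma word_ok_dual [simp]: "word_ok E (dual_word w) \<longleftrightarrow> word_ok E w"
  by (auto simp: dual_word_def)

text \<open>Since \<open>dual_word\<close> is its own inverse, moving coefficients along it is a
  precomposition and needs no sum over fibres.\<close>

definition fstar :: "('v, 'e, 'k::field) free_elem \<Rightarrow> ('v, 'e, 'k) free_elem" where
  "fstar = Poly_Mapping.map_key dual_word"

lemma lookup_fstar: "Poly_Mapping.lookup (fstar x) w = Poly_Mapping.lookup x (dual_word w)"
  by (simp add: fstar_def map_key.rep_eq)

lemma fstar_0 [simp]: "fstar 0 = 0"
  and fstar_add: "fstar (x + y) = fstar x + fstar y"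
  and fstar_diff: "fstar (x - y) = fstar x - fstar y"
  by (rule poly_mapping_eqI; simp add: lookup_fstar lookup_add lookup_minus)+

lemma fstar_sum: "fstar (sum f X) = (\<Sum>x\<in>X. fstar (f x))"
  by (induction X rule: infinite_finite_induct) (simp_all add: fstar_add)

lemma fstar_single [simp]: "fstar (Poly_Mapping.single w c) = Poly_Mapping.single (dual_word w) c"
  by (rule poly_mapping_eqI) (auto simp: lookup_fstar lookup_single when_def)

lemma fstar_gen [simp]: "fstar (gen g) = gen (dual_gen g)"
  by (simp add: gen_def dual_word_def)

lemma fstar_fstar [simp]: "fstar (fstar x) = x"
  by (rule poly_mapping_eqI) (simp add: lookup_fstar)

lemma fstar_mult: "fstar (x * y) = fstar y * fstar x"
proof (induction x rule: poly_mapping_add_induct)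
  case (single w d)
  show ?case
    by (induction y rule: poly_mapping_add_induct)
      (simp_all add: mult_single dual_word_plus fstar_add distrib_left distrib_right mult.commute)
qed (simp_all add: fstar_add distrib_right distrib_left)

lemma fstar_scale: "fstar (scale c x) = scale c (fstar x)"
  by (induction x rule: poly_mapping_add_induct) (simp_all add: scale_add fstar_add)

lemma fstar_fcarrier [simp]: "x \<in> fcarrier E \<Longrightarrow> fstar x \<in> fcarrier E"
  unfolding fcarrier_iff_lookup lookup_fstar using word_ok_dual[where E = E] by metis

text \<open>The relators are permuted: the source relation of an edge becomes that of its ghost,
  likewise for ranges, and CK1 for \<open>e\<close>, \<open>f\<close> becomes CK1 for
  \<open>f\<close>, \<open>e\<close>.\<close>

lemma fstar_relators:
  assumes "x \<in> leavitt_relators E" shows "fstar x \<in> leavitt_relators E"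
  using assms
proof cases
  case (CK1 e f)
  then show ?thesis
    using leavitt_relators.CK1[of f E e] by (auto simp: fstar_diff fstar_mult split: if_splits)
qed (auto simp: fstar_diff fstar_mult fstar_sum intro: leavitt_relators.intros)

lemma fstar_leavitt_ideal: "x \<in> leavitt_ideal E \<Longrightarrow> fstar x \<in> leavitt_ideal E"
  by (induction rule: leavitt_ideal.induct)
    (auto simp: fstar_add fstar_scale fstar_mult fstar_relators intro: leavitt_ideal.intros)

section \<open>The grading of the free algebra\<close>

fun gen_degree :: "('v, 'e) generator \<Rightarrow> int" where
  "gen_degree (Vertex v) = 0"
| "gen_degree (Edge e) = 1"
| "gen_degree (Ghost e) = - 1"

definition word_degree :: "('v, 'e) generator word \<Rightarrow> int" where
  "word_degree w = sum_list (map gen_degree (letters w))"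

lemma word_degree_plus: "word_degree (u + w) = word_degree u + word_degree w"
  by (simp add: word_degree_def plus_word_def)

definition fproj :: "int \<Rightarrow> ('v, 'e, 'k::field) free_elem \<Rightarrow> ('v, 'e, 'k) free_elem" where
  "fproj k = Poly_Mapping.mapp (\<lambda>w c. if word_degree w = k then c else 0)"

lemma lookup_fproj:
  "Poly_Mapping.lookup (fproj k x) w = (if word_degree w = k then Poly_Mapping.lookup x w else 0)"
  by (auto simp: fproj_def lookup_mapp when_def in_keys_iff)

lemma fproj_0 [simp]: "fproj k 0 = 0"
  and fproj_add: "fproj k (x + y) = fproj k x + fproj k y"
  and fproj_diff: "fproj k (x - y) = fproj k x - fproj k y"
  by (rule poly_mapping_eqI; simp add: lookup_fproj lookup_add lookup_minus)+

lemma fproj_single: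
  "fproj k (Poly_Mapping.single w c) = (if word_degree w = k then Poly_Mapping.single w c else 0)"
  by (rule poly_mapping_eqI) (auto simp: lookup_fproj lookup_single when_def)

lemma fproj_scale: "fproj k (scale c x) = scale c (fproj k x)"
  by (induction x rule: poly_mapping_add_induct) (simp_all add: scale_add fproj_add fproj_single)

lemma fproj_fcarrier [simp]: "x \<in> fcarrier E \<Longrightarrow> fproj k x \<in> fcarrier E"
  by (simp add: fcarrier_iff_lookup lookup_fproj)

lemma fproj_single_mult:
  "fproj k (Poly_Mapping.single w c * x) = Poly_Mapping.single w c * fproj (k - word_degree w) x"
  by (induction x rule: poly_mapping_add_induct)
    (auto simp: mult_single fproj_add fproj_single distrib_left word_degree_plus)

lemma fproj_mult_single:
  "fproj k (x * Poly_Mapping.single w c) = fproj (k - word_degree w) x * Poly_Mapping.single w c"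
  by (induction x rule: poly_mapping_add_induct)
    (auto simp: mult_single fproj_add fproj_single distrib_right word_degree_plus)

definition fhom :: "int \<Rightarrow> ('v, 'e, 'k::field) free_elem set" where
  "fhom k = {x. \<forall>w\<in>Poly_Mapping.keys x. word_degree w = k}"

lemma fhom_0 [simp]: "0 \<in> fhom k"
  by (simp add: fhom_def)

lemma fhom_gen: "gen g \<in> fhom (gen_degree g)"
  by (simp add: gen_def fhom_def word_degree_def)

lemma fhom_add: "x \<in> fhom k \<Longrightarrow> y \<in> fhom k \<Longrightarrow> x + y \<in> fhom k"
  using keys_add[of x y] by (auto simp: fhom_def)

lemma fhom_diff: "x \<in> fhom k \<Longrightarrow> y \<in> fhom k \<Longrightarrow> x - y \<in> fhom k"
  by (fastforce simp: fhom_def in_keys_iff lookup_minus)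

lemma fhom_sum: "(\<And>i. i \<in> X \<Longrightarrow> f i \<in> fhom k) \<Longrightarrow> sum f X \<in> fhom k"
  by (induction X rule: infinite_finite_induct) (simp_all add: fhom_add)

lemma fhom_mult: "x \<in> fhom k \<Longrightarrow> y \<in> fhom l \<Longrightarrow> x * y \<in> fhom (k + l)"
  using keys_mult[of x y] by (fastforce simp: fhom_def word_degree_plus)

lemma fproj_fhom: "x \<in> fhom l \<Longrightarrow> fproj k x = (if k = l then x else 0)"
  by (rule poly_mapping_eqI) (auto simp: fhom_def lookup_fproj in_keys_iff)

text \<open>An edge and its ghost have opposite degrees, which puts CK1 and CK2 in degree
  \<open>0\<close>. This is why the projections descend to the quotient.\<close>

lemma relators_homogeneous:
  assumes "x \<in> leavitt_relators E" shows "\<exists>k. x \<in> fhom k"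
proof -
  note g = fhom_gen[of "Vertex _", simplified] fhom_gen[of "Edge _", simplified]
    fhom_gen[of "Ghost _", simplified]
  have 2: "gen (Vertex v) * gen g \<in> fhom (gen_degree g)" "gen g * gen (Vertex v) \<in> fhom (gen_degree g)"
    for v and g :: "('v, 'e) generator"
    using fhom_mult[OF g(1)[of v] fhom_gen[of g]] fhom_mult[OF fhom_gen[of g] g(1)[of v]] by auto
  show ?thesis
    using assms
  proof cases
    case (idem v) then show ?thesis using 2(1)[of v "Vertex v"] g by (auto intro!: exI[of _ 0] fhom_diff)
  next
    case (orth v w) then show ?thesis using 2(1)[of v "Vertex w"] by auto
  next
    case (edge_source e) then show ?thesis using 2(1)[of _ "Edge e"] g by (auto intro!: exI[of _ 1] fhom_diff)
  next
    case (edge_range e) then show ?thesis using 2(2)[of "Edge e"] g by (auto intro!: exI[of _ 1] fhom_diff)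
  next
    case (ghost_range e) then show ?thesis using 2(1)[of _ "Ghost e"] g by (auto intro!: exI[of _ "- 1"] fhom_diff)
  next
    case (ghost_source e) then show ?thesis using 2(2)[of "Ghost e"] g by (auto intro!: exI[of _ "- 1"] fhom_diff)
  next
    case (CK1 e f)
    then have "x \<in> fhom 0"
      using fhom_mult[OF g(3)[of e] g(2)[of f]] g by (auto intro!: fhom_diff)
    then show ?thesis ..
  next
    case (CK2 v)
    then have "x \<in> fhom 0"
      by (auto intro!: fhom_diff fhom_sum g fhom_mult[OF g(2) g(3), simplified])
    then show ?thesis ..
  qed
qed

text \<open>A monomial factor shifts the degree of the projection, so the induction has to treat all
  \<open>k\<close> at once. A general factor is a sum of monomials, each of which is again an
  admissible multiplier.\<close>

lemma fproj_leavitt_ideal: "x \<in> leavitt_ideal E \<Longrightarrow> fproj k x \<in> leavitt_ideal E"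
proof (induction arbitrary: k rule: leavitt_ideal.induct)
  case (relator x)
  then obtain l where "x \<in> fhom l" using relators_homogeneous by blast
  then show ?case using relator by (auto simp: fproj_fhom intro: leavitt_ideal.intros)
next
  case (mult_left a x)
  have "fproj k (b * x) \<in> leavitt_ideal E"
    if b: "\<forall>w\<in>Poly_Mapping.keys b. word_ok E w" for b
  proof (induction b rule: poly_mapping_add_induct)
    case (single w c)
    then show ?case using b by (auto simp: fproj_single_mult intro!: leavitt_ideal.mult_left mult_left.IH)
  qed (auto simp: distrib_right fproj_add intro: leavitt_ideal.intros)
  then show ?case using mult_left by (simp add: fcarrier_iff)
next
  case (mult_right a x)
  have "fproj k (x * b) \<in> leavitt_ideal E"
    if b: "\<forall>w\<in>Poly_Mapping.keys b. word_ok E w" for b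
  proof (induction b rule: poly_mapping_add_induct)
    case (single w c)
    then show ?case using b by (auto simp: fproj_mult_single intro!: leavitt_ideal.mult_right mult_right.IH)
  qed (auto simp: distrib_left fproj_add intro: leavitt_ideal.intros)
  then show ?case using mult_right by (simp add: fcarrier_iff)
qed (auto simp: fproj_add fproj_scale intro: leavitt_ideal.intros)

section \<open>Leavitt path algebras inside a ring type\<close>

text \<open>The carrier condition makes the relation partial. It is what lets multiplication respect
  the relation, because \<open>leavitt_ideal E\<close> absorbs only factors from the
  carrier.\<close>

definition lq_rel :: "(('v, 'e) pre_digraph \<Rightarrow> ('v, 'e, 'k::field) free_elem) \<Rightarrow>
    (('v, 'e) pre_digraph \<Rightarrow> ('v, 'e, 'k) free_elem) \<Rightarrow> bool" where
  "lq_rel f g \<longleftrightarrow> (\<forall>E. f E \<in> fcarrier E \<and> g E \<in> fcarrier E \<and> f E - g E \<in> leavitt_ideal E)"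

text \<open>
  A type cannot depend on the graph \<open>E\<close>.  The product of the Leavitt path algebras of all graphs
  is a type, however, and the algebra of \<open>E\<close> sits in it as the factor at \<open>E\<close>.  This makes
  the type classes for rings available.
\<close>

quotient_type (overloaded) ('v, 'e, 'k) lprod =
  "('v, 'e) pre_digraph \<Rightarrow> ('v, 'e, 'k::field) free_elem" / partial: lq_rel
proof (rule part_equivpI)
  show "\<exists>x. lq_rel x x"
    by (rule exI[of _ "\<lambda>_. 0"]) (simp add: lq_rel_def leavitt_ideal.zero)
  show "symp lq_rel"
    using leavitt_ideal_uminus by (fastforce simp: symp_def lq_rel_def)
  show "transp lq_rel"
    using leavitt_ideal.add by (fastforce simp: transp_def lq_rel_def)
qed

instantiation lprod :: (type, type, field) ring
begin

lift_definition zero_lprod :: "('a, 'b, 'c) lprod" is "\<lambda>_. 0"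
  by (simp add: lq_rel_def leavitt_ideal.zero)

lift_definition plus_lprod :: "('a, 'b, 'c) lprod \<Rightarrow> ('a, 'b, 'c) lprod \<Rightarrow> ('a, 'b, 'c) lprod"
  is "\<lambda>f g E. f E + g E"
  by (simp add: lq_rel_def add_diff_add leavitt_ideal.add)

lift_definition minus_lprod :: "('a, 'b, 'c) lprod \<Rightarrow> ('a, 'b, 'c) lprod \<Rightarrow> ('a, 'b, 'c) lprod"
  is "\<lambda>f g E. f E - g E"
proof -
  fix f f' g g' :: "('a, 'b) pre_digraph \<Rightarrow> ('a, 'b, 'c) free_elem"
  assume "lq_rel f f'" "lq_rel g g'"
  moreover have "(f E - g E) - (f' E - g' E) = (f E - f' E) - (g E - g' E)" for E
    by simp
  ultimately show "lq_rel (\<lambda>E. f E - g E) (\<lambda>E. f' E - g' E)"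
    by (simp only: lq_rel_def fcarrier_diff leavitt_ideal_diff simp_thms)
qed

lift_definition uminus_lprod :: "('a, 'b, 'c) lprod \<Rightarrow> ('a, 'b, 'c) lprod"
  is "\<lambda>f E. - f E"
proof -
  fix f f' :: "('a, 'b) pre_digraph \<Rightarrow> ('a, 'b, 'c) free_elem"
  assume "lq_rel f f'"
  moreover have "- f E - - f' E = - (f E - f' E)" for E
    by simp
  ultimately show "lq_rel (\<lambda>E. - f E) (\<lambda>E. - f' E)"
    unfolding lq_rel_def using leavitt_ideal_uminus fcarrier_uminus by metis
qed

lift_definition times_lprod :: "('a, 'b, 'c) lprod \<Rightarrow> ('a, 'b, 'c) lprod \<Rightarrow> ('a, 'b, 'c) lprod"
  is "\<lambda>f g E. f E * g E"
proof -
  fix f f' g g' :: "('a, 'b) pre_digraph \<Rightarrow> ('a, 'b, 'c) free_elem"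
  assume "lq_rel f f'" "lq_rel g g'"
  moreover have "f E * g E - f' E * g' E = f E * (g E - g' E) + (f E - f' E) * g' E" for E
    by (simp add: algebra_simps)
  ultimately show "lq_rel (\<lambda>E. f E * g E) (\<lambda>E. f' E * g' E)"
    by (simp add: lq_rel_def leavitt_ideal.add leavitt_ideal.mult_left leavitt_ideal.mult_right)
qed

instance
  by standard (transfer; auto simp: lq_rel_def algebra_simps leavitt_ideal.zero)+

end

lift_definition lscale :: "'k::field \<Rightarrow> ('v, 'e, 'k) lprod \<Rightarrow> ('v, 'e, 'k) lprod"
  is "\<lambda>c f E. scale c (f E)"
  by (simp add: lq_rel_def leavitt_ideal.scale scale_diff[symmetric])

lift_definition lstar :: "('v, 'e, 'k::field) lprod \<Rightarrow> ('v, 'e, 'k) lprod"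
  is "\<lambda>f E. fstar (f E)"
  by (simp add: lq_rel_def fstar_leavitt_ideal fstar_diff[symmetric])

lift_definition lproj :: "int \<Rightarrow> ('v, 'e, 'k::field) lprod \<Rightarrow> ('v, 'e, 'k) lprod"
  is "\<lambda>k f E. fproj k (f E)"
  by (simp add: lq_rel_def fproj_leavitt_ideal fproj_diff[symmetric])

lemma scale_scale: "scale a (scale b x) = scale (a * b) x"
  by (simp add: scale_conv mult_single flip: mult.assoc)

lemma scale_add_left: "scale (a + b) x = scale a x + scale b x"
  by (simp add: scale_conv single_add distrib_right)

interpretation lscale: vector_space lscale
proof
  fix a b :: 'a and x y :: "('b, 'c, 'a) lprod"
  show "lscale a (x + y) = lscale a x + lscale a y"
    by transfer (simp add: lq_rel_def scale_add leavitt_ideal.zero)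
  show "lscale (a + b) x = lscale a x + lscale b x"
    by transfer (simp add: lq_rel_def scale_add_left leavitt_ideal.zero)
  show "lscale a (lscale b x) = lscale (a * b) x"
    by transfer (simp add: lq_rel_def scale_scale leavitt_ideal.zero)
  show "lscale 1 x = x"
    by transfer (simp add: lq_rel_def scale_conv leavitt_ideal.zero)
qed

section \<open>Abstract Leavitt path algebras\<close>

text \<open>The ring type may be larger than the algebra, which is the span \<open>A\<close> of the
  monomials defined below. The two relations between ghosts and vertices are left to the involution,
  see \<open>T_P\<close> and \<open>P_T\<close>. Universality enters later, through the projections
  \<open>proj\<close> and the modules built from the free algebra.\<close>

locale leavitt = wf_digraph E + vector_space sc
  for E :: "('v, 'e) pre_digraph" and sc :: "'k::field \<Rightarrow> 'a::ring \<Rightarrow> 'a" +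
  fixes P :: "'v \<Rightarrow> 'a" and S T :: "'e \<Rightarrow> 'a" and star :: "'a \<Rightarrow> 'a"
  assumes sc_mult_left: "sc c x * y = sc c (x * y)"
    and sc_mult_right: "x * sc c y = sc c (x * y)"
    and star_add: "star (x + y) = star x + star y"
    and star_sc: "star (sc c x) = sc c (star x)"
    and star_mult: "star (x * y) = star y * star x"
    and star_star [simp]: "star (star x) = x"
    and star_P: "v \<in> verts E \<Longrightarrow> star (P v) = P v"
    and star_S: "e \<in> arcs E \<Longrightarrow> star (S e) = T e"
    and P_P: "v \<in> verts E \<Longrightarrow> w \<in> verts E \<Longrightarrow> P v * P w = (if v = w then P v else 0)"
    and P_S: "e \<in> arcs E \<Longrightarrow> P (tail E e) * S e = S e"
    and S_P: "e \<in> arcs E \<Longrightarrow> S e * P (head E e) = S e"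
    and T_S: "e \<in> arcs E \<Longrightarrow> f \<in> arcs E \<Longrightarrow> T e * S f = (if e = f then P (head E e) else 0)"
    and CK2: "v \<in> verts E \<Longrightarrow> finite (out_arcs E v) \<Longrightarrow> out_arcs E v \<noteq> {} \<Longrightarrow>
      P v = (\<Sum>e\<in>out_arcs E v. S e * T e)"
begin

lemma star_0 [simp]: "star 0 = 0"
  using star_add[of 0 0] by simp

lemma star_uminus: "star (- x) = - star x"
  using star_add[of x "- x"] by (simp add: eq_neg_iff_add_eq_0 add.commute)

lemma star_diff: "star (x - y) = star x - star y"
  using star_add[of x "- y"] by (simp add: star_uminus)

lemma star_sum: "star (sum f X) = (\<Sum>x\<in>X. star (f x))"
  by (induction X rule: infinite_finite_induct) (simp_all add: star_add)

lemma star_T: "e \<in> arcs E \<Longrightarrow> star (T e) = S e"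
  using star_star[of "S e"] by (simp add: star_S)

lemma T_P: "e \<in> arcs E \<Longrightarrow> T e * P (tail E e) = T e"
  using P_S[of e, THEN arg_cong[of _ _ star]] by (simp add: star_mult star_P star_S)

lemma P_T: "e \<in> arcs E \<Longrightarrow> P (head E e) * T e = T e"
  using S_P[of e, THEN arg_cong[of _ _ star]] by (simp add: star_mult star_P star_S)

lemma P_S_if: "e \<in> arcs E \<Longrightarrow> v \<in> verts E \<Longrightarrow> P v * S e = (if v = tail E e then S e else 0)"
  by (metis P_P P_S mult.assoc mult_zero_left tail_in_verts)

lemma T_P_if: "e \<in> arcs E \<Longrightarrow> v \<in> verts E \<Longrightarrow> T e * P v = (if v = tail E e then T e else 0)"
  by (metis P_P T_P mult.assoc mult_zero_right tail_in_verts)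

lemma span_mult:
  assumes "x \<in> span X" "y \<in> span Y" "\<And>x y. x \<in> X \<Longrightarrow> y \<in> Y \<Longrightarrow> x * y \<in> span Z"
  shows "x * y \<in> span Z"
proof -
  have *: "a * y \<in> span Z" if "a \<in> X" for a
    using assms(2)
  proof (induction rule: span_induct_alt)
    case (step c b z)
    then show ?case
      using assms(3)[OF that step(1)] by (simp add: distrib_left sc_mult_right span_add span_scale)
  qed (simp add: span_zero)
  show ?thesis
    using assms(1)
  proof (induction rule: span_induct_alt)
    case (step c b z)
    then show ?case by (simp add: * distrib_right sc_mult_left span_add span_scale)
  qed (simp add: span_zero)
qed

subsection \<open>Paths and monomials\<close>

text \<open>The closing vertex is absorbed by the last edge; it makes the recursion uniform down to
  length 0, unlike that of \<open>path_elem\<close>.\<close>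

primrec pe :: "'v \<Rightarrow> 'e list \<Rightarrow> 'a" where
  "pe u [] = P u"
| "pe u (e # p) = S e * pe (head E e) p"

lemma P_pe: "awalk u p w \<Longrightarrow> v \<in> verts E \<Longrightarrow> P v * pe u p = (if v = u then pe u p else 0)"
  by (cases p) (auto simp: awalk_simps P_P P_S_if simp flip: mult.assoc)

lemma pe_P: "awalk u p w \<Longrightarrow> v \<in> verts E \<Longrightarrow> pe u p * P v = (if v = w then pe u p else 0)"
  by (induction p arbitrary: u) (auto simp: awalk_simps P_P mult.assoc)

lemma pe_append: "awalk u p w \<Longrightarrow> awalk w q x \<Longrightarrow> pe u (p @ q) = pe u p * pe w q"
  by (induction p arbitrary: u) (auto simp: awalk_simps P_pe mult.assoc)

lemma star_pe_P: "awalk u p w \<Longrightarrow> v \<in> verts E \<Longrightarrow>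
    star (pe u p) * P v = (if v = u then star (pe u p) else 0)"
  using P_pe[of u p w v, THEN arg_cong[of _ _ star]] by (auto simp: star_mult star_P split: if_splits)

lemma P_star_pe: "awalk u p w \<Longrightarrow> v \<in> verts E \<Longrightarrow>
    P v * star (pe u p) = (if v = w then star (pe u p) else 0)"
  using pe_P[of u p w v, THEN arg_cong[of _ _ star]] by (auto simp: star_mult star_P split: if_splits)

text \<open>The factors \<open>T e * S f\<close> in the middle cancel from the inside out, so the
  product survives only when the shorter path is a prefix of the longer one.\<close>

lemma star_pe_pe:
  assumes "awalk u p w" "awalk v q x" "length p \<le> length q"
  shows "star (pe u p) * pe v q = (if u = v \<and> take (length p) q = p then pe w (drop (length p) q) else 0)"
  using assms
proof (induction p arbitrary: u v q)
  case Nil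
  then show ?case by (auto simp: awalk_simps star_P P_pe)
next
  case (Cons e p)
  then obtain f q' where q: "q = f # q'" by (cases q) auto
  have ef: "e \<in> arcs E" "f \<in> arcs E" "tail E e = u" "tail E f = v" "awalk (head E e) p w"
      "awalk (head E f) q' x" "length p \<le> length q'"
    using Cons.prems q by (auto simp: awalk_simps)
  have "star (pe u (e # p)) * pe v q
      = star (pe (head E e) p) * (T e * S f) * pe (head E f) q'"
    using ef by (simp add: q star_mult star_S mult.assoc)
  also have "\<dots> = (if e = f then star (pe (head E e) p) * pe (head E f) q' else 0)"
    using ef by (auto simp: T_S star_pe_P)
  finally show ?case
    using Cons.IH[OF ef(5-7)] ef by (auto simp: q)
qed

lemma star_pe_pe_same: "awalk u p w \<Longrightarrow> star (pe u p) * pe u p = P w"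
  using star_pe_pe[of u p w u p w] by simp

definition Mset :: "int \<Rightarrow> 'a set" where
  "Mset k = {pe u p * star (pe v q) | u p v q w.
     awalk u p w \<and> awalk v q w \<and> int (length p) - int (length q) = k}"

lemma MsetI: "awalk u p w \<Longrightarrow> awalk v q w \<Longrightarrow> int (length p) - int (length q) = k
    \<Longrightarrow> pe u p * star (pe v q) \<in> Mset k"
  unfolding Mset_def by blast

lemma Mset_star: "x \<in> Mset k \<Longrightarrow> star x \<in> Mset (- k)"
  by (force simp: Mset_def star_mult)

lemma Mset_pe: "awalk u p w \<Longrightarrow> pe u p \<in> Mset (int (length p))"
  using MsetI[of u p w w "[]" "int (length p)"] by (auto simp: star_P pe_P awalk_simps)

lemma Mset_P: "v \<in> verts E \<Longrightarrow> P v \<in> Mset 0"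
  using Mset_pe[of v "[]" v] by (simp add: awalk_simps)

lemma Mset_S: "e \<in> arcs E \<Longrightarrow> S e \<in> Mset 1"
  using Mset_pe[of "tail E e" "[e]" "head E e"] by (simp add: awalk_simps S_P)

lemma Mset_T: "e \<in> arcs E \<Longrightarrow> T e \<in> Mset (- 1)"
  using Mset_star[OF Mset_S] by (simp add: star_S)

lemma Mset_mult_aux:
  assumes "awalk u p w" "awalk v q w" "awalk v' q' w'" "awalk u' p' w'" "length q \<le> length q'"
  shows "pe u p * star (pe v q) * (pe v' q' * star (pe u' p')) \<in> insert 0
    (Mset (int (length p) - int (length q) + (int (length q') - int (length p'))))"
proof -
  have *: "pe u p * star (pe v q) * (pe v' q' * star (pe u' p'))
      = pe u p * (star (pe v q) * pe v' q') * star (pe u' p')"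
    by (simp add: mult.assoc)
  show ?thesis
  proof (cases "v = v' \<and> take (length q) q' = q")
    case True
    then obtain r where r: "q' = q @ r" by (metis append_take_drop_id)
    with assms True have "awalk w r w'"
      by (auto elim: awalkE')
    moreover have "pe u p * star (pe v q) * (pe v' q' * star (pe u' p')) = pe u (p @ r) * star (pe u' p')"
    proof -
      have "star (pe v q) * pe v' q' = pe w r" using star_pe_pe[OF assms(2,3,5)] True r by simp
      then show ?thesis using pe_append[OF assms(1) \<open>awalk w r w'\<close>] by (simp only: *)
    qed
    ultimately show ?thesis
      using assms r by (auto intro!: MsetI[of _ _ w'])
  next
    case False
    then show ?thesis unfolding * using assms by (subst star_pe_pe) auto
  qed
qed

text \<open>When the ghost path on the left is longer than the path it meets, the involution
  reverses the product and leads back to \<open>Mset_mult_aux\<close>.\<close>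

lemma Mset_mult:
  assumes "x \<in> Mset k" "y \<in> Mset l"
  shows "x * y \<in> insert 0 (Mset (k + l))"
proof -
  obtain u p v q w where x: "x = pe u p * star (pe v q)" "awalk u p w" "awalk v q w"
      "k = int (length p) - int (length q)" using assms(1) by (auto simp: Mset_def)
  obtain v' q' u' p' w' where y: "y = pe v' q' * star (pe u' p')" "awalk v' q' w'" "awalk u' p' w'"
      "l = int (length q') - int (length p')" using assms(2) by (auto simp: Mset_def)
  show ?thesis
  proof (cases "length q \<le> length q'")
    case True
    then show ?thesis using Mset_mult_aux[OF x(2,3) y(2,3)] x y by simp
  next
    case False
    then have "star (x * y) \<in> insert 0 (Mset (- (k + l)))"
    proof -
      have "- (k + l) = int (length p') - int (length q') + (int (length q) - int (length p))"
        using x y by simp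
      then show ?thesis
        using Mset_mult_aux[OF y(3,2) x(3,2)] False x(1) y(1) by (simp only: star_mult star_star)
    qed
    then consider "star (x * y) = 0" | "star (x * y) \<in> Mset (- (k + l))" by blast
    then show ?thesis
    proof cases
      case 1
      then have "x * y = 0" using star_star[of "x * y"] by simp
      then show ?thesis by simp
    next
      case 2
      from Mset_star[OF this] show ?thesis by (simp add: add.commute)
    qed
  qed
qed

definition AK :: "int \<Rightarrow> 'a set" where "AK k = span (Mset k)"
definition A :: "'a set" where "A = span (\<Union>k. Mset k)"

lemma Mset_AK: "x \<in> Mset k \<Longrightarrow> x \<in> AK k" by (simp add: AK_def span_base)
lemma AK_A: "x \<in> AK k \<Longrightarrow> x \<in> A" unfolding AK_def A_def by (metis UN_upper UNIV_I span_mono subsetD)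
lemma Mset_A: "x \<in> Mset k \<Longrightarrow> x \<in> A" using Mset_AK AK_A by blast

lemmas AK_closed = subspace_0[OF subspace_span[of "Mset k"], folded AK_def]
  subspace_add[OF subspace_span[of "Mset k"], folded AK_def]
  subspace_diff[OF subspace_span[of "Mset k"], folded AK_def]
  subspace_sum[OF subspace_span[of "Mset k"], folded AK_def]
  subspace_scale[OF subspace_span[of "Mset k"], folded AK_def] for k

lemma AK_mult:
  assumes "x \<in> AK k" "y \<in> AK l" shows "x * y \<in> AK (k + l)"
  unfolding AK_def
proof (rule span_mult)
  show "x \<in> span (Mset k)" "y \<in> span (Mset l)" using assms by (simp_all add: AK_def)
  show "a * b \<in> span (Mset (k + l))" if "a \<in> Mset k" "b \<in> Mset l" for a b
    using Mset_mult[OF that] by (auto simp: span_zero span_base)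
qed

lemma A_0 [simp]: "0 \<in> A" by (simp add: A_def span_zero)
lemma A_add [simp]: "x \<in> A \<Longrightarrow> y \<in> A \<Longrightarrow> x + y \<in> A" by (simp add: A_def span_add)
lemma A_diff [simp]: "x \<in> A \<Longrightarrow> y \<in> A \<Longrightarrow> x - y \<in> A" by (simp add: A_def span_diff)
lemma A_uminus [simp]: "x \<in> A \<Longrightarrow> - x \<in> A" by (simp add: A_def span_neg)
lemma A_sc [simp]: "x \<in> A \<Longrightarrow> sc c x \<in> A" by (simp add: A_def span_scale)
lemma A_sum: "(\<And>i. i \<in> X \<Longrightarrow> f i \<in> A) \<Longrightarrow> sum f X \<in> A" by (simp add: A_def span_sum)

lemma A_mult [simp]:
  assumes "x \<in> A" "y \<in> A" shows "x * y \<in> A"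
  unfolding A_def
proof (rule span_mult)
  show "x \<in> span (\<Union>k. Mset k)" "y \<in> span (\<Union>k. Mset k)" using assms by (simp_all add: A_def)
  show "a * b \<in> span (\<Union>k. Mset k)" if "a \<in> (\<Union>k. Mset k)" "b \<in> (\<Union>k. Mset k)" for a b
  proof -
    from that obtain k l where "a \<in> Mset k" "b \<in> Mset l" by blast
    then have "a * b = 0 \<or> a * b \<in> Mset (k + l)" using Mset_mult by blast
    then show ?thesis by (elim disjE) (simp add: span_zero, blast intro: span_base)
  qed
qed

lemma A_P [simp]: "v \<in> verts E \<Longrightarrow> P v \<in> A" using Mset_P Mset_A by blast
lemma A_S [simp]: "e \<in> arcs E \<Longrightarrow> S e \<in> A" using Mset_S Mset_A by blast
lemma A_T [simp]: "e \<in> arcs E \<Longrightarrow> T e \<in> A" using Mset_T Mset_A by blast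
lemma A_pe: "awalk u p w \<Longrightarrow> pe u p \<in> A" using Mset_pe Mset_A by blast

lemma span_star:
  assumes "x \<in> span X" "\<And>x. x \<in> X \<Longrightarrow> star x \<in> Y" shows "star x \<in> span Y"
  using assms(1)
  by (induction rule: span_induct_alt)
     (simp_all add: span_zero star_add star_sc span_add span_scale span_base assms)

lemma A_star [simp]: "x \<in> A \<Longrightarrow> star x \<in> A"
  unfolding A_def by (rule span_star) (use Mset_star in auto)

lemma AK_star: "x \<in> AK k \<Longrightarrow> star x \<in> AK (- k)"
  unfolding AK_def by (rule span_star) (use Mset_star in auto)

lemma A_induct [consumes 1, case_names zero mono]:
  assumes "x \<in> A" "Q 0"
    and "\<And>c u p v q w y. awalk u p w \<Longrightarrow> awalk v q w \<Longrightarrow> y \<in> A \<Longrightarrow> Q y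
      \<Longrightarrow> Q (sc c (pe u p * star (pe v q)) + y)"
  shows "Q x"
proof -
  have "x \<in> A \<and> Q x"
    using assms(1) unfolding A_def
  proof (induction rule: span_induct_alt)
    case (step c b z)
    then show ?case using assms(3) unfolding A_def[symmetric]
      by (auto simp: Mset_def intro!: A_add A_sc A_mult A_star A_pe)
  qed (simp add: assms(2) span_zero)
  then show ?thesis ..
qed

text \<open>Replaces the missing identity: only finitely many vertices occur as sources of the paths
  and ghost paths of a given element.\<close>

lemma local_unit:
  assumes "x \<in> A"
  obtains V where "finite V" "V \<subseteq> verts E" "(\<Sum>v\<in>V. P v) * x = x" "x * (\<Sum>v\<in>V. P v) = x"
proof -
  define good where "good x W \<longleftrightarrow> (\<Sum>v\<in>W. P v) * x = x \<and> x * (\<Sum>v\<in>W. P v) = x" for x W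
  \<comment> \<open>All finite supersets of \<open>V\<close> have to work as well, otherwise the
    units of two summands could not be merged.\<close>
  have "\<exists>V. finite V \<and> V \<subseteq> verts E \<and> (\<forall>W. finite W \<and> V \<subseteq> W \<and> W \<subseteq> verts E \<longrightarrow> good x W)"
    using assms
  proof (induction rule: A_induct)
    case zero
    show ?case by (rule exI[of _ "{}"]) (simp add: good_def)
  next
    case (mono c u p v q w y)
    obtain V where V: "finite V" "V \<subseteq> verts E"
      "\<forall>W. finite W \<and> V \<subseteq> W \<and> W \<subseteq> verts E \<longrightarrow> good y W"
      using mono(4) by (elim exE conjE)
    have uv: "u \<in> verts E" "v \<in> verts E" using mono by auto
    have *: "(\<Sum>v\<in>W. P v) * pe u p = pe u p" "star (pe v q) * (\<Sum>v\<in>W. P v) = star (pe v q)"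
      if "finite W" "u \<in> W" "v \<in> W" "W \<subseteq> verts E" for W
    proof -
      have "(\<Sum>v\<in>W. P v) * pe u p = (\<Sum>v\<in>W. if v = u then pe u p else 0)"
        unfolding sum_distrib_right by (rule sum.cong) (use that P_pe[OF mono(1)] in auto)
      then show "(\<Sum>v\<in>W. P v) * pe u p = pe u p" using that by simp
      have "star (pe v q) * (\<Sum>v\<in>W. P v) = (\<Sum>v'\<in>W. if v' = v then star (pe v q) else 0)"
        unfolding sum_distrib_left by (rule sum.cong) (use that star_pe_P[OF mono(2)] in auto)
      then show "star (pe v q) * (\<Sum>v\<in>W. P v) = star (pe v q)" using that by simp
    qed
    have "good (sc c (pe u p * star (pe v q)) + y) W"
      if W: "finite W" "insert u (insert v V) \<subseteq> W" "W \<subseteq> verts E" for W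
    proof -
      have "good y W" using W V(3) by simp
      moreover have "(\<Sum>v\<in>W. P v) * (pe u p * star (pe v q)) = pe u p * star (pe v q)"
        using *(1)[of W] W by (simp flip: mult.assoc)
      moreover have "(pe u p * star (pe v q)) * (\<Sum>v\<in>W. P v) = pe u p * star (pe v q)"
        using *(2)[of W] W by (simp add: mult.assoc)
      ultimately show ?thesis
        by (simp add: good_def distrib_left distrib_right sc_mult_right sc_mult_left)
    qed
    then show ?case
      by (intro exI[of _ "insert u (insert v V)"]) (use V uv in simp)
  qed
  then show thesis using that unfolding good_def by blast
qed

subsection \<open>Ideals\<close>

definition tsi :: "'a set \<Rightarrow> bool" where
  "tsi I \<longleftrightarrow> I \<subseteq> A \<and> 0 \<in> I \<and> (\<forall>x\<in>I. \<forall>y\<in>I. x - y \<in> I) \<and> (\<forall>a\<in>A. \<forall>x\<in>I. a * x \<in> I \<and> x * a \<in> I)"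

lemma tsiD:
  assumes "tsi I"
  shows "x \<in> I \<Longrightarrow> x \<in> A" "0 \<in> I" "x \<in> I \<Longrightarrow> y \<in> I \<Longrightarrow> x - y \<in> I"
    "a \<in> A \<Longrightarrow> x \<in> I \<Longrightarrow> a * x \<in> I" "a \<in> A \<Longrightarrow> x \<in> I \<Longrightarrow> x * a \<in> I"
  using assms by (auto simp: tsi_def)

lemma tsi_uminus: "tsi I \<Longrightarrow> x \<in> I \<Longrightarrow> - x \<in> I"
  using tsiD(3)[of I 0 x] tsiD(2) by simp

lemma tsi_add: "tsi I \<Longrightarrow> x \<in> I \<Longrightarrow> y \<in> I \<Longrightarrow> x + y \<in> I"
  using tsiD(3)[of I x "- y"] tsi_uminus by simp

lemma tsi_sum: "tsi I \<Longrightarrow> (\<And>i. i \<in> X \<Longrightarrow> f i \<in> I) \<Longrightarrow> sum f X \<in> I"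
  by (induction X rule: infinite_finite_induct) (simp_all add: tsiD(2) tsi_add)

text \<open>The scalar is moved onto a local unit, so ring ideals are automatically
  subspaces.\<close>

lemma tsi_sc:
  assumes "tsi I" "x \<in> I" shows "sc c x \<in> I"
proof -
  obtain V where V: "finite V" "V \<subseteq> verts E" "(\<Sum>v\<in>V. P v) * x = x"
    using local_unit[OF tsiD(1)[OF assms]] by metis
  then have "sc c (\<Sum>v\<in>V. P v) * x \<in> I" using assms by (intro tsiD(4)) (auto intro!: A_sc A_sum)
  then show ?thesis using V by (simp add: sc_mult_left)
qed

lemma tsi_star:
  assumes "tsi I" shows "tsi (star ` I)"
proof -
  have "star ` I \<subseteq> A" using tsiD(1)[OF assms] by auto
  moreover have "0 \<in> star ` I" using tsiD(2)[OF assms] by (rule rev_image_eqI) simp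
  moreover have "star x - star y \<in> star ` I" if "x \<in> I" "y \<in> I" for x y
    using tsiD(3)[OF assms that] by (simp flip: star_diff)
  moreover have "a * star x \<in> star ` I \<and> star x * a \<in> star ` I" if "a \<in> A" "x \<in> I" for a x
    using tsiD(4,5)[OF assms A_star[OF that(1)] that(2), THEN imageI, of star] by (simp add: star_mult)
  ultimately show ?thesis unfolding tsi_def by blast
qed

definition brk :: "'v set \<Rightarrow> 'v \<Rightarrow> 'a" where
  "brk H v = P v - (\<Sum>e\<in>{e \<in> out_arcs E v. head E e \<notin> H}. S e * T e)"

definition IHS :: "'v set \<Rightarrow> 'v set \<Rightarrow> 'a set" where
  "IHS H B = \<Inter>{I. tsi I \<and> P ` H \<union> brk H ` B \<subseteq> I}"

text \<open>For a finite set of arcs this is the idempotent that projects onto the paths starting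
  with one of them.\<close>

definition qs :: "'e set \<Rightarrow> 'a" where "qs G = (\<Sum>e\<in>G. S e * T e)"

lemma star_qs: "G \<subseteq> arcs E \<Longrightarrow> star (qs G) = qs G"
  unfolding qs_def star_sum
  by (rule sum.cong) (auto simp: star_mult star_S star_T subset_iff)

lemma star_brk: "v \<in> verts E \<Longrightarrow> star (brk H v) = brk H v"
  using star_qs[of "{e \<in> out_arcs E v. head E e \<notin> H}"]
  by (auto simp: brk_def qs_def star_diff star_P)

lemma A_qs [simp]: "G \<subseteq> arcs E \<Longrightarrow> qs G \<in> A"
  unfolding qs_def by (rule A_sum) auto

lemma A_brk [simp]: "v \<in> verts E \<Longrightarrow> brk H v \<in> A"
  unfolding brk_def by (intro A_diff A_sum) auto

lemma tsi_A: "tsi A"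
  by (simp add: tsi_def)

lemma tsi_IHS:
  assumes "H \<subseteq> verts E" "B \<subseteq> verts E" shows "tsi (IHS H B)"
proof -
  have "P ` H \<union> brk H ` B \<subseteq> A" using assms by auto
  then have "IHS H B \<subseteq> A" unfolding IHS_def using tsi_A by blast
  then show ?thesis unfolding tsi_def IHS_def by (auto dest: tsiD)
qed

lemma IHS_least: "tsi I \<Longrightarrow> P ` H \<subseteq> I \<Longrightarrow> brk H ` B \<subseteq> I \<Longrightarrow> IHS H B \<subseteq> I"
  unfolding IHS_def by blast

lemma IHS_P: "v \<in> H \<Longrightarrow> P v \<in> IHS H B" and IHS_brk: "v \<in> B \<Longrightarrow> brk H v \<in> IHS H B"
  unfolding IHS_def by blast+

text \<open>The generators are fixed by the involution. This is the reason why left and right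
  primitivity lead to the same list of ideals.\<close>

lemma star_IHS:
  assumes "H \<subseteq> verts E" "B \<subseteq> verts E" shows "star ` IHS H B = IHS H B"
proof -
  have "IHS H B \<subseteq> star ` IHS H B"
  proof (rule IHS_least)
    show "tsi (star ` IHS H B)" by (intro tsi_star tsi_IHS assms)
    show "P ` H \<subseteq> star ` IHS H B"
    proof (rule image_subsetI)
      fix v assume v: "v \<in> H"
      with assms have "star (P v) = P v" by (auto simp: star_P)
      with IHS_P[OF v] show "P v \<in> star ` IHS H B" by (metis imageI)
    qed
    show "brk H ` B \<subseteq> star ` IHS H B"
    proof (rule image_subsetI)
      fix v assume v: "v \<in> B"
      with assms have "star (brk H v) = brk H v" by (auto simp: star_brk)
      with IHS_brk[OF v] show "brk H v \<in> star ` IHS H B" by (metis imageI)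
    qed
  qed
  moreover from image_mono[OF this, of star] have "star ` IHS H B \<subseteq> IHS H B"
    by (simp add: image_image)
  ultimately show ?thesis by (rule subset_antisym[rotated])
qed

subsection \<open>Homogeneous elements of an ideal\<close>

text \<open>The spans of these sets filter the degree 0 part by path length; the induction in
  \<open>Fset_ideal\<close> runs over this filtration.\<close>

definition Fset :: "nat \<Rightarrow> 'a set" where
  "Fset n = {pe u p * star (pe v q) | u p v q w.
     awalk u p w \<and> awalk v q w \<and> length p = length q \<and> length p \<le> n}"

lemma qs_S: "finite G \<Longrightarrow> G \<subseteq> arcs E \<Longrightarrow> f \<in> arcs E \<Longrightarrow> qs G * S f = (if f \<in> G then S f else 0)"
proof -
  assume G: "finite G" "G \<subseteq> arcs E" "f \<in> arcs E"
  have "qs G * S f = (\<Sum>e\<in>G. if e = f then S f else 0)"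
    unfolding qs_def sum_distrib_right
    by (rule sum.cong) (use G in \<open>auto simp: mult.assoc T_S S_P\<close>)
  then show ?thesis using G by simp
qed

lemma T_qs: "finite G \<Longrightarrow> G \<subseteq> arcs E \<Longrightarrow> f \<in> arcs E \<Longrightarrow> T f * qs G = (if f \<in> G then T f else 0)"
  using qs_S[of G f, THEN arg_cong[of _ _ star]]
  by (auto simp: star_mult star_qs star_S split: if_splits)

lemma P_qs: "finite G \<Longrightarrow> G \<subseteq> arcs E \<Longrightarrow> v \<in> verts E \<Longrightarrow> P v * qs G = qs (G \<inter> out_arcs E v)"
proof -
  assume G: "finite G" "G \<subseteq> arcs E" "v \<in> verts E"
  have "P v * qs G = (\<Sum>e\<in>G. if e \<in> out_arcs E v then S e * T e else 0)"
    unfolding qs_def sum_distrib_left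
    by (rule sum.cong) (use G in \<open>auto simp: P_S_if simp flip: mult.assoc\<close>)
  then show ?thesis using G by (simp add: qs_def sum.If_cases Int_def)
qed

lemma qs_qs: "finite G \<Longrightarrow> G \<subseteq> arcs E \<Longrightarrow> F \<subseteq> G \<Longrightarrow> qs G * qs F = qs F"
  unfolding qs_def[of F] sum_distrib_left
  by (rule sum.cong) (auto simp: qs_S subset_iff simp flip: mult.assoc)

end

context leavitt
begin

lemma FsetI: "awalk u p w \<Longrightarrow> awalk v q w \<Longrightarrow> length p = length q \<Longrightarrow> length p \<le> n
    \<Longrightarrow> pe u p * star (pe v q) \<in> Fset n"
  unfolding Fset_def by blast

lemma FsetE:
  assumes "x \<in> Fset n"
  obtains u p v q w where "x = pe u p * star (pe v q)" "awalk u p w" "awalk v q w"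
    "length p = length q" "length p \<le> n"
  using assms unfolding Fset_def by blast

lemma Fset_mono: "m \<le> n \<Longrightarrow> Fset m \<subseteq> Fset n"
  by (auto elim!: FsetE intro: FsetI)

lemma AK_0_Fset:
  assumes "x \<in> AK 0" shows "\<exists>n. x \<in> span (Fset n)"
  using assms unfolding AK_def
proof (induction rule: span_induct_alt)
  case base
  show ?case by (auto intro: span_zero)
next
  case (step c b z)
  then obtain n where n: "z \<in> span (Fset n)" by blast
  obtain u p v q w where "b = pe u p * star (pe v q)" "awalk u p w" "awalk v q w" "length p = length q"
    using step(1) by (auto simp: Mset_def)
  then have m: "b \<in> Fset (length p)" by (simp add: FsetI)
  define m where "m = length p"
  note m = m[folded m_def]
  have "b \<in> span (Fset (max m n))" "z \<in> span (Fset (max m n))"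
    using m n span_mono[OF Fset_mono[of n "max m n"]] Fset_mono[of m "max m n"] by (auto intro: span_base)
  then show ?case by (blast intro: span_add span_scale)
qed

lemma T_Fset_S:
  assumes "x \<in> span (Fset (Suc n))" "e \<in> arcs E" "f \<in> arcs E"
  shows "T e * x * S f \<in> span (Fset n)"
  using assms(1)
proof (induction rule: span_induct_alt)
  case (step c b z)
  \<comment> \<open>A trivial path has no edge to lose: \<open>T e * P w * S f\<close> is a vertex
    or \<open>0\<close>, so the vertices must belong to every stage of the filtration.\<close>
  have P_F: "P v \<in> span (Fset n)" if "v \<in> verts E" for v
    using FsetI[of v "[]" v v "[]" n] that by (simp add: awalk_simps star_P P_P span_base)
  obtain u p v q w where b: "b = pe u p * star (pe v q)" "awalk u p w" "awalk v q w"
      "length p = length q" "length p \<le> Suc n"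
    using step(1) by (elim FsetE)
  have "T e * b * S f \<in> span (Fset n)"
  proof (cases p)
    case Nil
    with b have [simp]: "u = w" "v = w" "w \<in> verts E" and b': "b = P w"
      by (auto simp: awalk_simps star_P P_P)
    show ?thesis
      using assms(2,3) by (auto simp: b' T_P_if T_S P_F span_zero)
  next
    case (Cons g p')
    then obtain h q' where q: "q = h # q'" using b by (cases q) auto
    have gh: "g \<in> arcs E" "h \<in> arcs E" "awalk (head E g) p' w" "awalk (head E h) q' w"
      using b Cons q by (auto simp: awalk_simps)
    have "T e * b * S f = (T e * S g) * (pe (head E g) p' * star (pe (head E h) q')) * (T h * S f)"
      using gh by (simp add: b Cons q star_mult star_S mult.assoc)
    also have "\<dots> = (if e = g \<and> f = h then pe (head E g) p' * star (pe (head E h) q') else 0)"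
      using gh assms by (auto simp: T_S P_pe star_pe_P mult.assoc simp flip: mult.assoc[of "P _"])
    also have "\<dots> \<in> span (Fset n)"
    proof -
      have "pe (head E g) p' * star (pe (head E h) q') \<in> Fset n"
        using b Cons q by (intro FsetI[OF gh(3,4)]) simp_all
      then show ?thesis by (simp add: span_zero span_base)
    qed
    finally show ?thesis .
  qed
  then show ?case using step
    by (simp add: distrib_left distrib_right sc_mult_left sc_mult_right span_add span_scale)
qed (simp add: span_zero)

lemma Fset_0_corner:
  assumes "x \<in> span (Fset 0)" "u \<in> verts E" "w \<in> verts E"
  shows "\<exists>c. P u * x * P w = (if u = w then sc c (P u) else 0)"
  using assms(1)
proof (induction rule: span_induct_alt)
  case base
  show ?case by (rule exI[of _ 0]) simp
next
  case (step c b z)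
  then obtain d where d: "P u * z * P w = (if u = w then sc d (P u) else 0)" by blast
  obtain v where "v \<in> verts E" "b = P v"
    using step(1) by (auto simp: Fset_def awalk_simps star_P P_P)
  then have "P u * b * P w = (if u = w \<and> v = u then P u else 0)"
    using assms by (auto simp: P_P)
  then have "P u * (sc c b + z) * P w
      = (if u = w then sc (if v = u then c + d else d) (P u) else 0)"
    using d by (auto simp: distrib_left distrib_right sc_mult_left sc_mult_right scale_left_distrib)
  then show ?case by blast
qed

text \<open>A monomial of positive length is reproduced by \<open>qs G'\<close> on both sides once
  \<open>G'\<close> contains the first edges of its path and its ghost path, so it leaves no defect.
  Only the vertex \<open>u\<close> does, namely \<open>P u\<close> minus the edges of
  \<open>G'\<close> at \<open>u\<close>. Allowing every larger \<open>G'\<close> lets the edge sets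
  of the summands be united.\<close>

lemma Fset_corner:
  assumes "x \<in> span (Fset n)" "u \<in> verts E" "w \<in> verts E"
  shows "\<exists>c G. finite G \<and> G \<subseteq> arcs E \<and> (\<forall>G'. finite G' \<and> G \<subseteq> G' \<and> G' \<subseteq> arcs E \<longrightarrow>
    P u * x * P w - qs G' * (P u * x * P w) * qs G' =
      (if u = w then sc c (P u - qs (G' \<inter> out_arcs E u)) else 0))"
  using assms(1)
proof (induction rule: span_induct_alt)
  case base
  show ?case by (rule exI[of _ 0], rule exI[of _ "{}"]) simp
next
  case (step c b z)
  define defect where "defect y G = P u * y * P w - qs G * (P u * y * P w) * qs G" for y G
  have add: "defect (sc c b + z) G = sc c (defect b G) + defect z G" for G
    by (simp add: defect_def distrib_left distrib_right sc_mult_left sc_mult_right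
        scale_right_diff_distrib)
  obtain d G where d: "finite G" "G \<subseteq> arcs E"
     "\<forall>G'. finite G' \<and> G \<subseteq> G' \<and> G' \<subseteq> arcs E \<longrightarrow>
        defect z G' = (if u = w then sc d (P u - qs (G' \<inter> out_arcs E u)) else 0)"
    using step(2) unfolding defect_def[symmetric] by (elim exE conjE)
  obtain a p a' q v where b: "b = pe a p * star (pe a' q)" "awalk a p v" "awalk a' q v"
      "length p = length q"
    using step(1) by (elim FsetE)
  have "\<exists>c' F. finite F \<and> F \<subseteq> arcs E \<and> (\<forall>G'. finite G' \<and> F \<subseteq> G' \<and> G' \<subseteq> arcs E \<longrightarrow>
     defect b G' = (if u = w then sc c' (P u - qs (G' \<inter> out_arcs E u)) else 0))"
  proof (cases p)
    case Nil
    with b have v: "v \<in> verts E" and b': "b = P v"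
      by (auto simp: awalk_simps star_P P_P)
    have "defect b G' = (if u = w \<and> v = u then P u - qs (G' \<inter> out_arcs E u) else 0)"
      if "finite G'" "G' \<subseteq> arcs E" for G'
    proof -
      have pvw: "P u * b * P w = (if u = w \<and> v = u then P u else 0)"
        using assms v by (auto simp: b' P_P)
      have "qs G' * P u * qs G' = qs (G' \<inter> out_arcs E u)"
        using that assms by (simp add: mult.assoc P_qs qs_qs)
      then show ?thesis unfolding defect_def pvw by (cases "u = w \<and> v = u") auto
    qed
    then show ?thesis
      by (intro exI[of _ "if v = u then 1 else 0"] exI[of _ "{}"]) auto
  next
    case (Cons g p')
    then obtain h q' where q: "q = h # q'" using b by (cases q) auto
    have gh: "g \<in> arcs E" "h \<in> arcs E"
      using b Cons q by (auto simp: awalk_simps)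
    have "defect b G' = 0" if G': "finite G'" "{g, h} \<subseteq> G'" "G' \<subseteq> arcs E" for G'
    proof -
      have b': "b = S g * (pe (head E g) p' * star (pe (head E h) q')) * T h"
        using gh by (simp add: b Cons q star_mult star_S mult.assoc)
      have "P u * b * P w = (if u = tail E g \<and> w = tail E h then b else 0)"
        using gh assms by (simp add: b' P_S_if T_P_if mult.assoc) (simp add: P_S_if flip: mult.assoc)
      moreover have "qs G' * b * qs G' = b"
        using gh G' by (simp add: b' T_qs mult.assoc) (simp add: qs_S flip: mult.assoc)
      ultimately show ?thesis by (simp add: defect_def)
    qed
    then show ?thesis
      using gh by (intro exI[of _ 0] exI[of _ "{g, h}"]) auto
  qed
  then obtain c' F where F: "finite F" "F \<subseteq> arcs E"
     "\<forall>G'. finite G' \<and> F \<subseteq> G' \<and> G' \<subseteq> arcs E \<longrightarrow>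
        defect b G' = (if u = w then sc c' (P u - qs (G' \<inter> out_arcs E u)) else 0)"
    by (elim exE conjE)
  have "defect (sc c b + z) G' = (if u = w then sc (c * c' + d) (P u - qs (G' \<inter> out_arcs E u)) else 0)"
    if "finite G'" "F \<union> G \<subseteq> G'" "G' \<subseteq> arcs E" for G'
    using that d(3)[rule_format, of G'] F(3)[rule_format, of G'] by (auto simp: add scale_left_distrib)
  then show ?case
    using F(1,2) d(1,2) unfolding defect_def by (intro exI[of _ "c * c' + d"] exI[of _ "F \<union> G"]) auto
qed

lemma qs_in_ideal:
  assumes I: "tsi I" and G: "finite G" "\<And>e. e \<in> G \<Longrightarrow> e \<in> arcs E \<and> P (head E e) \<in> I"
  shows "qs G \<in> I"
  unfolding qs_def
proof (rule tsi_sum[OF I])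
  fix e assume "e \<in> G"
  then have e: "e \<in> arcs E" "P (head E e) \<in> I" using G by auto
  then have "S e * P (head E e) * T e \<in> I" using tsiD(4,5)[OF I] by simp
  then show "S e * T e \<in> I" using e by (simp add: S_P)
qed

lemma head_in_ideal:
  assumes I: "tsi I" and e: "e \<in> arcs E" and u: "P (tail E e) \<in> I" shows "P (head E e) \<in> I"
proof -
  have "T e * P (tail E e) * S e \<in> I" using tsiD(4,5)[OF I] u e by simp
  then show ?thesis using e by (simp add: T_P T_S)
qed

lemma hereditary_verts:
  assumes I: "tsi I" and p: "awalk u p w" and u: "P u \<in> I" shows "P w \<in> I"
  using p u by (induction p arbitrary: u) (auto simp: awalk_simps head_in_ideal[OF I])

text \<open>A corner element \<open>u - \<Sum>ee\<^sup>*\<close> of a graded ideal already lies in the ideal generated by the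
  vertices and the breaking elements: every further edge at \<open>u\<close> ends in \<open>H\<close>.\<close>

lemma corner_elem:
  assumes I: "tsi I" and J: "tsi J"
    and PJ: "\<And>v. v \<in> verts E \<Longrightarrow> P v \<in> I \<Longrightarrow> P v \<in> J"
    and BJ: "\<And>v. v \<in> B_set E {v \<in> verts E. P v \<in> I} \<Longrightarrow> brk {v \<in> verts E. P v \<in> I} v \<in> I \<Longrightarrow>
      brk {v \<in> verts E. P v \<in> I} v \<in> J"
    and G: "finite G" "G \<subseteq> out_arcs E u" and u: "u \<in> verts E" and z: "P u - qs G \<in> I"
  shows "P u - qs G \<in> J"
proof -
  define H where "H = {v \<in> verts E. P v \<in> I}"
  have G': "G \<subseteq> arcs E" using G by auto
  \<comment> \<open>On the left of an edge outside \<open>G\<close>, \<open>P u - qs G\<close> acts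
    as the identity; multiplying by the ghost of that edge leaves its range.\<close>
  have out: "head E e \<in> H" if e: "e \<in> out_arcs E u" "e \<notin> G" for e
  proof -
    have "T e * ((P u - qs G) * S e) \<in> I"
      using e by (intro tsiD(4)[OF I] tsiD(5)[OF I] z) auto
    moreover have "(P u - qs G) * S e = S e"
      using e G G' u by (simp add: left_diff_distrib qs_S P_S_if)
    ultimately show ?thesis using e by (simp add: T_S H_def)
  qed
  have diff_J: "qs F \<in> J" if "finite F" "F \<subseteq> {e \<in> out_arcs E u. head E e \<in> H}" for F
    using that PJ by (intro qs_in_ideal[OF J]) (auto simp: H_def)
  have "finite {e \<in> out_arcs E u. head E e \<notin> H}"
    by (rule finite_subset[OF _ G(1)]) (use out in auto)
  note fin = this
  have split: "P u - qs G = brk H u - qs {e \<in> G. head E e \<in> H}"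
  proof -
    have "G = {e \<in> out_arcs E u. head E e \<notin> H} \<union> {e \<in> G. head E e \<in> H}" using out G by auto
    then have "qs G = qs {e \<in> out_arcs E u. head E e \<notin> H} + qs {e \<in> G. head E e \<in> H}"
      unfolding qs_def using fin G(1) by (subst sum.union_disjoint[symmetric]) auto
    then show ?thesis by (simp add: brk_def qs_def)
  qed
  have qJ: "qs {e \<in> G. head E e \<in> H} \<in> J" using G by (intro diff_J) auto
  have qI: "qs {e \<in> G. head E e \<in> H} \<in> I"
    using G by (intro qs_in_ideal[OF I]) (auto simp: H_def)
  have brkI: "brk H u \<in> I" using tsi_add[OF I z qI] by (simp add: split)
  \<comment> \<open>If \<open>u\<close> lies in \<open>H\<close>, or all its edges end in
    \<open>H\<close>, then \<open>brk H u\<close> is \<open>P u\<close>. At a finite emitter CK2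
    turns it into a sum over edges into \<open>H\<close>. Only an infinite emitter with some edge
    ending outside \<open>H\<close> is a true breaking vertex, and there \<open>BJ\<close>
    applies.\<close>
  have "brk H u \<in> J"
  proof (cases "u \<in> H")
    case True
    then have "P (head E e) \<in> I" if "e \<in> out_arcs E u" for e
      using head_in_ideal[OF I, of e] that by (auto simp: H_def)
    then have empty: "{e \<in> out_arcs E u. head E e \<notin> H} = {}" by (auto simp: H_def)
    have "brk H u = P u" unfolding brk_def empty by simp
    then show ?thesis using True PJ by (simp add: H_def)
  next
    case uH: False
    show ?thesis
    proof (cases "{e \<in> out_arcs E u. head E e \<notin> H} = {}")
      case True
      then have "brk H u = P u" unfolding brk_def True by simp
      then show ?thesis using brkI PJ u by simp
    next
      case ne: False
      show ?thesis
      proof (cases "finite (out_arcs E u)")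
        case True
        have "P u - qs {e \<in> out_arcs E u. head E e \<notin> H} = qs {e \<in> out_arcs E u. head E e \<in> H}"
        proof -
          have "out_arcs E u \<noteq> {}" using ne by blast
          then have "P u = qs (out_arcs E u)" using CK2[OF u True] by (simp add: qs_def)
          also have "\<dots> = qs {e \<in> out_arcs E u. head E e \<notin> H} + qs {e \<in> out_arcs E u. head E e \<in> H}"
            unfolding qs_def using True
            by (subst sum.union_disjoint[symmetric])
              (auto intro!: sum.cong intro: finite_subset[OF _ True])
          finally show ?thesis by simp
        qed
        then have "brk H u = qs {e \<in> out_arcs E u. head E e \<in> H}" by (simp add: brk_def qs_def)
        moreover have "finite {e \<in> out_arcs E u. head E e \<in> H}"
          by (rule finite_subset[OF _ True]) auto
        ultimately show ?thesis using diff_J[OF _ subset_refl] by simp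
      next
        case False
        have "{e \<in> out_arcs E u. head E e \<in> verts E - H} = {e \<in> out_arcs E u. head E e \<notin> H}"
          by auto
        then have "u \<in> B_set E H"
          using False fin ne u uH by (auto simp: B_set_def)
        then show ?thesis using BJ brkI by (simp add: H_def)
      qed
    qed
  qed
  then show ?thesis using qJ tsiD(3)[OF J] split by simp
qed

text \<open>In a corner \<open>y\<close> of \<open>x\<close> the part \<open>qs G * y * qs G\<close>
  is a sum of terms \<open>S e * (T e * y * S f) * T f\<close>, whose middle factors are one step
  lower in the filtration and hence in \<open>J\<close> by induction. The remaining defect is a
  multiple of the element treated in \<open>corner_elem\<close>.\<close>

lemma Fset_ideal:
  assumes I: "tsi I" and J: "tsi J"
    and PJ: "\<And>v. v \<in> verts E \<Longrightarrow> P v \<in> I \<Longrightarrow> P v \<in> J"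
    and BJ: "\<And>v. v \<in> B_set E {v \<in> verts E. P v \<in> I} \<Longrightarrow> brk {v \<in> verts E. P v \<in> I} v \<in> I \<Longrightarrow>
      brk {v \<in> verts E. P v \<in> I} v \<in> J"
    and JI: "J \<subseteq> I"
  shows "x \<in> span (Fset n) \<Longrightarrow> x \<in> I \<Longrightarrow> x \<in> J"
proof (induction n arbitrary: x)
  \<comment> \<open>Local units on both sides write \<open>x\<close> as a finite sum of its
    corners.\<close>
  have reduce: "x \<in> J" if x: "x \<in> I" and "\<And>u w. u \<in> verts E \<Longrightarrow> w \<in> verts E \<Longrightarrow> P u * x * P w \<in> J" for x
  proof -
    obtain V where V: "finite V" "V \<subseteq> verts E" "(\<Sum>v\<in>V. P v) * x = x" "x * (\<Sum>v\<in>V. P v) = x"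
      using local_unit[OF tsiD(1)[OF I x]] by metis
    have "x = (\<Sum>v\<in>V. P v) * x * (\<Sum>v\<in>V. P v)" using V by simp
    also have "\<dots> = (\<Sum>u\<in>V. \<Sum>w\<in>V. P w * x * P u)"
      by (simp add: sum_distrib_left sum_distrib_right)
    also have "\<dots> \<in> J" by (intro tsi_sum[OF J] that(2)) (use V(2) in auto)
    finally show "x \<in> J" .
  qed
  {
    case 0
    show ?case
    proof (rule reduce[OF 0(2)])
      fix u w assume uw: "u \<in> verts E" "w \<in> verts E"
      obtain c where c: "P u * x * P w = (if u = w then sc c (P u) else 0)"
        using Fset_0_corner[OF 0(1) uw] by blast
      have "P u * x * P w \<in> I" using 0 uw tsiD[OF I] by auto
      show "P u * x * P w \<in> J"
      proof (cases "u = w \<and> c \<noteq> 0")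
        case True
        with c \<open>P u * x * P w \<in> I\<close> have "sc (inverse c) (sc c (P u)) \<in> I" using tsi_sc[OF I] by metis
        then have "P u \<in> J" using True uw PJ by simp
        then have "sc c (P u) \<in> J" by (rule tsi_sc[OF J])
        then show ?thesis using c True by simp
      qed (use c tsiD(2)[OF J] in auto)
    qed
  next
    case (Suc n)
    show ?case
    proof (rule reduce[OF Suc(3)])
      fix u w assume uw: "u \<in> verts E" "w \<in> verts E"
      define y where "y = P u * x * P w"
      have yI: "y \<in> I" using Suc uw tsiD[OF I] by (auto simp: y_def)
      obtain c G where G: "finite G" "G \<subseteq> arcs E"
        "y - qs G * y * qs G = (if u = w then sc c (P u - qs (G \<inter> out_arcs E u)) else 0)"
        using Fset_corner[OF Suc(2) uw] unfolding y_def by blast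
      have TyS: "T e * y * S f \<in> J" if "e \<in> G" "f \<in> G" for e f
      proof -
        have ef: "e \<in> arcs E" "f \<in> arcs E" using that G by auto
        have "T e * y * S f = (if u = tail E e \<and> w = tail E f then T e * x * S f else 0)"
          using ef uw by (simp add: y_def P_S_if mult.assoc) (simp add: T_P_if flip: mult.assoc)
        moreover have "T e * x * S f \<in> J"
          using Suc.prems ef tsiD[OF I] by (intro Suc.IH T_Fset_S) auto
        ultimately show ?thesis using tsiD(2)[OF J] by simp
      qed
      have "S e * (T e * y * S f) * T f \<in> J" if ef: "e \<in> G" "f \<in> G" for e f
        by (rule tsiD(5)[OF J _ tsiD(4)[OF J]]) (use ef G(2) TyS in auto)
      then have "(\<Sum>f\<in>G. \<Sum>e\<in>G. S e * (T e * y * S f) * T f) \<in> J"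
        by (intro tsi_sum[OF J]) auto
      moreover have "qs G * y * qs G = (\<Sum>f\<in>G. \<Sum>e\<in>G. S e * (T e * y * S f) * T f)"
        by (simp add: qs_def sum_distrib_left sum_distrib_right mult.assoc)
      ultimately have qJ: "qs G * y * qs G \<in> J" by simp
      have "y - qs G * y * qs G \<in> J"
      proof (cases "u = w \<and> c \<noteq> 0")
        case True
        \<comment> \<open>The part already placed in \<open>J\<close> also lies in \<open>I\<close>,
          so subtracting it keeps the defect in \<open>I\<close>.\<close>
        have "y - qs G * y * qs G \<in> I" using tsiD(3)[OF I yI] qJ JI by blast
        then have "sc (inverse c) (sc c (P u - qs (G \<inter> out_arcs E u))) \<in> I"
          using tsi_sc[OF I] G(3) True by metis
        then have "P u - qs (G \<inter> out_arcs E u) \<in> I" using True by simp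
        then have "P u - qs (G \<inter> out_arcs E u) \<in> J"
          using G uw PJ BJ by (intro corner_elem[OF I J]) auto
        then show ?thesis using G(3) True tsi_sc[OF J] by simp
      qed (use G(3) tsiD(2)[OF J] in auto)
      from tsi_add[OF J this qJ] show "P u * x * P w \<in> J" by (simp add: y_def)
    qed
  }
qed

text \<open>A monomial of degree \<open>n\<close> starts with at least \<open>n\<close> edges. The
  idempotent of its initial path of length \<open>n\<close> fixes it, and the idempotents of all
  other paths of length \<open>n\<close> annihilate it.\<close>

lemma AK_expand:
  assumes "x \<in> AK (int n)"
  shows "\<exists>X. finite X \<and> X \<subseteq> {(u, p). \<exists>w. awalk u p w \<and> length p = n} \<and>
    x = (\<Sum>(u, p)\<in>X. pe u p * star (pe u p) * x)"
proof -
  define U where "U = {(u, p). \<exists>w. awalk u p w \<and> length p = n}"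
  have "\<exists>X. finite X \<and> X \<subseteq> U \<and> (\<forall>Y. finite Y \<and> X \<subseteq> Y \<and> Y \<subseteq> U \<longrightarrow>
    x = (\<Sum>(u, p)\<in>Y. pe u p * star (pe u p) * x))"
    using assms unfolding AK_def
  proof (induction rule: span_induct_alt)
    case base
    show ?case by (rule exI[of _ "{}"]) simp
  next
    case (step c b z)
    obtain X where X: "finite X" "X \<subseteq> U"
      "\<forall>Y. finite Y \<and> X \<subseteq> Y \<and> Y \<subseteq> U \<longrightarrow> z = (\<Sum>(u, p)\<in>Y. pe u p * star (pe u p) * z)"
      using step(2) by (elim exE conjE)
    obtain u p v q w where b: "b = pe u p * star (pe v q)" "awalk u p w" "awalk v q w"
        "int (length p) - int (length q) = int n"
      using step(1) by (auto simp: Mset_def)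
    define p1 p2 where "p1 = take n p" and "p2 = drop n p"
    have p: "p = p1 @ p2" and len: "length p1 = n" using b(4) by (auto simp: p1_def p2_def)
    then obtain x where w: "awalk u p1 x" "awalk x p2 w" using b(2) by (auto simp: awalk_append_iff)
    have *: "b = (\<Sum>(u', p')\<in>Y. pe u' p' * star (pe u' p') * b)"
      if Y: "finite Y" "insert (u, p1) X \<subseteq> Y" "Y \<subseteq> U" for Y
    proof -
      have "(\<Sum>(u', p')\<in>Y. pe u' p' * star (pe u' p') * b) = (\<Sum>y\<in>Y. if y = (u, p1) then b else 0)"
      proof (rule sum.cong)
        fix y assume "y \<in> Y"
        then obtain u' p' w' where y: "y = (u', p')" "awalk u' p' w'" "length p' = n"
          using Y by (auto simp: U_def)
        have sp: "star (pe u' p') * pe u p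
            = (if u' = u \<and> take (length p') p = p' then pe w' (drop (length p') p) else 0)"
          using star_pe_pe[OF y(2) b(2)] y(3) len p by simp
        have "pe u' p' * star (pe u' p') * b = pe u' p' * (star (pe u' p') * pe u p) * star (pe v q)"
          by (simp only: b(1) mult.assoc)
        also have "\<dots> = (if y = (u, p1) then b else 0)"
        proof (cases "u' = u \<and> p' = p1")
          case True
          then have "awlast u p1 = w'" "awlast u p1 = x" using y(2) w(1) by (auto elim: awalkE')
          then show ?thesis
            using True pe_append[OF w] y(1,3) len unfolding sp by (simp add: p b(1))
        next
          case False
          then show ?thesis using y(1,3) len unfolding sp by (auto simp: p)
        qed
        finally have "pe u' p' * star (pe u' p') * b = (if y = (u, p1) then b else 0)" .
        then show "(case y of (u', p') \<Rightarrow> pe u' p' * star (pe u' p') * b) = (if y = (u, p1) then b else 0)"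
          using y by simp
      qed simp
      then show ?thesis using Y by simp
    qed
    have "sc c b + z = (\<Sum>(u', p')\<in>Y. pe u' p' * star (pe u' p') * (sc c b + z))"
      if Y: "finite Y" "insert (u, p1) X \<subseteq> Y" "Y \<subseteq> U" for Y
    proof -
      have "(\<Sum>(u', p')\<in>Y. pe u' p' * star (pe u' p') * (sc c b + z))
        = sc c (\<Sum>(u', p')\<in>Y. pe u' p' * star (pe u' p') * b) + (\<Sum>(u', p')\<in>Y. pe u' p' * star (pe u' p') * z)"
        by (simp add: scale_sum_right split_def distrib_left sc_mult_right sum.distrib)
      then show ?thesis using *[OF Y] X(3) Y by simp
    qed
    moreover have "(u, p1) \<in> U" using w len by (auto simp: U_def)
    ultimately show ?case using X(1,2) by (intro exI[of _ "insert (u, p1) X"]) simp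
  qed
  then show ?thesis unfolding U_def by blast
qed

text \<open>Each \<open>star (pe u p) * x\<close> with \<open>p\<close> of length \<open>n\<close>
  has degree \<open>0\<close> and falls under \<open>Fset_ideal\<close>; multiplying back by the
  paths recovers \<open>x\<close>.\<close>

lemma AK_ideal_nonneg:
  assumes I: "tsi I" and J: "tsi J"
    and PJ: "\<And>v. v \<in> verts E \<Longrightarrow> P v \<in> I \<Longrightarrow> P v \<in> J"
    and BJ: "\<And>v. v \<in> B_set E {v \<in> verts E. P v \<in> I} \<Longrightarrow> brk {v \<in> verts E. P v \<in> I} v \<in> I \<Longrightarrow>
      brk {v \<in> verts E. P v \<in> I} v \<in> J"
    and JI: "J \<subseteq> I" and x: "x \<in> I" "x \<in> AK (int n)"
  shows "x \<in> J"
proof -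
  obtain X where X: "finite X" "X \<subseteq> {(u, p). \<exists>w. awalk u p w \<and> length p = n}"
    "x = (\<Sum>(u, p)\<in>X. pe u p * star (pe u p) * x)"
    using AK_expand[OF x(2)] by blast
  have "pe u p * star (pe u p) * x \<in> J" if up: "(u, p) \<in> X" for u p
  proof -
    obtain w where w: "awalk u p w" "length p = n" using X(2) up by blast
    have "star (pe u p) \<in> AK (- int n)" using AK_star[OF Mset_AK[OF Mset_pe[OF w(1)]]] w by simp
    then have "star (pe u p) * x \<in> AK 0" using AK_mult[OF _ x(2)] by fastforce
    then obtain m where "star (pe u p) * x \<in> span (Fset m)" using AK_0_Fset by blast
    moreover have "star (pe u p) * x \<in> I" using x w A_pe tsiD(4)[OF I] by auto
    ultimately have "star (pe u p) * x \<in> J" using Fset_ideal[OF I J PJ BJ JI] by blast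
    then show ?thesis using tsiD(4)[OF J A_pe[OF w(1)]] by (simp add: mult.assoc)
  qed
  then show ?thesis by (subst X(3)) (auto intro!: tsi_sum[OF J])
qed

lemma star_image_iff: "x \<in> star ` I \<longleftrightarrow> star x \<in> I"
  by (metis image_iff star_star)

text \<open>The involution turns negative degrees into positive ones and fixes both kinds of
  generators.\<close>

lemma AK_ideal:
  assumes I: "tsi I" and J: "tsi J"
    and PJ: "\<And>v. v \<in> verts E \<Longrightarrow> P v \<in> I \<Longrightarrow> P v \<in> J"
    and BJ: "\<And>v. v \<in> B_set E {v \<in> verts E. P v \<in> I} \<Longrightarrow> brk {v \<in> verts E. P v \<in> I} v \<in> I \<Longrightarrow>
      brk {v \<in> verts E. P v \<in> I} v \<in> J"
    and JI: "J \<subseteq> I" and x: "x \<in> I" "x \<in> AK k"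
  shows "x \<in> J"
proof (cases "k \<ge> 0")
  case True
  then show ?thesis using AK_ideal_nonneg[OF I J PJ BJ JI x(1), of "nat k"] x by simp
next
  case False
  have H: "{v \<in> verts E. P v \<in> star ` I} = {v \<in> verts E. P v \<in> I}"
    by (auto simp: star_image_iff star_P)
  have "star x \<in> star ` J"
  proof (rule AK_ideal_nonneg[OF tsi_star[OF I] tsi_star[OF J]])
    show "star x \<in> AK (int (nat (- k)))" using AK_star[OF x(2)] False by simp
    show "P v \<in> star ` J" if "v \<in> verts E" "P v \<in> star ` I" for v
      using that PJ by (simp add: star_image_iff star_P)
    show "brk {v \<in> verts E. P v \<in> star ` I} v \<in> star ` J"
      if "v \<in> B_set E {v \<in> verts E. P v \<in> star ` I}" "brk {v \<in> verts E. P v \<in> star ` I} v \<in> star ` I" for v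
    proof -
      have "v \<in> verts E" using that(1) by (simp add: B_set_def)
      then show ?thesis using that BJ[of v] unfolding H by (simp add: star_image_iff star_brk)
    qed
    show "star ` J \<subseteq> star ` I" "star x \<in> star ` I" using JI x by auto
  qed
  then show ?thesis by (simp add: star_image_iff)
qed

end

subsection \<open>Graded ideals\<close>

text \<open>The existence of \<open>proj\<close> expresses that the components are independent,
  which the relations alone do not give; for the actual algebra it comes from the free
  algebra.\<close>

locale graded_leavitt = leavitt E sc P S T star
  for E :: "('v, 'e) pre_digraph" and sc :: "'k::field \<Rightarrow> 'a::ring \<Rightarrow> 'a"
    and P :: "'v \<Rightarrow> 'a" and S T :: "'e \<Rightarrow> 'a" and star :: "'a \<Rightarrow> 'a" +
  fixes proj :: "int \<Rightarrow> 'a \<Rightarrow> 'a"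
  assumes proj_add: "proj k (x + y) = proj k x + proj k y"
    and proj_sc: "proj k (sc c x) = sc c (proj k x)"
    and proj_Mset: "x \<in> Mset l \<Longrightarrow> proj k x = (if k = l then x else 0)"
begin

lemma proj_0 [simp]: "proj k 0 = 0"
  using proj_add[of k 0 0] by simp

lemma proj_sum: "proj k (sum f X) = (\<Sum>x\<in>X. proj k (f x))"
  by (induction X rule: infinite_finite_induct) (simp_all add: proj_add)

lemma proj_uminus: "proj k (- x) = - proj k x"
  using proj_add[of k x "- x"] by (simp add: eq_neg_iff_add_eq_0 add.commute)

lemma proj_diff: "proj k (x - y) = proj k x - proj k y"
  using proj_add[of k x "- y"] by (simp add: proj_uminus)

lemma proj_AK: "x \<in> AK l \<Longrightarrow> proj k x = (if k = l then x else 0)"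
  unfolding AK_def
  by (induction rule: span_induct_alt) (auto simp: proj_add proj_sc proj_Mset)

lemma proj_in_AK: "x \<in> A \<Longrightarrow> proj k x \<in> AK k"
  unfolding A_def
  by (induction rule: span_induct_alt)
    (auto simp: proj_add proj_sc proj_Mset AK_closed Mset_AK)

lemma proj_decomp:
  assumes "x \<in> A"
  shows "finite {k. proj k x \<noteq> 0}" "x = (\<Sum>k\<in>{k. proj k x \<noteq> 0}. proj k x)"
proof -
  \<comment> \<open>The set \<open>K\<close> has to bound the degrees of \<open>x\<close> and stay
    valid when enlarged, so that a new monomial can be added.\<close>
  have "\<exists>K. finite K \<and> (\<forall>L. finite L \<and> K \<subseteq> L \<longrightarrow> x = (\<Sum>k\<in>L. proj k x)) \<and> (\<forall>k. k \<notin> K \<longrightarrow> proj k x = 0)"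
    using assms unfolding A_def
  proof (induction rule: span_induct_alt)
    case base
    show ?case by (rule exI[of _ "{}"]) simp
  next
    case (step c b z)
    obtain K where K: "finite K" "\<forall>L. finite L \<and> K \<subseteq> L \<longrightarrow> z = (\<Sum>k\<in>L. proj k z)"
      "\<forall>k. k \<notin> K \<longrightarrow> proj k z = 0"
      using step(2) by (elim exE conjE)
    obtain l where l: "b \<in> Mset l" using step(1) by blast
    have "sc c b + z = (\<Sum>k\<in>L. proj k (sc c b + z))" if "finite L" "insert l K \<subseteq> L" for L
    proof -
      have "(\<Sum>k\<in>L. proj k (sc c b + z)) = (\<Sum>k\<in>L. if k = l then sc c b else 0) + (\<Sum>k\<in>L. proj k z)"
        unfolding sum.distrib[symmetric]
        by (rule sum.cong) (auto simp: proj_add proj_sc proj_Mset[OF l])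
      then show ?thesis using that K(2) by simp
    qed
    moreover have "proj k (sc c b + z) = 0" if "k \<notin> insert l K" for k
      using that K(3) by (simp add: proj_add proj_sc proj_Mset[OF l])
    ultimately show ?case using K(1) by (intro exI[of _ "insert l K"]) simp
  qed
  then obtain K where K: "finite K" "x = (\<Sum>k\<in>K. proj k x)" "\<forall>k. k \<notin> K \<longrightarrow> proj k x = 0"
    by blast
  show fin: "finite {k. proj k x \<noteq> 0}" by (rule finite_subset[OF _ K(1)]) (use K(3) in blast)
  show "x = (\<Sum>k\<in>{k. proj k x \<noteq> 0}. proj k x)"
    by (subst K(2), rule sum.mono_neutral_cong_right) (use K in auto)
qed

definition graded :: "'a set \<Rightarrow> bool" where
  "graded I \<longleftrightarrow> tsi I \<and> (\<forall>x\<in>I. \<forall>k. proj k x \<in> I)"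

text \<open>The homogeneous components of an element of \<open>I\<close> stay in \<open>I\<close>,
  and \<open>AK_ideal\<close>, with the ideal on the right as \<open>J\<close>, places each of them
  there.\<close>

theorem graded_ideal_eq_IHS:
  assumes gr: "graded I"
  defines "H \<equiv> {v \<in> verts E. P v \<in> I}"
  shows "I = IHS H {v \<in> B_set E H. brk H v \<in> I}"
proof -
  have I: "tsi I" using gr by (simp add: graded_def)
  define B where "B = {v \<in> B_set E H. brk H v \<in> I}"
  have J: "tsi (IHS H B)" by (rule tsi_IHS) (auto simp: H_def B_def B_set_def)
  have JI: "IHS H B \<subseteq> I" by (rule IHS_least[OF I]) (auto simp: H_def B_def)
  have "I \<subseteq> IHS H B"
  proof
    fix x assume x: "x \<in> I"
    have "proj k x \<in> IHS H B" for k
    proof (rule AK_ideal[OF I J _ _ JI])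
      show "proj k x \<in> I" using gr x by (simp add: graded_def)
      show "proj k x \<in> AK k" using proj_in_AK tsiD(1)[OF I x] by simp
    qed (auto simp: H_def B_def intro!: IHS_P IHS_brk)
    then have "(\<Sum>k\<in>{k. proj k x \<noteq> 0}. proj k x) \<in> IHS H B" by (intro tsi_sum[OF J])
    then show "x \<in> IHS H B" using proj_decomp(2)[OF tsiD(1)[OF I x]] by simp
  qed
  then show ?thesis using JI by (simp add: B_def)
qed

end

section \<open>Graded primitive ideals\<close>

context graded_leavitt
begin

text \<open>The properties of the annihilator of a nonzero vector of a simple left module.\<close>

definition simple_ann :: "'a set \<Rightarrow> bool" where
  "simple_ann m \<longleftrightarrow> m \<subset> A \<and> 0 \<in> m \<and> (\<forall>x\<in>m. \<forall>y\<in>m. x - y \<in> m) \<and> (\<forall>a\<in>A. \<forall>x\<in>m. a * x \<in> m) \<and>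
     (\<forall>x\<in>A - m. \<forall>b\<in>A. \<exists>a\<in>A. b - a * x \<in> m)"

text \<open>The second condition makes \<open>I\<close> the annihilator of the left module
  \<open>A / m\<close>; this is left primitivity of \<open>A / I\<close> phrased with subsets of
  \<open>A\<close> only.\<close>

definition lprim :: "'a set \<Rightarrow> bool" where
  "lprim I \<longleftrightarrow> tsi I \<and> (\<exists>m. simple_ann m \<and> I = {a \<in> A. \<forall>b\<in>A. a * b \<in> m})"

lemma simple_annD:
  assumes "simple_ann m"
  shows "x \<in> m \<Longrightarrow> x \<in> A" "0 \<in> m" "x \<in> m \<Longrightarrow> y \<in> m \<Longrightarrow> x - y \<in> m" "x \<in> m \<Longrightarrow> y \<in> m \<Longrightarrow> x + y \<in> m"
    "a \<in> A \<Longrightarrow> x \<in> m \<Longrightarrow> a * x \<in> m" "x \<in> A \<Longrightarrow> x \<notin> m \<Longrightarrow> b \<in> A \<Longrightarrow> \<exists>a\<in>A. b - a * x \<in> m"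
proof -
  have *: "m \<subset> A" "0 \<in> m" "\<And>x y. x \<in> m \<Longrightarrow> y \<in> m \<Longrightarrow> x - y \<in> m"
    "\<And>a x. a \<in> A \<Longrightarrow> x \<in> m \<Longrightarrow> a * x \<in> m"
    "\<And>x b. x \<in> A - m \<Longrightarrow> b \<in> A \<Longrightarrow> \<exists>a\<in>A. b - a * x \<in> m"
    using assms unfolding simple_ann_def by blast+
  show "x \<in> m \<Longrightarrow> x \<in> A" "0 \<in> m" "x \<in> m \<Longrightarrow> y \<in> m \<Longrightarrow> x - y \<in> m"
    "a \<in> A \<Longrightarrow> x \<in> m \<Longrightarrow> a * x \<in> m" "x \<in> A \<Longrightarrow> x \<notin> m \<Longrightarrow> b \<in> A \<Longrightarrow> \<exists>a\<in>A. b - a * x \<in> m"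
    using * by auto
  show "x \<in> m \<Longrightarrow> y \<in> m \<Longrightarrow> x + y \<in> m"
    using *(3)[of x "0 - y"] *(3)[of 0 y] *(2) by simp
qed

text \<open>If \<open>b\<close> does not kill some vector, simplicity makes the multiples of its
  image fill the module; since \<open>a\<close> kills all of them, it annihilates the
  module.\<close>

lemma lprim_prime:
  assumes "lprim I" "a \<in> A" "b \<in> A" "\<And>c. c \<in> A \<Longrightarrow> a * c * b \<in> I"
  shows "a \<in> I \<or> b \<in> I"
proof (rule disjCI)
  assume "b \<notin> I"
  obtain m where m: "simple_ann m" "I = {a \<in> A. \<forall>b\<in>A. a * b \<in> m}"
    using assms(1) unfolding lprim_def by blast
  obtain d where d: "d \<in> A" "b * d \<notin> m" using \<open>b \<notin> I\<close> m(2) assms(3) by blast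
  have "a * f \<in> m" if f: "f \<in> A" for f
  proof -
    obtain c where c: "c \<in> A" "f - c * (b * d) \<in> m"
      using simple_annD(6)[OF m(1) _ d(2) f] assms d by auto
    have "a * c * b \<in> I" using assms c by simp
    then have "a * c * b * d \<in> m" using d m(2) by blast
    moreover have "a * (f - c * (b * d)) \<in> m" using simple_annD(5)[OF m(1)] assms c by simp
    ultimately have "a * (f - c * (b * d)) + a * c * b * d \<in> m" by (rule simple_annD(4)[OF m(1), rotated])
    then show ?thesis by (simp add: right_diff_distrib mult.assoc)
  qed
  then show "a \<in> I" using m(2) assms by simp
qed

text \<open>An ideal containing all vertices contains all local units, which would force
  \<open>m\<close> to be all of \<open>A\<close>.\<close>

lemma lprim_proper: assumes "lprim I" shows "\<exists>v\<in>verts E. P v \<notin> I"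
proof (rule ccontr)
  assume *: "\<not> ?thesis"
  obtain m where m: "simple_ann m" "I = {a \<in> A. \<forall>b\<in>A. a * b \<in> m}"
    using assms unfolding lprim_def by blast
  have "x \<in> m" if x: "x \<in> A" for x
  proof -
    obtain V where V: "finite V" "V \<subseteq> verts E" "(\<Sum>v\<in>V. P v) * x = x"
      using local_unit[OF x] by metis
    have "(\<Sum>v\<in>V. P v) \<in> I" using assms V * by (intro tsi_sum) (auto simp: lprim_def)
    then show ?thesis using m(2) x V(3) by force
  qed
  then show False using m(1) unfolding simple_ann_def by blast
qed

lemma mono_notin:
  assumes I: "tsi I" and x: "x \<in> A" "a * x * b \<notin> I"
  obtains u p v q w where "awalk u p w" "awalk v q w" "a * (pe u p * star (pe v q)) * b \<notin> I"
proof (rule ccontr)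
  note thesisI = that
  assume "\<not> thesis"
  then have *: "a * (pe u p * star (pe v q)) * b \<in> I" if pq: "awalk u p w" "awalk v q w" for u p v q w
    using thesisI[OF pq] by blast
  have "a * x * b \<in> I"
    using x(1)
  proof (induction rule: A_induct)
    case (mono c u p v q w y)
    then show ?case
      using *[OF mono(1,2)]
      by (simp add: distrib_left distrib_right sc_mult_left sc_mult_right tsi_add[OF I] tsi_sc[OF I])
  qed (simp add: tsiD(2)[OF I])
  with x show False by simp
qed

lemma mono_range_notin:
  assumes I: "tsi I" and p: "awalk u p w" "awalk v q w" and "a \<in> A" "b \<in> A"
    and n: "a * (pe u p * star (pe v q)) * b \<notin> I"
  shows "P w \<notin> I"
proof
  assume "P w \<in> I"
  then have "a * pe u p * P w * (star (pe v q) * b) \<in> I"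
    by (intro tsiD(5)[OF I _ tsiD(4)[OF I]]) (use assms A_pe[OF p(1)] A_pe[OF p(2)] in auto)
  moreover have "w \<in> verts E" using p(1) by auto
  ultimately show False using n pe_P[OF p(1)] by (simp add: mult.assoc flip: mult.assoc[of "pe u p" "P w"])
qed

text \<open>For (MT3), primeness gives a monomial between \<open>v\<close> and \<open>w\<close>
  outside \<open>I\<close>; its path and its ghost path start at \<open>v\<close> and
  \<open>w\<close> and meet in a vertex outside \<open>I\<close>. (MT2) is CK2, and (MT1) holds
  because the vertices in \<open>I\<close> are hereditary.\<close>

lemma lprim_maximal_tail:
  assumes lp: "lprim I" shows "maximal_tail E {v \<in> verts E. P v \<notin> I}"
  unfolding maximal_tail_def
proof (intro conjI ballI impI)
  have I: "tsi I" using lp by (simp add: lprim_def)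
  show "{v \<in> verts E. P v \<notin> I} \<noteq> {}" using lprim_proper[OF lp] by auto
  fix v assume v: "v \<in> {v \<in> verts E. P v \<notin> I}"
  {
    assume out: "finite (out_arcs E v) \<and> out_arcs E v \<noteq> {}"
    show "\<exists>e\<in>out_arcs E v. head E e \<in> {v \<in> verts E. P v \<notin> I}"
    proof (rule ccontr)
      assume *: "\<not> ?thesis"
      have "P v = qs (out_arcs E v)" using CK2[of v] out v by (simp add: qs_def)
      moreover have "qs (out_arcs E v) \<in> I" using out * by (intro qs_in_ideal[OF I]) auto
      ultimately show False using v by simp
    qed
  next
    fix w assume w: "w \<in> {v \<in> verts E. P v \<notin> I}"
    obtain c where c: "c \<in> A" "P v * c * P w \<notin> I"
      using lprim_prime[OF lp, of "P v" "P w"] v w by auto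
    obtain u p u' q y where y: "awalk u p y" "awalk u' q y" "P v * (pe u p * star (pe u' q)) * P w \<notin> I"
      by (rule mono_notin[OF I c])
    have "P y \<notin> I" using mono_range_notin[OF I y(1,2) _ _ y(3)] v w by simp
    moreover have "v = u \<and> w = u'"
    proof (rule ccontr)
      assume "\<not> ?thesis"
      then have "P v * pe u p * (star (pe u' q) * P w) = 0"
        using P_pe[OF y(1)] star_pe_P[OF y(2)] v w by auto
      then show False using y(3) tsiD(2)[OF I] by (simp add: mult.assoc)
    qed
    ultimately show "\<exists>y\<in>{v \<in> verts E. P v \<notin> I}. v \<rightarrow>\<^sup>*\<^bsub>E\<^esub> y \<and> w \<rightarrow>\<^sup>*\<^bsub>E\<^esub> y"
      using y(1,2) by (intro bexI[of _ y]) (auto intro: reachable_awalkI)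
  }
next
  have I: "tsi I" using lp by (simp add: lprim_def)
  fix v w assume "v \<in> verts E" "w \<in> {v \<in> verts E. P v \<notin> I}" "v \<rightarrow>\<^sup>*\<^bsub>E\<^esub> w"
  then show "v \<in> {v \<in> verts E. P v \<notin> I}"
    using hereditary_verts[OF I] by (auto simp: reachable_awalk)
qed auto

section \<open>Breaking elements outside a primitive ideal\<close>

lemma brk_P:
  assumes "finite {e \<in> out_arcs E v. head E e \<notin> H}" "v \<in> verts E" "w \<in> verts E"
  shows "P w * brk H v = (if v = w then brk H v else 0)"
proof -
  have "P w * qs {e \<in> out_arcs E v. head E e \<notin> H} = (if v = w then qs {e \<in> out_arcs E v. head E e \<notin> H} else 0)"
  proof -
    have "{e \<in> out_arcs E v. head E e \<notin> H} \<inter> out_arcs E w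
        = (if v = w then {e \<in> out_arcs E v. head E e \<notin> H} else {})" by auto
    then have "P w * qs {e \<in> out_arcs E v. head E e \<notin> H}
        = qs (if v = w then {e \<in> out_arcs E v. head E e \<notin> H} else {})"
      by (subst P_qs) (use assms in auto)
    then show ?thesis by (simp add: qs_def)
  qed
  then show ?thesis using assms by (auto simp: brk_def P_P right_diff_distrib simp flip: qs_def)
qed

text \<open>A ghost edge whose edge occurs in the subtracted sum cancels against \<open>v\<close>;
  one that is left over passes through a vertex of \<open>I\<close>.\<close>

lemma T_brk:
  assumes I: "tsi I" "finite {e \<in> out_arcs E v. P (head E e) \<notin> I}" "v \<in> verts E" "f \<in> arcs E"
  shows "T f * brk {v \<in> verts E. P v \<in> I} v \<in> I"
proof -
  define G where "G = {e \<in> out_arcs E v. head E e \<notin> {v \<in> verts E. P v \<in> I}}"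
  have G: "G = {e \<in> out_arcs E v. P (head E e) \<notin> I}" by (auto simp: G_def)
  then have fin: "finite G" "G \<subseteq> arcs E" using assms by auto
  have "T f * brk {v \<in> verts E. P v \<in> I} v = T f * P v - T f * qs G"
    by (simp add: brk_def G_def qs_def right_diff_distrib)
  also have "\<dots> = (if f \<in> out_arcs E v \<and> P (head E f) \<in> I then T f else 0)"
    using assms fin by (auto simp: T_P_if T_qs G)
  also have "\<dots> \<in> I"
  proof (cases "P (head E f) \<in> I")
    case True
    then have "P (head E f) * T f \<in> I" using assms by (intro tsiD(5)[OF I(1)]) auto
    then show ?thesis using assms tsiD(2)[OF I(1)] by (simp add: P_T)
  qed (simp add: tsiD(2)[OF I(1)])
  finally show ?thesis .
qed

text \<open>By \<open>T_brk\<close> a ghost edge directly before the breaking element would put the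
  product into \<open>I\<close>. So the monomial provided by primeness is a plain path, and it must
  end at \<open>v\<close>.\<close>

lemma brk_notin:
  assumes lp: "lprim I" and v: "v \<in> B_set E {v \<in> verts E. P v \<in> I}"
    and n: "brk {v \<in> verts E. P v \<in> I} v \<notin> I" and a: "a \<in> A" "a \<notin> I"
  obtains u p where "awalk u p v" "a * pe u p * brk {v \<in> verts E. P v \<in> I} v \<notin> I"
proof -
  have I: "tsi I" using lp by (simp add: lprim_def)
  let ?b = "brk {v \<in> verts E. P v \<in> I} v"
  have "{e \<in> out_arcs E v. head E e \<in> verts E - {v \<in> verts E. P v \<in> I}}
      = {e \<in> out_arcs E v. P (head E e) \<notin> I}"
    "{e \<in> out_arcs E v. head E e \<notin> {v \<in> verts E. P v \<in> I}}
      = {e \<in> out_arcs E v. P (head E e) \<notin> I}" by auto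
  then have fin: "v \<in> verts E" "finite {e \<in> out_arcs E v. P (head E e) \<notin> I}"
      "finite {e \<in> out_arcs E v. head E e \<notin> {v \<in> verts E. P v \<in> I}}"
    using v by (auto simp: B_set_def)
  obtain c where c: "c \<in> A" "a * c * ?b \<notin> I"
    using lprim_prime[OF lp, of a ?b] a n fin by auto
  obtain u p u' q y where y: "awalk u p y" "awalk u' q y" "a * (pe u p * star (pe u' q)) * ?b \<notin> I"
    by (rule mono_notin[OF I c])
  have "q = []"
  proof (rule ccontr)
    assume "q \<noteq> []"
    then obtain f q' where q: "q = f # q'" by (cases q) auto
    then have f: "f \<in> arcs E" "awalk (head E f) q' y" using y(2) by (auto simp: awalk_simps)
    have "(a * (pe u p * star (pe (head E f) q'))) * (T f * ?b) \<in> I"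
      by (rule tsiD(4)[OF I _ T_brk[OF I fin(2,1) f(1)]]) (use a A_pe[OF y(1)] A_pe[OF f(2)] in auto)
    then show False using y(3) f by (simp add: q star_mult star_S mult.assoc)
  qed
  with y have u': "u' = y" "y \<in> verts E" by (auto simp: awalk_simps)
  with \<open>q = []\<close> have "a * pe u p * (P y * ?b) \<notin> I" using y(3) by (simp add: star_P mult.assoc)
  then have "y = v" using brk_P[OF fin(3,1) u'(2)] tsiD(2)[OF I] by (auto split: if_splits)
  with \<open>a * pe u p * (P y * ?b) \<notin> I\<close> y(1) show thesis
    using that brk_P[OF fin(3,1) u'(2)] by auto
qed

text \<open>Primeness would give a path \<open>p\<close> with \<open>brk H w * p * brk H v\<close>
  outside \<open>I\<close>. If \<open>p\<close> has an edge, the dual of \<open>T_brk\<close> puts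
  \<open>brk H w * p\<close> into \<open>I\<close>; if \<open>p\<close> is trivial, the product
  vanishes because the two vertices differ.\<close>

lemma brk_notin_unique:
  assumes lp: "lprim I" and v: "v \<in> B_set E {v \<in> verts E. P v \<in> I}" "brk {v \<in> verts E. P v \<in> I} v \<notin> I"
    and w: "w \<in> B_set E {v \<in> verts E. P v \<in> I}" "brk {v \<in> verts E. P v \<in> I} w \<notin> I"
  shows "v = w"
proof (rule ccontr)
  assume vw: "v \<noteq> w"
  have I: "tsi I" using lp by (simp add: lprim_def)
  let ?H = "{v \<in> verts E. P v \<in> I}"
  have "{e \<in> out_arcs E w. head E e \<in> verts E - ?H} = {e \<in> out_arcs E w. P (head E e) \<notin> I}"
    "{e \<in> out_arcs E w. head E e \<notin> ?H} = {e \<in> out_arcs E w. P (head E e) \<notin> I}" by auto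
  then have fin: "w \<in> verts E" "finite {e \<in> out_arcs E w. P (head E e) \<notin> I}"
      "finite {e \<in> out_arcs E w. head E e \<notin> ?H}"
    using w by (auto simp: B_set_def)
  have vE: "v \<in> verts E" using v by (simp add: B_set_def)
  obtain u p where p: "awalk u p v" "brk ?H w * pe u p * brk ?H v \<notin> I"
    using brk_notin[OF lp v _ w(2)] fin by auto
  have "brk ?H w * pe u p \<notin> I"
    using p(2) tsiD(5)[OF I _ , of "brk ?H v"] vE by auto
  moreover have "brk ?H w * pe u p \<in> I"
  proof (cases p)
    case Nil
    then have "P v * brk ?H w = 0" "u = v" using p(1) brk_P[OF fin(3,1) vE] vw by (auto simp: awalk_simps)
    then have "star (P v * brk ?H w) = 0" by simp
    then show ?thesis using Nil \<open>u = v\<close> fin vE tsiD(2)[OF I] by (simp add: star_mult star_brk star_P)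
  next
    case (Cons f p')
    then have f: "f \<in> arcs E" "awalk (head E f) p' v" using p(1) by (auto simp: awalk_simps)
    have H': "{v \<in> verts E. P v \<in> star ` I} = ?H" by (auto simp: star_image_iff star_P)
    have "finite {e \<in> out_arcs E w. P (head E e) \<notin> star ` I}"
      using fin(2) by (rule finite_subset[rotated]) (auto simp: star_image_iff star_P)
    from T_brk[OF tsi_star[OF I] this fin(1) f(1)]
    have "T f * brk ?H w \<in> star ` I" by (simp only: H')
    then have "brk ?H w * S f \<in> I"
      using fin f by (simp add: star_image_iff star_mult star_brk star_T)
    then have "brk ?H w * S f * pe (head E f) p' \<in> I" by (rule tsiD(5)[OF I A_pe[OF f(2)]])
    then show ?thesis by (simp add: Cons mult.assoc)
  qed
  ultimately show False by simp
qed

text \<open>Applying \<open>brk_notin\<close> to a vertex outside \<open>I\<close> yields a path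
  from it to \<open>v\<close>; conversely, a vertex of \<open>I\<close> cannot reach
  \<open>v\<close>, which lies outside.\<close>

lemma brk_notin_Omega:
  assumes lp: "lprim I" and v: "v \<in> B_set E {v \<in> verts E. P v \<in> I}" "brk {v \<in> verts E. P v \<in> I} v \<notin> I"
  shows "{v \<in> verts E. P v \<in> I} = Omega E {v}" "v \<in> BV E"
proof -
  have I: "tsi I" using lp by (simp add: lprim_def)
  have vE: "v \<in> verts E" "P v \<notin> I" using v by (auto simp: B_set_def)
  have "w \<rightarrow>\<^sup>*\<^bsub>E\<^esub> v" if w: "w \<in> verts E" "P w \<notin> I" for w
  proof -
    obtain u p where p: "awalk u p v" "P w * pe u p * brk {v \<in> verts E. P v \<in> I} v \<notin> I"
      using brk_notin[OF lp v _ w(2)] w by auto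
    then have "w = u" using P_pe[OF p(1) w(1)] tsiD(2)[OF I] by (auto split: if_splits)
    then show ?thesis using p by (auto intro: reachable_awalkI)
  qed
  then show *: "{v \<in> verts E. P v \<in> I} = Omega E {v}"
    using vE hereditary_verts[OF I] by (auto simp: Omega_def reachable_awalk)
  have "{e \<in> out_arcs E v. head E e \<in> verts E - Omega E {v}} = {e \<in> out_arcs E v. head E e \<notin> Omega E {v}}"
    by auto
  note ** = this
  show "v \<in> BV E"
    using v(1)[unfolded *] unfolding B_set_def BV_def mem_Collect_eq ** by blast
qed

end

section \<open>A cycle without exit modulo a graded ideal\<close>

locale no_exit_cycle = graded_leavitt E sc P S T star proj
  for E :: "('v, 'e) pre_digraph" and sc :: "'k::field \<Rightarrow> 'a::ring \<Rightarrow> 'a"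
    and P :: "'v \<Rightarrow> 'a" and S T :: "'e \<Rightarrow> 'a" and star :: "'a \<Rightarrow> 'a" and proj :: "int \<Rightarrow> 'a \<Rightarrow> 'a" +
  fixes I :: "'a set" and c :: "'e list" and u :: 'v
  assumes gr: "graded I"
    and u: "P u \<notin> I"
    and c: "c \<noteq> []" "awalk u c u"
    and simple: "\<And>i. 0 < i \<Longrightarrow> i < length c \<Longrightarrow> tail E (c ! i) \<noteq> u"
    and c_heads: "\<And>e. e \<in> set c \<Longrightarrow> P (head E e) \<notin> I"
    and no_exit: "\<And>e f. e \<in> set c \<Longrightarrow> f \<in> arcs E \<Longrightarrow> tail E f = tail E e \<Longrightarrow> P (head E f) \<notin> I \<Longrightarrow> f = e"
    and brkI: "\<And>v. v \<in> B_set E {v \<in> verts E. P v \<in> I} \<Longrightarrow> brk {v \<in> verts E. P v \<in> I} v \<in> I"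
begin

lemma I: "tsi I"
  using gr by (simp add: graded_def)

lemma proj_I: "x \<in> I \<Longrightarrow> proj k x \<in> I"
  using gr by (simp add: graded_def)

lemma uE: "u \<in> verts E"
  using c by auto

definition Z :: "'v set" where "Z = tail E ` set c"

lemma hd_c: "tail E (hd c) = u" "tail E (c ! 0) = u"
  using c by (cases c; auto simp: awalk_simps)+

lemma u_Z: "u \<in> Z"
  unfolding Z_def using hd_c c(1) by (metis hd_in_set image_eqI)

lemma heads_Z: "e \<in> set c \<Longrightarrow> head E e \<in> Z"
proof -
  have "head E ` set p \<subseteq> tail E ` set p \<union> {y}" if "awalk w p y" for w p y
    using that
  proof (induction p arbitrary: w)
    case (Cons e p)
    then have "awalk (head E e) p y" by (simp add: awalk_simps)
    moreover from this have "head E e \<in> tail E ` set p \<union> {y}"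
      by (cases p) (auto simp: awalk_simps)
    ultimately show ?case using Cons.IH by auto
  qed simp
  from this[OF c(2)] show "e \<in> set c \<Longrightarrow> head E e \<in> Z"
    using u_Z by (auto simp: Z_def)
qed

abbreviation live :: "'e list \<Rightarrow> bool" where
  "live p \<equiv> \<forall>e\<in>set p. P (head E e) \<notin> I"

lemma live_edge:
  assumes "e \<in> arcs E" "tail E e \<in> Z" "P (head E e) \<notin> I" shows "e \<in> set c"
  using assms no_exit by (auto simp: Z_def)

text \<open>At each vertex of the cycle a single edge ends outside \<open>I\<close>, so a live path
  is determined by its start and its length.\<close>

lemma live_unique:
  "awalk z p x \<Longrightarrow> awalk z q y \<Longrightarrow> live p \<Longrightarrow> live q \<Longrightarrow> z \<in> Z \<Longrightarrow> length p \<le> length q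
    \<Longrightarrow> p = take (length p) q"
proof (induction p arbitrary: z q)
  case (Cons e p)
  then obtain f q' where q: "q = f # q'" by (cases q) auto
  have "e \<in> set c" "f \<in> arcs E" "tail E f = tail E e"
    using Cons.prems live_edge by (auto simp: q awalk_simps)
  then have "f = e" using no_exit Cons.prems by (auto simp: q)
  moreover have "p = take (length p) q'"
    using Cons.prems \<open>f = e\<close> \<open>e \<in> set c\<close> heads_Z by (intro Cons.IH[of "head E e"]) (auto simp: q awalk_simps)
  ultimately show ?case by (simp add: q)
qed simp

definition cp :: "nat \<Rightarrow> 'e list" where "cp i = concat (replicate i c)"

lemma cp_walk: "awalk u (cp i) u"
  unfolding cp_def by (induction i) (simp_all add: awalk_simps uE awalk_appendI[OF c(2)] del: awalk_append_iff)

lemma cp_live: "live (cp i)"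
  unfolding cp_def using c_heads by (induction i) auto

lemma cp_len: "length (cp i) = i * length c"
  unfolding cp_def by (induction i) auto

lemma cp_add: "cp (i + j) = cp i @ cp j"
  unfolding cp_def by (simp add: replicate_add)

text \<open>A live closed path at \<open>u\<close> follows \<open>c\<close>. It cannot stop earlier,
  since \<open>c\<close> passes through \<open>u\<close> only at its ends, so a copy of
  \<open>c\<close> splits off at the front.\<close>

lemma closed_walk_power: "awalk u p u \<Longrightarrow> live p \<Longrightarrow> \<exists>i. p = cp i"
proof (induction "length p" arbitrary: p rule: less_induct)
  case less
  show ?case
  proof (cases "p = []")
    case True
    then show ?thesis by (intro exI[of _ 0]) (simp add: cp_def)
  next
    case ne: False
    have "length c \<le> length p"
    proof (rule ccontr)
      assume len: "\<not> length c \<le> length p"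
      then have "p = take (length p) c"
        using live_unique[OF less.prems(1) c(2) less.prems(2)] c_heads u_Z by auto
      then obtain r where r: "c = p @ r" by (metis append_take_drop_id)
      with len have "r \<noteq> []" by auto
      have "awalk u r u" using c(2) less.prems(1) by (auto simp: r elim: awalkE')
      then have "tail E (hd r) = u" using \<open>r \<noteq> []\<close> by (cases r) (auto simp: awalk_simps)
      then have "tail E (c ! length p) = u" using \<open>r \<noteq> []\<close> by (simp add: r nth_append hd_conv_nth)
      then show False using simple[of "length p"] ne len by auto
    qed
    then have "c = take (length c) p"
      using live_unique[OF c(2) less.prems(1) _ less.prems(2) u_Z] c_heads by auto
    then obtain r where r: "p = c @ r" by (metis append_take_drop_id)
    have "awalk u r u" using c(2) less.prems(1) by (auto simp: r elim: awalkE')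
    moreover have "live r" using less.prems(2) by (auto simp: r)
    ultimately obtain i where "r = cp i" using less.hyps[of r] c(1) by (auto simp: r)
    then have "p = cp (Suc i)" by (simp add: r cp_def)
    then show ?thesis ..
  qed
qed

text \<open>At a finite emitter this is CK2 with the edges into \<open>I\<close> dropped. At an
  infinite emitter CK2 is absent, and the assumption \<open>brkI\<close> on the breaking elements
  takes its place.\<close>

lemma edge_mod: assumes e: "e \<in> set c" shows "P (tail E e) - S e * T e \<in> I"
proof -
  let ?H = "{v \<in> verts E. P v \<in> I}" and ?z = "tail E e"
  have eE: "e \<in> arcs E" using e c by auto
  have F: "{f \<in> out_arcs E ?z. head E f \<notin> ?H} = {e}"
    using eE no_exit[OF e] c_heads[OF e] by auto
  then have b: "brk ?H ?z = P ?z - S e * T e" by (simp add: brk_def)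
  show ?thesis
  proof (cases "finite (out_arcs E ?z)")
    case True
    have "out_arcs E ?z \<noteq> {}" using eE by auto
    then have "P ?z = qs (out_arcs E ?z)" using CK2[OF _ True] eE by (simp add: qs_def)
    also have "\<dots> = S e * T e + qs (out_arcs E ?z - {e})"
      unfolding qs_def using eE by (subst sum.remove[OF True]) auto
    finally have "P ?z - S e * T e = qs (out_arcs E ?z - {e})" by simp
    also have "\<dots> \<in> I" by (rule qs_in_ideal[OF I]) (use True F in auto)
    finally show ?thesis .
  next
    case False
    have zE: "P ?z \<notin> I" using head_in_ideal[OF I eE] c_heads[OF e] by blast
    have "{f \<in> out_arcs E ?z. head E f \<in> verts E - ?H} = {f \<in> out_arcs E ?z. head E f \<notin> ?H}" by auto
    then have X: "{f \<in> out_arcs E ?z. head E f \<in> verts E - ?H} = {e}" by (simp only: F)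
    have "?z \<in> B_set E ?H" unfolding B_set_def mem_Collect_eq X using False eE zE by simp
    from brkI[OF this] show ?thesis by (simp only: b)
  qed
qed

text \<open>Nests \<open>edge_mod\<close> along the path: at every vertex on the way the live edge
  accounts for the whole vertex modulo \<open>I\<close>.\<close>

lemma walk_mod:
  "awalk z p y \<Longrightarrow> z \<in> Z \<Longrightarrow> live p \<Longrightarrow> P z - pe z p * star (pe z p) \<in> I"
proof (induction p arbitrary: z)
  case Nil
  then have "z = y" "P z - pe z [] * star (pe z []) = 0" by (auto simp: awalk_simps star_P P_P)
  then show ?case by (simp only: tsiD(2)[OF I])
next
  case (Cons e p)
  have e: "e \<in> arcs E" "tail E e = z" "awalk (head E e) p y" "e \<in> set c"
    using Cons.prems live_edge by (auto simp: awalk_simps)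
  have "P (head E e) - pe (head E e) p * star (pe (head E e) p) \<in> I"
    using Cons e heads_Z by auto
  then have "S e * (P (head E e) - pe (head E e) p * star (pe (head E e) p)) * T e \<in> I"
    using e by (intro tsiD(5)[OF I _ tsiD(4)[OF I]]) auto
  moreover have "S e * P (head E e) * T e = S e * T e" using e by (simp add: S_P)
  ultimately have "S e * T e - pe z (e # p) * star (pe z (e # p)) \<in> I"
    using e by (simp add: right_diff_distrib left_diff_distrib star_mult star_S mult.assoc)
  from tsi_add[OF I edge_mod[OF e(4)] this] show ?case using e by simp
qed

abbreviation pc :: "nat \<Rightarrow> 'a" where "pc i \<equiv> pe u (cp i)"

text \<open>The powers of the Laurent variable modulo \<open>I\<close>, with ghost paths as the
  negative ones.\<close>

definition cz :: "int \<Rightarrow> 'a" where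
  "cz k = (if k \<ge> 0 then pc (nat k) else star (pc (nat (- k))))"

lemma A_pc [simp]: "pc i \<in> A"
  using A_pe[OF cp_walk] .

lemma pc_add: "pc (i + j) = pc i * pc j"
  by (simp add: cp_add pe_append[OF cp_walk cp_walk])

lemma pc_P: "pc i * P u = pc i" "P u * pc i = pc i" "star (pc i) * P u = star (pc i)"
    "P u * star (pc i) = star (pc i)" "star (pc i) * pc i = P u"
  using pe_P[OF cp_walk uE] P_pe[OF cp_walk uE] star_pe_P[OF cp_walk uE] P_star_pe[OF cp_walk uE]
    star_pe_pe_same[OF cp_walk] by simp_all

lemma cz_P: "cz k * P u = cz k" "P u * cz k = cz k"
  by (simp_all add: cz_def pc_P)

lemma cz_0: "cz 0 = P u"
  by (simp add: cz_def cp_def)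

lemma cz_AK: "cz k \<in> AK (k * int (length c))"
proof (cases "k \<ge> 0")
  case True
  then show ?thesis using Mset_AK[OF Mset_pe[OF cp_walk[of "nat k"]]] by (simp add: cz_def cp_len)
next
  case False
  then show ?thesis
    using AK_star[OF Mset_AK[OF Mset_pe[OF cp_walk[of "nat (- k)"]]]] by (simp add: cz_def cp_len)
qed

lemma A_cz [simp]: "cz k \<in> A"
  using cz_AK AK_A by blast

lemma cz_notin: "cz k \<notin> I"
proof
  assume *: "cz k \<in> I"
  have "P u \<in> I"
  proof (cases "k \<ge> 0")
    case True
    then have "star (pc (nat k)) * pc (nat k) \<in> I" using * tsiD(4)[OF I, of "star (pc (nat k))"] by (simp add: cz_def)
    then show ?thesis by (simp add: pc_P)
  next
    case False
    then have "star (pc (nat (- k))) * pc (nat (- k)) \<in> I" using * tsiD(5)[OF I] by (simp add: cz_def)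
    then show ?thesis by (simp add: pc_P)
  qed
  then show False using u by simp
qed

text \<open>The common powers meet in the middle, where \<open>walk_mod\<close> replaces them by
  \<open>P u\<close>; the surplus on one side is the Laurent power.\<close>

lemma pc_star_pc: "pc i * star (pc j) - cz (int i - int j) \<in> I"
proof (cases "j \<le> i")
  case True
  then obtain d where i: "i = d + j" by (metis le_add_diff_inverse2)
  have "pc d * (P u - pc j * star (pc j)) \<in> I"
    using walk_mod[OF cp_walk u_Z cp_live] by (intro tsiD(4)[OF I]) auto
  then have "- (pc d * (P u - pc j * star (pc j))) \<in> I" by (rule tsi_uminus[OF I])
  moreover have "- (pc d * (P u - pc j * star (pc j))) = pc i * star (pc j) - cz (int i - int j)"
    by (simp add: i cz_def pc_add pc_P right_diff_distrib mult.assoc)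
  ultimately show ?thesis by simp
next
  case False
  then obtain d where j: "j = d + i" by (metis le_add_diff_inverse2 nat_le_linear)
  have d: "d > 0" using False j by simp
  have "(P u - pc i * star (pc i)) * star (pc d) \<in> I"
    using walk_mod[OF cp_walk u_Z cp_live] by (intro tsiD(5)[OF I]) auto
  then have "- ((P u - pc i * star (pc i)) * star (pc d)) \<in> I" by (rule tsi_uminus[OF I])
  moreover have "- ((P u - pc i * star (pc i)) * star (pc d)) = pc i * star (pc j) - cz (int i - int j)"
    using d by (simp add: j cz_def pc_add pc_P left_diff_distrib mult.assoc star_mult)
  ultimately show ?thesis by simp
qed

lemma cz_neg: "cz (- int n) = star (pc n)"
  by (cases "n = 0") (simp_all add: cz_def cp_def star_P uE)

text \<open>The ideal enters only when a path is multiplied by a ghost path on its right; for the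
  other sign patterns the paths concatenate or cancel exactly.\<close>

lemma cz_mult: "cz k * cz l - cz (k + l) \<in> I"
proof -
  consider i j where "k = int i" "l = int j" | i j where "k = - int i" "l = - int j"
    | i j where "k = int i" "l = - int j" | i j where "k = - int i" "l = int j"
    by (metis int_cases2)
  then show ?thesis
  proof cases
    case 1
    then show ?thesis by (simp add: cz_def nat_add_distrib pc_add tsiD(2)[OF I])
  next
    case 2
    have "- int i + - int j = - int (j + i)" by simp
    then have "cz k * cz l = cz (k + l)"
      using 2 cz_neg[of "j + i"] by (simp only: cz_neg pc_add star_mult)
    then show ?thesis by (simp add: tsiD(2)[OF I])
  next
    case 3
    show ?thesis using pc_star_pc[of i j] 3 by (simp add: cz_neg) (simp add: cz_def)
  next
    case 4
    have "cz k * cz l = cz (k + l)"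
    proof (cases "i \<le> j")
      case True
      then obtain d where d: "j = i + d" by (metis le_Suc_ex)
      have "star (pc i) * pc (i + d) = pc d"
        by (simp add: pc_add pc_P flip: mult.assoc)
      then show ?thesis using 4 d by (simp add: cz_neg) (simp add: cz_def nat_add_distrib)
    next
      case False
      then obtain d where d: "i = j + d" by (metis nat_le_linear le_Suc_ex)
      have "star (pc (j + d)) * pc j = star (pc d)"
        by (simp add: pc_add star_mult mult.assoc pc_P)
      moreover have "cz k = star (pc (j + d))" unfolding 4(1) d by (rule cz_neg)
      moreover have "cz l = pc j" using 4 by (simp add: cz_def)
      moreover have kl: "k + l = - int d" using 4 d by simp
      moreover have "cz (k + l) = star (pc d)" unfolding kl by (rule cz_neg)
      ultimately show ?thesis by simp
    qed
    then show ?thesis by (simp add: tsiD(2)[OF I])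
  qed
qed

text \<open>Laurent polynomials in \<open>c\<close>, serving as representatives for the corner at
  \<open>u\<close> modulo \<open>I\<close>.\<close>

definition L :: "'a set" where "L = span (range cz)"

lemma L_A: "x \<in> L \<Longrightarrow> x \<in> A"
  unfolding L_def by (induction rule: span_induct_alt) auto

lemma cz_L: "cz k \<in> L"
  by (simp add: L_def span_base)

lemma mod_trans: "x - y \<in> I \<Longrightarrow> y - z \<in> I \<Longrightarrow> x - z \<in> I"
  using tsi_add[OF I, of "x - y" "y - z"] by simp

lemma mod_sym: "x - y \<in> I \<Longrightarrow> y - x \<in> I"
  using tsi_uminus[OF I, of "x - y"] by simp

text \<open>If the common range \<open>w\<close> of the two paths lies outside \<open>I\<close>, it
  is on the cycle. Completing both paths by the rest \<open>d\<close> of the cycle turns them into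
  powers of \<open>c\<close>, and by \<open>walk_mod\<close> the inserted factor is
  \<open>P w\<close> modulo \<open>I\<close>.\<close>

lemma mono_corner:
  assumes "awalk a p w" "awalk b q w"
  shows "\<exists>y\<in>L. P u * (pe a p * star (pe b q)) * P u - y \<in> I"
proof (cases "a = u \<and> b = u \<and> P w \<notin> I")
  case False
  have "P u * (pe a p * star (pe b q)) * P u \<in> I"
  proof (cases "a = u \<and> b = u")
    case True
    then have "P w \<in> I" using False by simp
    then have "P u * pe a p * P w * (star (pe b q) * P u) \<in> I"
      by (intro tsiD(5)[OF I _ tsiD(4)[OF I]]) (use uE A_pe[OF assms(1)] A_pe[OF assms(2)] in auto)
    moreover have "pe a p * P w = pe a p" using pe_P[OF assms(1), of w] assms by auto
    ultimately show ?thesis by (metis mult.assoc)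
  next
    case False
    then have "P u * pe a p * (star (pe b q) * P u) = 0"
      using P_pe[OF assms(1) uE] star_pe_P[OF assms(2) uE] by auto
    then show ?thesis by (simp add: mult.assoc tsiD(2)[OF I])
  qed
  then show ?thesis using span_zero by (intro bexI[of _ 0]) (auto simp: L_def)
next
  case True
  have live: "live r" if "awalk x r w" for x r
    using that
  proof (induction r arbitrary: x)
    case (Cons e r)
    then show ?case using hereditary_verts[OF I, of "head E e" r w] True by (auto simp: awalk_simps)
  qed simp
  \<comment> \<open>A live path that starts on the cycle cannot leave it.\<close>
  have live_Z: "y \<in> Z" if "awalk x r y" "x \<in> Z" "live r" for x r y
    using that
  proof (induction r arbitrary: x)
    case (Cons e r)
    then have "e \<in> set c" using live_edge by (auto simp: awalk_simps)
    then show ?case using Cons heads_Z by (auto simp: awalk_simps)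
  qed (auto simp: awalk_simps)
  have "w \<in> Z" using live_Z[OF assms(1)] live[OF assms(1)] True u_Z by simp
  then obtain i where i: "i < length c" "w = tail E (c ! i)" by (auto simp: Z_def in_set_conv_nth)
  define d where "d = drop i c"
  have d: "awalk w d u" "live d"
  proof -
    have "awalk u (take i c @ d) u" using c by (simp add: d_def)
    then have *: "awalk (awlast u (take i c)) d u" by (simp only: awalk_append_iff)
    moreover have "awlast u (take i c) = w"
      using * i by (simp add: d_def Cons_nth_drop_Suc[symmetric] awalk_simps)
    ultimately show "awalk w d u" by simp
    show "live d" using c_heads by (auto simp: d_def dest: in_set_dropD)
  qed
  have pw: "awalk u p w" "awalk u q w" using assms True by auto
  obtain i where i: "p @ d = cp i"
    using closed_walk_power[OF awalk_appendI[OF pw(1) d(1)]] live[OF pw(1)] d(2) by auto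
  obtain j where j: "q @ d = cp j"
    using closed_walk_power[OF awalk_appendI[OF pw(2) d(1)]] live[OF pw(2)] d(2) by auto
  have "pe u p * (P w - pe w d * star (pe w d)) * star (pe u q) \<in> I"
    using walk_mod[OF d(1) \<open>w \<in> Z\<close> d(2)] A_pe[OF pw(1)] A_pe[OF pw(2)]
    by (intro tsiD(5)[OF I _ tsiD(4)[OF I]]) auto
  moreover have "pe u p * P w = pe u p" using pe_P[OF pw(1), of w] pw by auto
  moreover have "pc i * star (pc j) = pe u p * (pe w d * star (pe w d)) * star (pe u q)"
    by (simp add: i[symmetric] j[symmetric] pe_append[OF pw(1) d(1)] pe_append[OF pw(2) d(1)] star_mult mult.assoc)
  ultimately have "pe u p * star (pe u q) - pc i * star (pc j) \<in> I"
    by (simp add: right_diff_distrib left_diff_distrib)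
  then have "pe u p * star (pe u q) - cz (int i - int j) \<in> I"
    using pc_star_pc mod_trans by blast
  moreover have "P u * (pe a p * star (pe b q)) * P u = pe u p * star (pe u q)"
    using True P_pe[OF pw(1) uE] star_pe_P[OF pw(2) uE] by (simp add: mult.assoc) (simp flip: mult.assoc)
  ultimately show ?thesis using cz_L by metis
qed

lemma corner_L:
  assumes "x \<in> A" shows "\<exists>y\<in>L. P u * x * P u - y \<in> I"
  using assms
proof (induction rule: A_induct)
  case zero
  then show ?case using span_zero by (intro bexI[of _ 0]) (auto simp: L_def tsiD(2)[OF I])
next
  case (mono a v p w q x y)
  obtain y1 where y1: "y1 \<in> L" "P u * (pe v p * star (pe w q)) * P u - y1 \<in> I"
    using mono_corner[OF mono(1,2)] by blast
  obtain y2 where y2: "y2 \<in> L" "P u * y * P u - y2 \<in> I" using mono by blast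
  have "sc a (P u * (pe v p * star (pe w q)) * P u - y1) + (P u * y * P u - y2) \<in> I"
    by (intro tsi_add[OF I] tsi_sc[OF I] y1 y2)
  moreover have "sc a (P u * (pe v p * star (pe w q)) * P u - y1) + (P u * y * P u - y2)
     = P u * (sc a (pe v p * star (pe w q)) + y) * P u - (sc a y1 + y2)"
    by (simp add: scale_right_diff_distrib distrib_left distrib_right sc_mult_left sc_mult_right)
  moreover have "sc a y1 + y2 \<in> L" using y1 y2 by (simp add: L_def span_add span_scale)
  ultimately show ?case by metis
qed

lemma L_comm:
  assumes "x \<in> L" "y \<in> L" shows "x * y - y * x \<in> I"
proof -
  have 1: "cz k * y - y * cz k \<in> I" if "y \<in> L" for k y
    using that unfolding L_def
  proof (induction rule: span_induct_alt)
    case base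
    then show ?case by (simp add: tsiD(2)[OF I])
  next
    case (step a b z)
    then obtain l where b: "b = cz l" by blast
    have "cz k * b - b * cz k \<in> I"
      using mod_trans[OF cz_mult[of k l] mod_sym[OF cz_mult[of l k, unfolded add.commute[of l k]]]] by (simp add: b)
    then have "sc a (cz k * b - b * cz k) + (cz k * z - z * cz k) \<in> I"
      using step by (intro tsi_add[OF I] tsi_sc[OF I])
    then show ?case
      by (simp add: distrib_left distrib_right sc_mult_left sc_mult_right scale_right_diff_distrib algebra_simps)
  qed
  show ?thesis
    using assms(1) unfolding L_def
  proof (induction rule: span_induct_alt)
    case base
    then show ?case by (simp add: tsiD(2)[OF I])
  next
    case (step a b z)
    then have "b * y - y * b \<in> I" using 1[OF assms(2)] by blast
    then have "sc a (b * y - y * b) + (z * y - y * z) \<in> I"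
      using step by (intro tsi_add[OF I] tsi_sc[OF I])
    then show ?case
      by (simp add: distrib_left distrib_right sc_mult_left sc_mult_right scale_right_diff_distrib algebra_simps)
  qed
qed

text \<open>In the corner at \<open>u\<close>, which is the Laurent polynomial ring modulo \<open>I\<close>, the element
  \<open>1 + c\<close> has no inverse: a quasi-inverse would have coefficients alternating forever.\<close>

lemma L_not_invertible:
  assumes y: "y \<in> L" shows "P u - y * (P u + cz 1) \<notin> I"
proof
  assume *: "P u - y * (P u + cz 1) \<in> I"
  let ?n = "int (length c)"
  have n: "?n > 0" using c by simp
  \<comment> \<open>As \<open>cz k\<close> has degree \<open>k * length c\<close>, the projection to
    that degree isolates its coefficient.\<close>
  have "\<forall>k. \<exists>a. proj (k * ?n) y = sc a (cz k)"
    using y unfolding L_def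
  proof (induction rule: span_induct_alt)
    case base
    show ?case by (auto intro: exI[of _ 0])
  next
    case (step b x z)
    then obtain l where l: "x = cz l" by blast
    show ?case
    proof
      fix k
      obtain a where "proj (k * ?n) z = sc a (cz k)" using step by blast
      then have "proj (k * ?n) (sc b x + z) = sc ((if k = l then b else 0) + a) (cz k)"
        using n by (auto simp: proj_add proj_sc l proj_AK[OF cz_AK] scale_left_distrib)
      then show "\<exists>a. proj (k * ?n) (sc b x + z) = sc a (cz k)" by blast
    qed
  qed
  then obtain a where a: "\<And>k. proj (k * ?n) y = sc (a k) (cz k)" by metis
  have shift: "proj k (x * cz 1) = proj (k - ?n) x * cz 1" if "x \<in> L" for k x
    using that unfolding L_def
  proof (induction rule: span_induct_alt)
    case (step b x z)
    then obtain l where l: "x = cz l" by blast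
    have "cz l * cz 1 \<in> AK (l * ?n + ?n)" using AK_mult[OF cz_AK[of l] cz_AK[of 1]] by simp
    then have "proj k (x * cz 1) = proj (k - ?n) x * cz 1"
      by (auto simp: l proj_AK[OF cz_AK[of l]] proj_AK)
    then show ?case using step by (simp add: distrib_right proj_add proj_sc sc_mult_left)
  qed simp
  have yP: "y * P u = y" using y unfolding L_def
    by (induction rule: span_induct_alt) (auto simp: distrib_right sc_mult_left cz_P)
  \<comment> \<open>Compares the coefficients of the \<open>k\<close>-th power in
    \<open>1 = y (1 + c)\<close>. This can be done modulo \<open>I\<close> because \<open>I\<close>
    is graded and contains no \<open>cz k\<close>.\<close>
  have rec: "a k + a (k - 1) = (if k = 0 then 1 else 0)" for k
  proof -
    have "proj (k * ?n) (P u - y * (P u + cz 1)) \<in> I" by (rule proj_I[OF *])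
    moreover have "proj (k * ?n) (P u) = sc (if k = 0 then 1 else 0) (cz k)"
      using n proj_AK[OF cz_AK[of 0], of "k * ?n"] by (auto simp: cz_0)
    moreover have "proj (k * ?n) (y * (P u + cz 1)) = sc (a k) (cz k) + sc (a (k - 1)) (cz (k - 1) * cz 1)"
      using a[of "k - 1"] by (simp add: distrib_left yP proj_add shift[OF y] a sc_mult_left left_diff_distrib)
    ultimately have 1: "sc (if k = 0 then 1 else 0) (cz k) - (sc (a k) (cz k) + sc (a (k - 1)) (cz (k - 1) * cz 1)) \<in> I"
      by (simp only: proj_diff)
    have "sc (a (k - 1)) (cz (k - 1) * cz 1 - cz k) \<in> I"
      using cz_mult[of "k - 1" 1] by (intro tsi_sc[OF I]) simp
    from tsi_add[OF I 1 this]
    have "sc ((if k = 0 then 1 else 0) - a k - a (k - 1)) (cz k) \<in> I"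
      by (simp add: scale_left_diff_distrib scale_right_diff_distrib algebra_simps)
    then have "sc (inverse ((if k = 0 then 1 else 0) - a k - a (k - 1))) (sc ((if k = 0 then 1 else 0) - a k - a (k - 1)) (cz k)) \<in> I"
      by (rule tsi_sc[OF I])
    then have "(if k = 0 then 1 else 0) - a k - a (k - 1) = 0"
      using cz_notin[of k] by (cases "(if k = 0 then 1 else 0) - a k - a (k - 1) = 0") auto
    then show ?thesis by (simp add: algebra_simps)
  qed
  have "(\<lambda>k. k * ?n) ` {k. a k \<noteq> 0} \<subseteq> {k. proj k y \<noteq> 0}"
    using cz_notin tsiD(2)[OF I] by (auto simp: a) (metis)
  then have "finite ((\<lambda>k. k * ?n) ` {k. a k \<noteq> 0})"
    using proj_decomp(1)[OF L_A[OF y]] finite_subset by blast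
  then have fin: "finite {k. a k \<noteq> 0}"
    by (rule finite_imageD) (use n in \<open>auto simp: inj_on_def\<close>)
  show False
  \<comment> \<open>The coefficients \<open>a 0\<close> and \<open>a (- 1)\<close> add up to
    \<open>1\<close>, so one of them is nonzero. By the recursion the nonzero coefficients then
    continue without end, upwards from \<open>0\<close> or downwards from
    \<open>- 1\<close>.\<close>
  proof (cases "a 0 = 0")
    case False
    have "a (int i) \<noteq> 0" for i
    proof (induction i)
      case (Suc i)
      then show ?case using rec[of "int (Suc i)"] by auto
    qed (use False in simp)
    then have "range int \<subseteq> {k. a k \<noteq> 0}" by auto
    moreover have "infinite (range int)" by (simp add: finite_image_iff)
    ultimately show False using fin finite_subset by blast
  next
    case True
    have "a (- 1 - int i) \<noteq> 0" for i
    proof (induction i)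
      case 0
      then show ?case using rec[of 0] True by auto
    next
      case (Suc i)
      have e: "- 1 - int i - 1 = - 1 - int (Suc i)" by simp
      show ?case using Suc rec[of "- 1 - int i"] unfolding e by auto
    qed
    then have "range (\<lambda>i. - 1 - int i) \<subseteq> {k. a k \<noteq> 0}" by auto
    moreover have "infinite (range (\<lambda>i. - 1 - int i))" by (simp add: finite_image_iff inj_on_def)
    ultimately show False using fin finite_subset by blast
  qed
qed

text \<open>Write \<open>g\<close> for \<open>1 + c\<close> and take a vector \<open>n\<close> at
  \<open>u\<close> that \<open>g\<close> does not kill. Simplicity provides a Laurent polynomial
  \<open>y\<close> such that \<open>1 - y g\<close> kills \<open>n\<close>. The corner at
  \<open>u\<close> is commutative modulo \<open>I\<close>, so \<open>1 - y g\<close> kills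
  everything generated by \<open>n\<close>, which is the whole module. Then it lies in
  \<open>I\<close>, against \<open>L_not_invertible\<close>.\<close>

lemma not_lprim: "\<not> lprim I"
proof
  assume "lprim I"
  then obtain m where m: "simple_ann m" "I = {a \<in> A. \<forall>b\<in>A. a * b \<in> m}"
    unfolding lprim_def by blast
  note mD = simple_annD[OF m(1)]
  have Im: "i * x \<in> m" if "i \<in> I" "x \<in> A" for i x using that m(2) by blast
  define g where "g = P u + cz 1"
  have gA: "g \<in> A" using uE by (simp add: g_def)
  have gP: "g * P u = g" "P u * g = g" using uE by (simp_all add: g_def distrib_left distrib_right cz_P P_P)
  have gL: "g \<in> L" unfolding g_def cz_0[symmetric] L_def by (intro span_add span_base) auto
  have "g \<notin> I"
  proof
    assume "g \<in> I"
    then have "proj 0 g \<in> I" by (rule proj_I)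
    moreover have "proj 0 g = P u"
      using c proj_AK[OF cz_AK[of 0], of 0] proj_AK[OF cz_AK[of 1], of 0]
      by (simp add: g_def proj_add cz_0)
    ultimately show False using u by simp
  qed
  then obtain d where d: "d \<in> A" "g * d \<notin> m" using m(2) gA by blast
  define n where "n = P u * d"
  have n: "n \<in> A" "g * n \<notin> m" "P u * n = n"
    using d uE gP by (simp_all add: n_def P_P flip: mult.assoc)
  have nm: "n \<notin> m" using n(2) mD(5)[OF gA] by blast
  obtain a where a: "a \<in> A" "n - a * (g * n) \<in> m"
    using mD(6)[OF _ n(2) n(1)] gA n by auto
  obtain y where y: "y \<in> L" "P u * a * P u - y \<in> I" using corner_L[OF a(1)] by blast
  define z where "z = P u - y * g"
  have yA: "y \<in> A" by (rule L_A[OF y(1)])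
  have zA: "z \<in> A" using uE yA gA by (simp add: z_def)
  have zP: "z * P u = z" using uE by (simp add: z_def left_diff_distrib P_P mult.assoc gP)
  have zn: "z * n \<in> m"
  proof -
    have "P u * (n - a * (g * n)) \<in> m" using a uE by (intro mD(5)) auto
    moreover have "(P u * a * P u - y) * (g * n) \<in> m" using gA n by (intro Im[OF y(2)]) auto
    ultimately have "P u * (n - a * (g * n)) + (P u * a * P u - y) * (g * n) \<in> m" by (rule mD(4))
    moreover have "P u * (n - a * (g * n)) + (P u * a * P u - y) * (g * n) = z * n"
    proof -
      have "P u * a * P u * (g * n) = P u * (a * (g * n))" using gP by (metis mult.assoc)
      then show ?thesis using n(3) by (simp add: z_def left_diff_distrib right_diff_distrib mult.assoc)
    qed
    ultimately show ?thesis by simp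
  qed
  have comm: "z * x - x * z \<in> I" if x: "x \<in> L" for x
  proof -
    have xA: "x \<in> A" by (rule L_A[OF x])
    have "P u * x - x * P u \<in> I" using L_comm[OF cz_L[of 0] x] by (simp add: cz_0)
    moreover have "(x * y - y * x) * g + y * (x * g - g * x) \<in> I"
      using L_comm[OF x y(1)] L_comm[OF x gL] gA yA
      by (intro tsi_add[OF I] tsiD(4)[OF I] tsiD(5)[OF I])
    ultimately have "P u * x - x * P u + ((x * y - y * x) * g + y * (x * g - g * x)) \<in> I"
      by (rule tsi_add[OF I])
    then show ?thesis by (simp add: z_def algebra_simps)
  qed
  \<comment> \<open>Modulo \<open>m\<close> the element \<open>b\<close> is \<open>a' * n\<close>.
    Since \<open>z\<close> and \<open>n\<close> live at \<open>u\<close>, only the corner of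
    \<open>a'\<close> matters, and \<open>z\<close> commutes past it to reach
    \<open>n\<close>.\<close>
  have "z * b \<in> m" if b: "b \<in> A" for b
  proof -
    obtain a' where a': "a' \<in> A" "b - a' * n \<in> m" using mD(6)[OF n(1) nm b] by blast
    define x' where "x' = P u * a' * P u"
    obtain y' where y': "y' \<in> L" "x' - y' \<in> I" using corner_L[OF a'(1)] by (auto simp: x'_def)
    have y'A: "y' \<in> A" by (rule L_A[OF y'(1)])
    have "z * (b - a' * n) \<in> m" using zA a' by (intro mD(5))
    moreover have "z * (x' - y') * n \<in> m" using tsiD(4)[OF I zA y'(2)] n by (intro Im)
    moreover have "(z * y' - y' * z) * n \<in> m" using comm[OF y'(1)] n by (intro Im)
    moreover have "y' * (z * n) \<in> m" by (rule mD(5)[OF y'A zn])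
    ultimately have "z * (b - a' * n) + z * (x' - y') * n + (z * y' - y' * z) * n + y' * (z * n) \<in> m"
      by (intro mD(4))
    moreover have "z * (x' * n) = z * (a' * n)"
      using zP n(3) by (metis x'_def mult.assoc)
    ultimately show ?thesis
      by (simp add: left_diff_distrib right_diff_distrib mult.assoc)
  qed
  then have "z \<in> I" using m(2) zA by simp
  then show False using L_not_invertible[OF y(1)] by (simp add: z_def g_def)
qed

end

lemma cas_tail_subgraph: "pre_digraph.cas (tail_subgraph E M) x p y = pre_digraph.cas E x p y"
  by (induction p arbitrary: x) (simp_all add: pre_digraph.cas.simps tail_subgraph_def)

lemma awalk_tail_subgraph:
  "pre_digraph.awalk (tail_subgraph E M) x p y \<longleftrightarrow>
     x \<in> M \<and> (\<forall>e\<in>set p. e \<in> arcs E \<and> head E e \<in> M) \<and> pre_digraph.cas E x p y"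
  unfolding pre_digraph.awalk_def[of "tail_subgraph E M"] cas_tail_subgraph
  by (auto simp: tail_subgraph_def)

context graded_leavitt
begin

text \<open>A closed simple path without exit in the tail has, at each of its vertices, no other
  edge that ends outside \<open>I\<close>; this is the situation excluded by
  \<open>not_lprim\<close>.\<close>

lemma lprim_condition_L:
  assumes lp: "lprim I" and gr: "graded I"
    and brkI: "\<And>v. v \<in> B_set E {v \<in> verts E. P v \<in> I} \<Longrightarrow> brk {v \<in> verts E. P v \<in> I} v \<in> I"
  shows "condition_L (tail_subgraph E {v \<in> verts E. P v \<notin> I})"
  unfolding condition_L_def
proof (intro allI impI, rule ccontr)
  let ?M = "{v \<in> verts E. P v \<notin> I}"
  fix c assume cs: "closed_simple_path (tail_subgraph E ?M) c"
    and ne: "\<not> has_exit (tail_subgraph E ?M) c"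
  have [simp]: "tail (tail_subgraph E ?M) = tail E" "arcs (tail_subgraph E ?M) = {e \<in> arcs E. head E e \<in> ?M}"
    by (simp_all add: tail_subgraph_def)
  obtain u where u: "c \<noteq> []" "u \<in> ?M" "\<forall>e\<in>set c. e \<in> arcs E \<and> head E e \<in> ?M" "cas u c u"
    "\<forall>i. 0 < i \<and> i < length c \<longrightarrow> tail E (c ! i) \<noteq> tail E (c ! 0)"
    using cs unfolding closed_simple_path_def awalk_tail_subgraph by auto
  have hd: "tail E (c ! 0) = u" using u(1,4) by (cases c) auto
  interpret no_exit_cycle E sc P S T star proj I c u
  proof unfold_locales
    show "f = e" if "e \<in> set c" "f \<in> arcs E" "tail E f = tail E e" "P (head E f) \<notin> I" for e f
    proof -
      obtain i where "i < length c" "e = c ! i" using \<open>e \<in> set c\<close> by (metis in_set_conv_nth)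
      moreover have "f \<in> out_arcs (tail_subgraph E ?M) (tail E e)" using that by (simp add: out_arcs_def)
      ultimately show ?thesis using ne unfolding has_exit_def by auto
    qed
  qed (use gr u hd brkI in \<open>auto simp: awalk_def\<close>)
  show False using not_lprim lp by simp
qed

theorem lprim_graded_form:
  assumes lp: "lprim I" and gr: "graded I"
  shows "(\<exists>M\<in>M_gamma E. I = IHS (Omega E M) (B_set E (Omega E M))) \<or>
     (\<exists>v\<in>BV E. I = IHS (Omega E {v}) (B_set E (Omega E {v}) - {v}))"
proof -
  define H where "H = {v \<in> verts E. P v \<in> I}"
  define M where "M = {v \<in> verts E. P v \<notin> I}"
  have eq: "I = IHS H {v \<in> B_set E H. brk H v \<in> I}"
    unfolding H_def by (rule graded_ideal_eq_IHS[OF gr])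
  show ?thesis
  proof (cases "\<exists>v\<in>B_set E H. brk H v \<notin> I")
    case True
    then obtain v where v: "v \<in> B_set E H" "brk H v \<notin> I" by blast
    have "H = Omega E {v}" "v \<in> BV E" using brk_notin_Omega[OF lp] v unfolding H_def by blast+
    moreover have "{v \<in> B_set E H. brk H v \<in> I} = B_set E H - {v}"
      using brk_notin_unique[OF lp] v unfolding H_def by blast
    ultimately show ?thesis using eq by metis
  next
    case False
    then have "{v \<in> B_set E H. brk H v \<in> I} = B_set E H" by blast
    moreover have mt: "maximal_tail E M" unfolding M_def by (rule lprim_maximal_tail[OF lp])
    moreover have "condition_L (tail_subgraph E M)"
      unfolding M_def using False by (intro lprim_condition_L[OF lp gr]) (auto simp: H_def)
    moreover have "Omega E M = H"
    proof -
      have "w \<in> M" if "w \<in> verts E" "v \<in> M" "w \<rightarrow>\<^sup>*\<^bsub>E\<^esub> v" for v w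
        using mt that unfolding maximal_tail_def by blast
      then show ?thesis by (auto simp: Omega_def M_def H_def)
    qed
    ultimately show ?thesis using eq by (auto simp: M_gamma_def)
  qed
qed

end

section \<open>Modules of branching systems\<close>

text \<open>A ghost path can kill one of the two points while keeping the other: common first edges
  are stripped until one point starts with an edge that the other does not have.\<close>

inductive separated ::
  "('v, 'e) pre_digraph \<Rightarrow> 'x set \<Rightarrow> ('x \<Rightarrow> 'v) \<Rightarrow> ('e \<Rightarrow> 'x \<Rightarrow> 'x) \<Rightarrow> 'x \<Rightarrow> 'x \<Rightarrow> bool"
  for E X src cons where
  left: "\<lbrakk>e \<in> arcs E; x \<in> X; src x = head E e; \<forall>z\<in>X. src z = head E e \<longrightarrow> y \<noteq> cons e z\<rbrakk>
    \<Longrightarrow> separated E X src cons (cons e x) y"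
| right: "\<lbrakk>e \<in> arcs E; x \<in> X; src x = head E e; \<forall>z\<in>X. src z = head E e \<longrightarrow> y \<noteq> cons e z\<rbrakk>
    \<Longrightarrow> separated E X src cons y (cons e x)"
| step: "\<lbrakk>e \<in> arcs E; x \<in> X; y \<in> X; src x = head E e; src y = head E e; separated E X src cons x y\<rbrakk>
    \<Longrightarrow> separated E X src cons (cons e x) (cons e y)"

text \<open>
  The points of \<open>X\<close> behave like the paths that end at a fixed vertex, or like the infinite paths
  that are tail equivalent to a fixed one, where \<open>cons\<close> prepends an edge.
\<close>

locale branching_system = wf_digraph E
  for E :: "('v, 'e) pre_digraph" and X :: "'x set" and src :: "'x \<Rightarrow> 'v"
    and cons :: "'e \<Rightarrow> 'x \<Rightarrow> 'x" and deg :: "'x \<Rightarrow> int" +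
  assumes X_ne: "X \<noteq> {}"
    and src_in: "x \<in> X \<Longrightarrow> src x \<in> verts E"
    and cons_in: "\<lbrakk>e \<in> arcs E; x \<in> X; src x = head E e\<rbrakk> \<Longrightarrow> cons e x \<in> X"
    and src_cons: "\<lbrakk>e \<in> arcs E; x \<in> X; src x = head E e\<rbrakk> \<Longrightarrow> src (cons e x) = tail E e"
    and deg_cons: "\<lbrakk>e \<in> arcs E; x \<in> X; src x = head E e\<rbrakk> \<Longrightarrow> deg (cons e x) = deg x + 1"
    and cons_inj: "cons e x = cons f y \<Longrightarrow> e = f \<and> x = y"
    and uncons: "\<lbrakk>x \<in> X; finite (out_arcs E (src x)); out_arcs E (src x) \<noteq> {}\<rbrakk>
      \<Longrightarrow> \<exists>e\<in>arcs E. \<exists>y\<in>X. src y = head E e \<and> x = cons e y"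
    and transitive: "\<lbrakk>Y \<subseteq> X; Y \<noteq> {};
        \<And>e x. \<lbrakk>e \<in> arcs E; x \<in> X; src x = head E e\<rbrakk> \<Longrightarrow> x \<in> Y \<longleftrightarrow> cons e x \<in> Y\<rbrakk> \<Longrightarrow> Y = X"
    and separated: "\<lbrakk>x \<in> X; y \<in> X; x \<noteq> y\<rbrakk> \<Longrightarrow> separated E X src cons x y"

abbreviation msc :: "'k::field \<Rightarrow> ('x \<Rightarrow>\<^sub>0 'k) \<Rightarrow> ('x \<Rightarrow>\<^sub>0 'k)" where
  "msc c \<equiv> Poly_Mapping.map ((*) c)"

lemma single_one_neq_0: "Poly_Mapping.single x (1 :: 'k :: field) \<noteq> 0"
  by (metis lookup_single_eq lookup_zero one_neq_zero)

lemma lookup_msc: "Poly_Mapping.lookup (msc c m) x = c * Poly_Mapping.lookup m x"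
  by (simp add: Poly_Mapping.map.rep_eq when_def)

lemma keys_msc: "Poly_Mapping.keys (msc c m) \<subseteq> Poly_Mapping.keys m"
  by (auto simp: in_keys_iff lookup_msc)

locale branching_module = graded_leavitt E sc P S T star proj + branching_system E X src cons deg
  for E :: "('v, 'e) pre_digraph" and sc :: "'k::field \<Rightarrow> 'a::ring \<Rightarrow> 'a"
    and P :: "'v \<Rightarrow> 'a" and S T :: "'e \<Rightarrow> 'a" and star :: "'a \<Rightarrow> 'a" and proj :: "int \<Rightarrow> 'a \<Rightarrow> 'a"
    and X :: "'x set" and src :: "'x \<Rightarrow> 'v" and cons :: "'e \<Rightarrow> 'x \<Rightarrow> 'x" and deg :: "'x \<Rightarrow> int" +
  fixes act :: "'a \<Rightarrow> ('x \<Rightarrow>\<^sub>0 'k) \<Rightarrow> ('x \<Rightarrow>\<^sub>0 'k)"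
  assumes act_add: "a \<in> A \<Longrightarrow> b \<in> A \<Longrightarrow> act (a + b) m = act a m + act b m"
    and act_add_right: "act a (m + n) = act a m + act a n"
    and act_sc: "a \<in> A \<Longrightarrow> act (sc c a) m = msc c (act a m)"
    and act_mult: "a \<in> A \<Longrightarrow> b \<in> A \<Longrightarrow> act (a * b) m = act a (act b m)"
    and act_P: "v \<in> verts E \<Longrightarrow> x \<in> X \<Longrightarrow> act (P v) (Poly_Mapping.single x c) =
      (if src x = v then Poly_Mapping.single x c else 0)"
    and act_S: "e \<in> arcs E \<Longrightarrow> x \<in> X \<Longrightarrow> act (S e) (Poly_Mapping.single x c) =
      (if src x = head E e then Poly_Mapping.single (cons e x) c else 0)"
    and act_T: "e \<in> arcs E \<Longrightarrow> x \<in> X \<Longrightarrow> src x = head E e \<Longrightarrow>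
      act (T e) (Poly_Mapping.single (cons e x) c) = Poly_Mapping.single x c"
    and act_T_0: "e \<in> arcs E \<Longrightarrow> y \<in> X \<Longrightarrow> \<forall>x\<in>X. src x = head E e \<longrightarrow> y \<noteq> cons e x \<Longrightarrow>
      act (T e) (Poly_Mapping.single y c) = 0"
begin

section \<open>The grading and the annihilator of the module\<close>

definition N :: "('x \<Rightarrow>\<^sub>0 'k) set" where "N = {m. Poly_Mapping.keys m \<subseteq> X}"

definition Ann :: "'a set" where "Ann = {a \<in> A. \<forall>m\<in>N. act a m = 0}"

lemma act_0_right [simp]: "act a 0 = 0"
  using act_add_right[of a 0 0] by simp

lemma act_0_left [simp]: "act 0 m = 0"
  using act_add[of 0 0 m] by simp

lemma act_uminus: "a \<in> A \<Longrightarrow> act (- a) m = - act a m"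
  using act_add[of a "- a" m] by (simp add: eq_neg_iff_add_eq_0 add.commute)

lemma act_diff: "a \<in> A \<Longrightarrow> b \<in> A \<Longrightarrow> act (a - b) m = act a m - act b m"
  using act_add[of a "- b" m] by (simp add: act_uminus)

lemma act_sum: "finite K \<Longrightarrow> (\<And>i. i \<in> K \<Longrightarrow> f i \<in> A) \<Longrightarrow> act (sum f K) m = (\<Sum>i\<in>K. act (f i) m)"
  by (induction K rule: finite_induct) (auto simp: act_add A_sum)

lemma N_0 [simp]: "0 \<in> N"
  and N_add: "m \<in> N \<Longrightarrow> n \<in> N \<Longrightarrow> m + n \<in> N"
  and N_uminus: "m \<in> N \<Longrightarrow> - m \<in> N"
  and N_single: "x \<in> X \<Longrightarrow> Poly_Mapping.single x c \<in> N"
  using keys_add[of m n] by (auto simp: N_def in_keys_iff split: if_splits)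

lemma N_sum: "(\<And>i. i \<in> K \<Longrightarrow> f i \<in> N) \<Longrightarrow> sum f K \<in> N"
  by (induction K rule: infinite_finite_induct) (auto simp: N_add)

lemma N_induct [consumes 1, case_names zero single add]:
  assumes "m \<in> N" "Q 0" "\<And>x c. x \<in> X \<Longrightarrow> Q (Poly_Mapping.single x c)"
    and "\<And>m n. Q m \<Longrightarrow> Q n \<Longrightarrow> Q (m + n)"
  shows "Q m"
  by (rule poly_mapping_add_induct) (use assms in \<open>auto simp: N_def\<close>)

definition Nd :: "int \<Rightarrow> ('x \<Rightarrow>\<^sub>0 'k) set" where
  "Nd d = {m. \<forall>x\<in>Poly_Mapping.keys m. x \<in> X \<and> deg x = d}"

lemma Nd_0 [simp]: "0 \<in> Nd d"
  and Nd_add: "m \<in> Nd d \<Longrightarrow> n \<in> Nd d \<Longrightarrow> m + n \<in> Nd d"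
  and Nd_single: "x \<in> X \<Longrightarrow> Poly_Mapping.single x c \<in> Nd (deg x)"
  and Nd_msc: "m \<in> Nd d \<Longrightarrow> msc c m \<in> Nd d"
  using keys_add[of m n] keys_msc[of c m] by (auto simp: Nd_def split: if_splits)

lemma Nd_induct [consumes 1, case_names zero single add]:
  assumes "m \<in> Nd d" "Q 0" "\<And>x c. x \<in> X \<Longrightarrow> deg x = d \<Longrightarrow> Q (Poly_Mapping.single x c)"
    and "\<And>m n. Q m \<Longrightarrow> Q n \<Longrightarrow> Q (m + n)"
  shows "Q m"
  by (rule poly_mapping_add_induct) (use assms in \<open>auto simp: Nd_def\<close>)

lemma act_T_cases:
  assumes "e \<in> arcs E" "x \<in> X"
  shows "(\<exists>y\<in>X. src y = head E e \<and> x = cons e y \<and> (\<forall>c. act (T e) (Poly_Mapping.single x c) = Poly_Mapping.single y c))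
    \<or> (\<forall>y\<in>X. src y = head E e \<longrightarrow> x \<noteq> cons e y) \<and> (\<forall>c. act (T e) (Poly_Mapping.single x c) = 0)"
  using act_T[OF assms(1)] act_T_0[OF assms] by metis

lemma act_gen_Nd:
  shows "v \<in> verts E \<Longrightarrow> m \<in> Nd d \<Longrightarrow> act (P v) m \<in> Nd d"
    and "e \<in> arcs E \<Longrightarrow> m \<in> Nd d \<Longrightarrow> act (S e) m \<in> Nd (d + 1)"
    and "e \<in> arcs E \<Longrightarrow> m \<in> Nd d \<Longrightarrow> act (T e) m \<in> Nd (d - 1)"
proof -
  show "act (P v) m \<in> Nd d" if "v \<in> verts E" "m \<in> Nd d"
    using that(2)
    by (induction rule: Nd_induct) (auto simp: act_P that act_add_right Nd_add Nd_single)
  show "act (S e) m \<in> Nd (d + 1)" if e: "e \<in> arcs E" "m \<in> Nd d"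
    using e(2)
  proof (induction rule: Nd_induct)
    case (single x c)
    show ?case
    proof (cases "src x = head E e")
      case True
      then show ?thesis
        using Nd_single[OF cons_in[OF e(1) single(1) True], of c] deg_cons[OF e(1) single(1) True] single e
        by (simp add: act_S)
    qed (use single e in \<open>simp add: act_S\<close>)
  qed (auto simp: act_add_right Nd_add)
  show "act (T e) m \<in> Nd (d - 1)" if e: "e \<in> arcs E" "m \<in> Nd d"
    using e(2)
  proof (induction rule: Nd_induct)
    case (single x c)
    from act_T_cases[OF e(1) single(1)] show ?case
    proof (elim disjE bexE conjE)
      fix y assume y: "y \<in> X" "src y = head E e" "x = cons e y"
        "\<forall>c. act (T e) (Poly_Mapping.single x c) = Poly_Mapping.single y c"
      have "d - 1 = deg y" using y(3) single(2) deg_cons[OF e(1) y(1,2)] by simp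
      then show ?thesis using Nd_single[OF y(1), of c] y(4) by simp
    qed simp
  qed (auto simp: act_add_right Nd_add)
qed

lemma act_pe_Nd: "awalk u p w \<Longrightarrow> m \<in> Nd d \<Longrightarrow> act (pe u p) m \<in> Nd (d + int (length p))"
proof (induction p arbitrary: u)
  case (Cons e p)
  have e: "e \<in> arcs E" "awalk (head E e) p w" using Cons.prems by (auto simp: awalk_simps)
  have "act (S e) (act (pe (head E e) p) m) \<in> Nd (d + int (length p) + 1)"
    by (intro act_gen_Nd(2) Cons.IH e Cons.prems)
  then show ?case using e A_pe[OF e(2)] by (simp add: act_mult add.assoc add.commute[of 1])
qed (auto simp: awalk_simps act_gen_Nd)

lemma act_star_pe_Nd: "awalk u p w \<Longrightarrow> m \<in> Nd d \<Longrightarrow> act (star (pe u p)) m \<in> Nd (d - int (length p))"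
proof (induction p arbitrary: u m d)
  case (Cons e p)
  have e: "e \<in> arcs E" "awalk (head E e) p w" using Cons.prems by (auto simp: awalk_simps)
  have "act (star (pe (head E e) p)) (act (T e) m) \<in> Nd (d - 1 - int (length p))"
    by (intro act_gen_Nd(3) Cons.IH e Cons.prems)
  then show ?case using e A_pe[OF e(2)] by (simp add: star_mult star_S act_mult algebra_simps)
qed (auto simp: awalk_simps act_gen_Nd star_P)

lemma act_AK_Nd: "a \<in> AK k \<Longrightarrow> m \<in> Nd d \<Longrightarrow> act a m \<in> Nd (d + k)"
proof -
  assume m: "m \<in> Nd d"
  have "a \<in> A \<and> act a m \<in> Nd (d + k)" if "a \<in> span (Mset k)"
    using that
  proof (induction rule: span_induct_alt)
    case (step c x y)
    have "act x m \<in> Nd (d + k)"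
    proof -
      obtain u p v q w where x: "x = pe u p * star (pe v q)" "awalk u p w" "awalk v q w"
        "int (length p) - int (length q) = k" using step(1) by (auto simp: Mset_def)
      have "act (pe u p) (act (star (pe v q)) m) \<in> Nd (d - int (length q) + int (length p))"
        by (intro act_pe_Nd[OF x(2)] act_star_pe_Nd[OF x(3)] m)
      moreover have "d - int (length q) + int (length p) = d + k" using x(4) by simp
      ultimately show ?thesis using A_pe[OF x(2)] A_pe[OF x(3)] by (simp add: x(1) act_mult)
    qed
    moreover have "x \<in> A" using step(1) Mset_A by blast
    ultimately show ?case using step by (simp add: act_add act_sc Nd_add Nd_msc)
  qed simp
  then show "a \<in> AK k \<Longrightarrow> act a m \<in> Nd (d + k)" by (simp add: AK_def)
qed

lemma Nd_N: "Nd d \<subseteq> N"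
  by (auto simp: Nd_def N_def)

text \<open>Homogeneous elements map homogeneous vectors into the module, so \<open>a\<close> is
  split into its components first.\<close>

lemma act_single_N:
  assumes "a \<in> A" "x \<in> X" shows "act a (Poly_Mapping.single x c) \<in> N"
proof -
  have "act a (Poly_Mapping.single x c)
      = (\<Sum>k\<in>{k. proj k a \<noteq> 0}. act (proj k a) (Poly_Mapping.single x c))"
  proof -
    have "act (\<Sum>k\<in>{k. proj k a \<noteq> 0}. proj k a) (Poly_Mapping.single x c)
        = (\<Sum>k\<in>{k. proj k a \<noteq> 0}. act (proj k a) (Poly_Mapping.single x c))"
      by (rule act_sum[OF proj_decomp(1)[OF assms(1)] AK_A[OF proj_in_AK[OF assms(1)]]])
    then show ?thesis by (simp only: proj_decomp(2)[OF assms(1), symmetric])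
  qed
  also have "\<dots> \<in> N"
  proof (rule N_sum)
    show "act (proj k a) (Poly_Mapping.single x c) \<in> N" for k
      using act_AK_Nd[OF proj_in_AK[OF assms(1)] Nd_single[OF assms(2)]] Nd_N by blast
  qed
  finally show ?thesis .
qed

lemma act_N:
  assumes "a \<in> A" "m \<in> N" shows "act a m \<in> N"
  using assms(2) by (induction rule: N_induct) (auto simp: act_single_N assms(1) act_add_right N_add)

lemma AnnI:
  assumes "a \<in> A" "\<And>x c. x \<in> X \<Longrightarrow> act a (Poly_Mapping.single x c) = 0" shows "a \<in> Ann"
proof -
  have "act a m = 0" if "m \<in> N" for m
    using that by (induction rule: N_induct) (auto simp: assms act_add_right)
  then show ?thesis using assms by (simp add: Ann_def)
qed

lemma AnnD: "a \<in> Ann \<Longrightarrow> x \<in> X \<Longrightarrow> act a (Poly_Mapping.single x c) = 0"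
  by (simp add: Ann_def N_single)

text \<open>The components of \<open>a\<close> send a basis vector into different degrees, where
  they cannot cancel one another, so each of them vanishes on it.\<close>

lemma Ann_graded: "graded Ann"
  unfolding graded_def
proof (intro conjI ballI allI)
  show "tsi Ann"
    unfolding tsi_def Ann_def by (auto simp: act_diff act_mult act_N)
  fix a k assume a: "a \<in> Ann"
  then have aA: "a \<in> A" by (simp add: Ann_def)
  show "proj k a \<in> Ann"
  proof (rule AnnI)
    show "proj k a \<in> A" using proj_in_AK[OF aA] AK_A by blast
    fix x and c :: 'k assume x: "x \<in> X"
    let ?K = "{k. proj k a \<noteq> 0}" and ?m = "Poly_Mapping.single x c"
    have "act (\<Sum>k\<in>?K. proj k a) ?m = (\<Sum>k\<in>?K. act (proj k a) ?m)"
      by (rule act_sum) (use proj_decomp(1)[OF aA] proj_in_AK[OF aA] AK_A in blast)+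
    then have sum0: "(\<Sum>k\<in>?K. act (proj k a) ?m) = 0"
      using proj_decomp(2)[OF aA] AnnD[OF a x] by simp
    have hom: "act (proj l a) ?m \<in> Nd (deg x + l)" for l
      using act_AK_Nd[OF proj_in_AK[OF aA] Nd_single[OF x]] .
    show "act (proj k a) ?m = 0"
    proof (rule poly_mapping_eqI)
      fix y
      show "Poly_Mapping.lookup (act (proj k a) ?m) y = Poly_Mapping.lookup 0 y"
      proof (cases "k \<in> ?K \<and> deg y = deg x + k")
        case True
        have "(\<Sum>l\<in>?K. Poly_Mapping.lookup (act (proj l a) ?m) y)
          = (\<Sum>l\<in>?K. if l = k then Poly_Mapping.lookup (act (proj k a) ?m) y else 0)"
        proof (rule sum.cong)
          fix l
          show "Poly_Mapping.lookup (act (proj l a) ?m) y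
            = (if l = k then Poly_Mapping.lookup (act (proj k a) ?m) y else 0)"
          proof (cases "l = k")
            case False
            then have "y \<notin> Poly_Mapping.keys (act (proj l a) ?m)"
              using hom[of l] True by (auto simp: Nd_def)
            then show ?thesis using False by (simp add: in_keys_iff)
          qed simp
        qed simp
        then have "Poly_Mapping.lookup (act (proj k a) ?m) y
            = Poly_Mapping.lookup (\<Sum>k\<in>?K. act (proj k a) ?m) y"
          using True proj_decomp(1)[OF aA] by (simp add: lookup_sum)
        then show ?thesis by (simp add: sum0)
      next
        case False
        then have "proj k a = 0 \<or> y \<notin> Poly_Mapping.keys (act (proj k a) ?m)"
          using hom[of k] by (auto simp: Nd_def)
        then show ?thesis by (auto simp: in_keys_iff)
      qed
    qed
  qed
qed

lemma P_Ann: "v \<in> verts E \<Longrightarrow> P v \<in> Ann \<longleftrightarrow> (\<forall>x\<in>X. src x \<noteq> v)"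
proof
  assume v: "v \<in> verts E" "P v \<in> Ann"
  show "\<forall>x\<in>X. src x \<noteq> v"
  proof
    fix x assume x: "x \<in> X"
    have "(if src x = v then Poly_Mapping.single x (1::'k) else 0) = 0"
      using AnnD[OF v(2) x, of 1] act_P[OF v(1) x, of 1] by simp
    then show "src x \<noteq> v" by (auto simp: single_one_neq_0)
  qed
qed (auto intro!: AnnI simp: act_P)

lemma act_S_T:
  assumes "e \<in> arcs E" "x \<in> X"
  shows "act (S e * T e) (Poly_Mapping.single x c) =
    (if \<exists>y\<in>X. src y = head E e \<and> x = cons e y then Poly_Mapping.single x c else 0)"
  using act_T_cases[OF assms] assms by (auto simp: act_mult act_S)

text \<open>On a point with source \<open>v\<close> the subtracted sum is the identity if the point
  starts with an edge and zero otherwise. Such an edge does occur in the sum, because its range is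
  the source of a point and hence not in the annihilator.\<close>

lemma brk_Ann:
  assumes v: "v \<in> B_set E {v \<in> verts E. P v \<in> Ann}"
  shows "brk {v \<in> verts E. P v \<in> Ann} v \<in> Ann \<longleftrightarrow>
    (\<forall>x\<in>X. src x = v \<longrightarrow> (\<exists>e\<in>arcs E. \<exists>y\<in>X. src y = head E e \<and> x = cons e y))"
proof -
  let ?H = "{v \<in> verts E. P v \<in> Ann}"
  let ?G = "{e \<in> out_arcs E v. head E e \<notin> ?H}"
  have vE: "v \<in> verts E" using v by (simp add: B_set_def)
  have "?G = {e \<in> out_arcs E v. head E e \<in> verts E - ?H}" by auto
  then have fin: "finite ?G" using v unfolding B_set_def by simp
  have GA: "?G \<subseteq> arcs E" by auto
  have act_brk: "act (brk ?H v) (Poly_Mapping.single x c) =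
     (if src x = v then Poly_Mapping.single x c else 0) -
     (if src x = v \<and> (\<exists>e\<in>arcs E. \<exists>y\<in>X. src y = head E e \<and> x = cons e y) then Poly_Mapping.single x c else 0)"
    if x: "x \<in> X" for x c
  proof -
    have "act (\<Sum>e\<in>?G. S e * T e) (Poly_Mapping.single x c)
      = (\<Sum>e\<in>?G. act (S e * T e) (Poly_Mapping.single x c))"
      by (rule act_sum[OF fin]) auto
    also have "\<dots> = (if src x = v \<and> (\<exists>e\<in>arcs E. \<exists>y\<in>X. src y = head E e \<and> x = cons e y) then Poly_Mapping.single x c else 0)"
    proof (cases "src x = v \<and> (\<exists>e\<in>arcs E. \<exists>y\<in>X. src y = head E e \<and> x = cons e y)")
      case True
      then obtain f y where f: "f \<in> arcs E" "y \<in> X" "src y = head E f" "x = cons f y" by blast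
      have "P (head E f) \<notin> Ann" using P_Ann[of "head E f"] f by auto
      moreover have "tail E f = v" using True src_cons[OF f(1,2,3)] f(4) by simp
      ultimately have fG: "f \<in> ?G" using f by auto
      have "(\<Sum>e\<in>?G. act (S e * T e) (Poly_Mapping.single x c)) = (\<Sum>e\<in>?G. if e = f then Poly_Mapping.single x c else 0)"
      proof (rule sum.cong[OF refl])
        fix e assume e: "e \<in> ?G"
        then have "e \<in> arcs E" by auto
        moreover have "(\<exists>y\<in>X. src y = head E e \<and> x = cons e y) \<longleftrightarrow> e = f"
          using f cons_inj by blast
        ultimately show "act (S e * T e) (Poly_Mapping.single x c) = (if e = f then Poly_Mapping.single x c else 0)"
          using act_S_T[OF _ x] by simp
      qed
      also have "\<dots> = Poly_Mapping.single x c" using fin fG by simp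
      finally show ?thesis using True by simp
    next
      case False
      have "act (S e * T e) (Poly_Mapping.single x c) = 0" if "e \<in> ?G" for e
      proof -
        from that have e: "e \<in> arcs E" "tail E e = v" by auto
        have "\<not> (\<exists>y\<in>X. src y = head E e \<and> x = cons e y)" using False e src_cons by blast
        then show ?thesis by (simp only: act_S_T[OF e(1) x] if_False)
      qed
      then have "(\<Sum>e\<in>?G. act (S e * T e) (Poly_Mapping.single x c)) = 0" by (rule sum.neutral[rule_format])
      then show ?thesis by (simp only: False if_False)
    qed
    finally have 1: "act (\<Sum>e\<in>?G. S e * T e) (Poly_Mapping.single x c) =
      (if src x = v \<and> (\<exists>e\<in>arcs E. \<exists>y\<in>X. src y = head E e \<and> x = cons e y) then Poly_Mapping.single x c else 0)" .
    have "(\<Sum>e\<in>?G. S e * T e) \<in> A" by (rule A_sum) auto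
    then show ?thesis by (simp only: brk_def act_diff[OF A_P[OF vE]] act_P[OF vE x] 1)
  qed
  show ?thesis
  proof
    assume *: "brk ?H v \<in> Ann"
    show "\<forall>x\<in>X. src x = v \<longrightarrow> (\<exists>e\<in>arcs E. \<exists>y\<in>X. src y = head E e \<and> x = cons e y)"
    proof (intro ballI impI, rule ccontr)
      fix x assume x: "x \<in> X" "src x = v" "\<not> (\<exists>e\<in>arcs E. \<exists>y\<in>X. src y = head E e \<and> x = cons e y)"
      then have "act (brk ?H v) (Poly_Mapping.single x 1) = Poly_Mapping.single x 1"
        by (simp only: act_brk[OF x(1)] simp_thms if_True if_False) simp
      moreover have "act (brk ?H v) (Poly_Mapping.single x 1) = 0" by (rule AnnD[OF * x(1)])
      ultimately have "Poly_Mapping.single x (1::'k) = 0" by simp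
      then show False by (simp add: single_one_neq_0)
    qed
  next
    assume *: "\<forall>x\<in>X. src x = v \<longrightarrow> (\<exists>e\<in>arcs E. \<exists>y\<in>X. src y = head E e \<and> x = cons e y)"
    show "brk ?H v \<in> Ann"
    proof (rule AnnI)
      show "brk ?H v \<in> A" using vE by simp
      fix x and c :: 'k assume x: "x \<in> X"
      with * have "(src x = v \<and> (\<exists>e\<in>arcs E. \<exists>y\<in>X. src y = head E e \<and> x = cons e y)) = (src x = v)"
        by blast
      then show "act (brk ?H v) (Poly_Mapping.single x c) = 0"
        by (simp only: act_brk[OF x] diff_self)
    qed
  qed
qed

theorem Ann_eq_IHS:
  defines "H \<equiv> {v \<in> verts E. \<forall>x\<in>X. src x \<noteq> v}"
  shows "Ann = IHS H {v \<in> B_set E H. \<forall>x\<in>X. src x = v \<longrightarrow> (\<exists>e\<in>arcs E. \<exists>y\<in>X. src y = head E e \<and> x = cons e y)}"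
proof -
  have H: "H = {v \<in> verts E. P v \<in> Ann}" using P_Ann by (auto simp: H_def)
  have B: "{v \<in> B_set E H. brk H v \<in> Ann} = {v \<in> B_set E H. \<forall>x\<in>X. src x = v \<longrightarrow> (\<exists>e\<in>arcs E. \<exists>y\<in>X. src y = head E e \<and> x = cons e y)}"
    unfolding H by (rule Collect_cong) (use brk_Ann in blast)
  from graded_ideal_eq_IHS[OF Ann_graded] show ?thesis unfolding H[symmetric] B .
qed

section \<open>Simplicity of the module\<close>

lemma lookup_act_T:
  assumes e: "e \<in> arcs E" and m: "m \<in> N"
  shows "Poly_Mapping.lookup (act (T e) m) z =
    (if z \<in> X \<and> src z = head E e then Poly_Mapping.lookup m (cons e z) else 0)"
  using m
proof (induction rule: N_induct)
  case (single x c)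
  from act_T_cases[OF e single] show ?case
  proof (elim disjE bexE conjE)
    fix y assume "y \<in> X" "src y = head E e" "x = cons e y"
      "\<forall>c. act (T e) (Poly_Mapping.single x c) = Poly_Mapping.single y c"
    then show ?thesis using cons_inj[of e y e z] by (auto simp: lookup_single when_def)
  next
    assume "\<forall>y\<in>X. src y = head E e \<longrightarrow> x \<noteq> cons e y" "\<forall>c. act (T e) (Poly_Mapping.single x c) = 0"
    then show ?thesis by (auto simp: lookup_single when_def)
  qed
qed (auto simp: act_add_right lookup_add)

lemma card_act_T:
  assumes e: "e \<in> arcs E" and m: "m \<in> N" and F: "Poly_Mapping.keys m \<inter> cons e ` {z \<in> X. src z = head E e} \<subseteq> F"
    and fin: "finite F"
  shows "card (Poly_Mapping.keys (act (T e) m)) \<le> card F"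
proof (rule card_inj_on_le[OF _ _ fin])
  show "inj_on (cons e) (Poly_Mapping.keys (act (T e) m))" using cons_inj by (auto simp: inj_on_def)
  show "cons e ` Poly_Mapping.keys (act (T e) m) \<subseteq> F"
    using F lookup_act_T[OF e m] by (fastforce simp: in_keys_iff split: if_splits)
qed

text \<open>A ghost edge sends distinct basis vectors to distinct ones or to zero. Following the
  derivation of \<open>separated\<close>, the support never grows; the final ghost edge drops one of
  the two points and keeps the other.\<close>

lemma separated_shrink:
  assumes U: "U \<subseteq> N" "\<And>a m. a \<in> A \<Longrightarrow> m \<in> U \<Longrightarrow> act a m \<in> U"
  shows "separated E X src cons x y \<Longrightarrow> m \<in> U \<Longrightarrow> x \<in> Poly_Mapping.keys m \<Longrightarrow> y \<in> Poly_Mapping.keys m \<Longrightarrow>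
    \<exists>m'\<in>U. m' \<noteq> 0 \<and> card (Poly_Mapping.keys m') < card (Poly_Mapping.keys m)"
proof (induction arbitrary: m rule: separated.induct)
  have shrink: "\<exists>m'\<in>U. m' \<noteq> 0 \<and> card (Poly_Mapping.keys m') < card (Poly_Mapping.keys m)"
    if e: "e \<in> arcs E" and x: "x \<in> X" "src x = head E e" and y: "\<forall>z\<in>X. src z = head E e \<longrightarrow> y \<noteq> cons e z"
      and m: "m \<in> U" "cons e x \<in> Poly_Mapping.keys m" "y \<in> Poly_Mapping.keys m" for e x y m
  proof (rule bexI[of _ "act (T e) m"])
    have mN: "m \<in> N" using U m by auto
    have "card (Poly_Mapping.keys (act (T e) m)) \<le> card (Poly_Mapping.keys m - {y})"
      by (rule card_act_T[OF e mN]) (use y in auto)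
    also have "\<dots> < card (Poly_Mapping.keys m)" using m(3) by (intro card_Diff1_less) auto
    finally have "card (Poly_Mapping.keys (act (T e) m)) < card (Poly_Mapping.keys m)" .
    moreover have "Poly_Mapping.lookup (act (T e) m) x \<noteq> 0"
      using lookup_act_T[OF e mN] x m(2) by (simp add: in_keys_iff)
    then have "act (T e) m \<noteq> 0" by auto
    ultimately show "act (T e) m \<noteq> 0 \<and> card (Poly_Mapping.keys (act (T e) m)) < card (Poly_Mapping.keys m)"
      by simp
  qed (use U e m in auto)
  {
    case (left e x y)
    then show ?case using shrink[of e x y m] by blast
  next
    case (right e x y)
    then show ?case using shrink[of e x y m] by blast
  next
    case (step e x y)
    have mN: "m \<in> N" using U step by auto
    have "x \<in> Poly_Mapping.keys (act (T e) m)" "y \<in> Poly_Mapping.keys (act (T e) m)"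
      using step lookup_act_T[OF step(1) mN] by (auto simp: in_keys_iff)
    moreover have "act (T e) m \<in> U" using U step by auto
    ultimately obtain m' where "m' \<in> U" "m' \<noteq> 0"
      "card (Poly_Mapping.keys m') < card (Poly_Mapping.keys (act (T e) m))"
      using step.IH by blast
    moreover have "card (Poly_Mapping.keys (act (T e) m)) \<le> card (Poly_Mapping.keys m)"
      by (rule card_act_T[OF step(1) mN]) auto
    ultimately show ?case by force
  }
qed

text \<open>A nonzero vector of minimal support in \<open>U\<close> is supported at one point, since
  two points could be separated and the support shrunk. \<open>transitive\<close> carries this basis
  vector to all others.\<close>

theorem N_simple:
  assumes U: "U \<subseteq> N" "U \<noteq> {0}" "0 \<in> U" and add: "\<And>m n. m \<in> U \<Longrightarrow> n \<in> U \<Longrightarrow> m + n \<in> U"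
    and act: "\<And>a m. a \<in> A \<Longrightarrow> m \<in> U \<Longrightarrow> act a m \<in> U"
  shows "U = N"
proof -
  have "\<exists>n m. m \<in> U \<and> m \<noteq> 0 \<and> card (Poly_Mapping.keys m) = n" using U by blast
  then obtain m where m: "m \<in> U" "m \<noteq> 0"
    and min: "\<And>m'. m' \<in> U \<Longrightarrow> m' \<noteq> 0 \<Longrightarrow> card (Poly_Mapping.keys m) \<le> card (Poly_Mapping.keys m')"
    using exists_least_iff[of "\<lambda>n. \<exists>m. m \<in> U \<and> m \<noteq> 0 \<and> card (Poly_Mapping.keys m) = n"]
    by (metis not_le)
  have mN: "Poly_Mapping.keys m \<subseteq> X" using m U by (auto simp: N_def)
  obtain x where x: "x \<in> Poly_Mapping.keys m" using m(2) by (metis all_not_in_conv keys_eq_empty)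
  have "y = x" if "y \<in> Poly_Mapping.keys m" for y
    using separated_shrink[OF U(1) act separated m(1)] that x mN min by (metis not_le subsetD)
  then have "m = Poly_Mapping.single x (Poly_Mapping.lookup m x)"
    by (intro poly_mapping_eqI) (metis in_keys_iff lookup_single_eq lookup_single_not_eq)
  then obtain c where c: "Poly_Mapping.single x c \<in> U" "c \<noteq> 0" using m x by (metis in_keys_iff)
  have xX: "x \<in> X" using x mN by auto
  \<comment> \<open>\<open>U\<close> is known to be closed only under addition and the action, so a
    scalar is applied as a multiple of the source vertex.\<close>
  have scale: "Poly_Mapping.single y (d * c) \<in> U" if "y \<in> X" "Poly_Mapping.single y c \<in> U" for y c d
    using act[OF A_sc[OF A_P[OF src_in[OF that(1)]]] that(2), of d] src_in[OF that(1)] that(1)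
    by (simp add: act_sc act_P)
  define Y where "Y = {y \<in> X. Poly_Mapping.single y 1 \<in> U}"
  have "Y = X"
  proof (rule transitive)
    have "x \<in> Y" using scale[OF xX c(1), of "inverse c"] c(2) xX by (simp add: Y_def)
    then show "Y \<noteq> {}" by blast
    fix e z assume e: "e \<in> arcs E" "z \<in> X" "src z = head E e"
    have "Poly_Mapping.single (cons e z) 1 \<in> U" if "Poly_Mapping.single z 1 \<in> U"
      using act[OF A_S[OF e(1)] that] e by (simp add: act_S)
    moreover have "Poly_Mapping.single z 1 \<in> U" if "Poly_Mapping.single (cons e z) 1 \<in> U"
      using act[OF A_T[OF e(1)] that] e by (simp add: act_T)
    ultimately show "z \<in> Y \<longleftrightarrow> cons e z \<in> Y" using e cons_in by (auto simp: Y_def)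
  qed (auto simp: Y_def)
  then have single: "Poly_Mapping.single y d \<in> U" if "y \<in> X" for y d
    using scale[of y 1 d] that by (auto simp: Y_def)
  have "n \<in> U" if "n \<in> N" for n
    using that by (induction rule: N_induct) (auto simp: U single add)
  then show ?thesis using U by blast
qed

end

section \<open>The Leavitt path algebra of a graph as a factor of the product\<close>

text \<open>The value \<open>0\<close> outside the carrier keeps every representing function in the
  domain of the partial quotient, so the lift is total.\<close>

lift_definition lin :: "('v, 'e) pre_digraph \<Rightarrow> ('v, 'e, 'k::field) free_elem \<Rightarrow> ('v, 'e, 'k) lprod"
  is "\<lambda>E x E'. if E' = E \<and> x \<in> fcarrier E then x else 0"
  by (auto simp: lq_rel_def leavitt_ideal.zero)

lemma lin_0 [simp]: "lin E 0 = 0"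
  by transfer (auto simp: lq_rel_def leavitt_ideal.zero)

lemma lin_add: "x \<in> fcarrier E \<Longrightarrow> y \<in> fcarrier E \<Longrightarrow> lin E (x + y) = lin E x + lin E y"
  by transfer (auto simp: lq_rel_def leavitt_ideal.zero)

lemma lin_mult: "x \<in> fcarrier E \<Longrightarrow> y \<in> fcarrier E \<Longrightarrow> lin E (x * y) = lin E x * lin E y"
  by transfer (auto simp: lq_rel_def leavitt_ideal.zero)

lemma lin_scale: "x \<in> fcarrier E \<Longrightarrow> lin E (scale c x) = lscale c (lin E x)"
  by transfer (auto simp: lq_rel_def leavitt_ideal.zero)

lemma lin_fstar: "x \<in> fcarrier E \<Longrightarrow> lin E (fstar x) = lstar (lin E x)"
  by transfer (auto simp: lq_rel_def leavitt_ideal.zero)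

lemma lin_fproj: "x \<in> fcarrier E \<Longrightarrow> lin E (fproj k x) = lproj k (lin E x)"
  by transfer (auto simp: lq_rel_def leavitt_ideal.zero)

text \<open>This identifies the factor at \<open>E\<close> with the free algebra modulo the
  relations: the representing functions agree at all other graphs, so only the difference at
  \<open>E\<close> counts.\<close>

lemma lin_eq_iff: "x \<in> fcarrier E \<Longrightarrow> y \<in> fcarrier E \<Longrightarrow> lin E x = lin E y \<longleftrightarrow> x - y \<in> leavitt_ideal E"
proof -
  assume xy: "x \<in> fcarrier E" "y \<in> fcarrier E"
  define f where "f z = (\<lambda>E'. if E' = E \<and> z \<in> fcarrier E then z else 0)" for z :: "('a, 'b, 'c) free_elem"
  have lin: "lin E z = abs_lprod (f z)" for z
    by (simp add: lin_def f_def id_def)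
  have refl: "lq_rel (f z) (f z)" for z
    by (auto simp: lq_rel_def f_def leavitt_ideal.zero)
  have "f x E' - f y E' = (if E' = E then x - y else 0)" for E'
    using xy by (simp add: f_def)
  then have "lq_rel (f x) (f y) \<longleftrightarrow> x - y \<in> leavitt_ideal E"
    using refl[of x] refl[of y] unfolding lq_rel_def by (auto simp: leavitt_ideal.zero split: if_splits)
  then show ?thesis
    unfolding lin using Quotient3_rel[OF Quotient3_lprod, of "f x" "f y"] refl by blast
qed

lemma fcarrier_sum: "(\<And>i. i \<in> K \<Longrightarrow> f i \<in> fcarrier E) \<Longrightarrow> sum f K \<in> fcarrier E"
  by (induction K rule: infinite_finite_induct) auto

lemma lin_sum: "(\<And>i. i \<in> K \<Longrightarrow> f i \<in> fcarrier E) \<Longrightarrow> lin E (sum f K) = (\<Sum>i\<in>K. lin E (f i))"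
  by (induction K rule: infinite_finite_induct) (auto simp: lin_add fcarrier_sum)

lemma lin_relator:
  "x - y \<in> leavitt_relators E \<Longrightarrow> x \<in> fcarrier E \<Longrightarrow> y \<in> fcarrier E \<Longrightarrow> lin E x = lin E y"
  by (simp add: lin_eq_iff leavitt_ideal.relator)

abbreviation lP :: "('v, 'e) pre_digraph \<Rightarrow> 'v \<Rightarrow> ('v, 'e, 'k::field) lprod" where
  "lP E v \<equiv> lin E (gen (Vertex v))"
abbreviation lS :: "('v, 'e) pre_digraph \<Rightarrow> 'e \<Rightarrow> ('v, 'e, 'k::field) lprod" where
  "lS E e \<equiv> lin E (gen (Edge e))"
abbreviation lT :: "('v, 'e) pre_digraph \<Rightarrow> 'e \<Rightarrow> ('v, 'e, 'k::field) lprod" where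
  "lT E e \<equiv> lin E (gen (Ghost e))"

lemma generators_simps [simp]:
  "Vertex v \<in> generators E \<longleftrightarrow> v \<in> verts E"
  "Edge e \<in> generators E \<longleftrightarrow> e \<in> arcs E"
  "Ghost e \<in> generators E \<longleftrightarrow> e \<in> arcs E"
  by (auto simp: generators_def)

lemma leavitt_lprod:
  fixes E :: "('v, 'e) pre_digraph"
  assumes "wf_digraph E"
  shows "leavitt E (lscale :: 'k::field \<Rightarrow> _) (lP E) (lS E) (lT E) lstar"
proof -
  interpret wf_digraph E by fact
  show ?thesis
  proof unfold_locales
    fix c and x y :: "('v, 'e, 'k) lprod"
    show "lscale c x * y = lscale c (x * y)"
      by transfer (simp add: lq_rel_def scale_mult_left leavitt_ideal.zero)
    show "x * lscale c y = lscale c (x * y)"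
      by transfer (simp add: lq_rel_def scale_mult_right leavitt_ideal.zero)
    show "lstar (x + y) = lstar x + lstar y"
      by transfer (simp add: lq_rel_def fstar_add leavitt_ideal.zero)
    show "lstar (lscale c x) = lscale c (lstar x)"
      by transfer (simp add: lq_rel_def fstar_scale leavitt_ideal.zero)
    show "lstar (x * y) = lstar y * lstar x"
      by transfer (simp add: lq_rel_def fstar_mult leavitt_ideal.zero)
    show "lstar (lstar x) = x"
      by transfer (simp add: lq_rel_def leavitt_ideal.zero)
  next
    fix v w assume v: "v \<in> verts E"
    then show "lstar (lP E v) = (lP E v :: ('v, 'e, 'k) lprod)" by (simp flip: lin_fstar)
    assume w: "w \<in> verts E"
    show "lP E v * lP E w = (if v = w then lP E v else (0 :: ('v, 'e, 'k) lprod))"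
    proof (cases "v = w")
      case True
      have "lin E (gen (Vertex v) * gen (Vertex v)) = (lP E v :: ('v, 'e, 'k) lprod)"
        by (rule lin_relator[OF leavitt_relators.idem[OF v]]) (use v in auto)
      then show ?thesis using True v by (simp add: lin_mult)
    next
      case False
      have "lin E (gen (Vertex v) * gen (Vertex w)) = (lin E 0 :: ('v, 'e, 'k) lprod)"
        by (rule lin_relator) (use v w False in \<open>auto intro: leavitt_relators.orth\<close>)
      then show ?thesis using False v w by (simp add: lin_mult)
    qed
  next
    fix e assume e: "e \<in> arcs E"
    then show "lstar (lS E e) = (lT E e :: ('v, 'e, 'k) lprod)" by (simp flip: lin_fstar)
    show "lP E (tail E e) * lS E e = (lS E e :: ('v, 'e, 'k) lprod)"
      using e lin_relator[OF leavitt_relators.edge_source[OF e]] by (simp flip: lin_mult)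
    show "lS E e * lP E (head E e) = (lS E e :: ('v, 'e, 'k) lprod)"
      using e lin_relator[OF leavitt_relators.edge_range[OF e]] by (simp flip: lin_mult)
    fix f assume f: "f \<in> arcs E"
    show "lT E e * lS E f = (if e = f then lP E (head E e) else (0 :: ('v, 'e, 'k) lprod))"
      using e f lin_relator[OF leavitt_relators.CK1[OF e f]] by (auto simp flip: lin_mult split: if_splits)
  next
    fix v assume v: "v \<in> verts E" "finite (out_arcs E v)" "out_arcs E v \<noteq> {}"
    have "lP E v = lin E (\<Sum>e\<in>out_arcs E v. gen (Edge e) * gen (Ghost e))"
      by (rule lin_relator[OF leavitt_relators.CK2[OF v]]) (use v in \<open>auto intro!: fcarrier_sum\<close>)
    also have "\<dots> = (\<Sum>e\<in>out_arcs E v. lS E e * lT E e)"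
      by (subst lin_sum) (auto simp: lin_mult intro!: sum.cong)
    finally show "lP E v = (\<Sum>e\<in>out_arcs E v. lS E e * (lT E e :: ('v, 'e, 'k) lprod))" .
  qed
qed

text \<open>Elements with a homogeneous preimage in the free algebra; on these \<open>lproj\<close>
  can be computed, and the monomials are shown to be among them.\<close>

definition Gset :: "('v, 'e) pre_digraph \<Rightarrow> int \<Rightarrow> ('v, 'e, 'k::field) lprod set" where
  "Gset E k = lin E ` (fcarrier E \<inter> fhom k)"

lemma Gset_mult: "a \<in> Gset E k \<Longrightarrow> b \<in> Gset E l \<Longrightarrow> a * b \<in> Gset E (k + l)"
  unfolding Gset_def by (auto simp: fhom_mult simp flip: lin_mult)

lemma Gset_gen: "g \<in> generators E \<Longrightarrow> lin E (gen g) \<in> Gset E (gen_degree g)"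
  unfolding Gset_def by (auto simp: fhom_gen)

lemma graded_leavitt_lprod:
  fixes E :: "('v, 'e) pre_digraph"
  assumes "wf_digraph E"
  shows "graded_leavitt E (lscale :: 'k::field \<Rightarrow> _) (lP E) (lS E) (lT E) lstar lproj"
proof -
  interpret leavitt E "lscale :: 'k \<Rightarrow> _" "lP E" "lS E" "lT E" lstar by (rule leavitt_lprod) fact
  have gen: "lP E v \<in> (Gset E 0 :: ('v, 'e, 'k) lprod set)" if "v \<in> verts E" for v
    using Gset_gen[of "Vertex v" E, where ?'c = 'k] that by simp
  have pe: "pe u p \<in> Gset E (int (length p)) \<and> lstar (pe u p) \<in> Gset E (- int (length p))" if "awalk u p w" for u p w
    using that
  proof (induction p arbitrary: u)
    case Nil
    then show ?case using gen by (auto simp: awalk_simps star_P)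
  next
    case (Cons e p)
    then have e: "e \<in> arcs E" "awalk (head E e) p w" by (auto simp: awalk_simps)
    note IH = Cons.IH[OF e(2)]
    have g: "lS E e \<in> Gset E 1" "lT E e \<in> Gset E (- 1)"
      using Gset_gen[of "Edge e" E] Gset_gen[of "Ghost e" E] e by simp_all
    from Gset_mult[OF g(1) conjunct1[OF IH]] Gset_mult[OF conjunct2[OF IH] g(2)]
    show ?case using e by (simp add: star_mult star_S algebra_simps)
  qed
  have Mset: "Mset k \<subseteq> Gset E k" for k
  proof
    fix x assume "x \<in> Mset k"
    then obtain u p v q w where x: "x = pe u p * lstar (pe v q)" "awalk u p w" "awalk v q w"
      "int (length p) - int (length q) = k" by (auto simp: Mset_def)
    from Gset_mult[OF conjunct1[OF pe[OF x(2)]] conjunct2[OF pe[OF x(3)]]] x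
    show "x \<in> Gset E k" by simp
  qed
  show ?thesis
  proof unfold_locales
    fix k c and x y :: "('v, 'e, 'k) lprod"
    show "lproj k (x + y) = lproj k x + lproj k y"
      by transfer (simp add: lq_rel_def fproj_add leavitt_ideal.zero)
    show "lproj k (lscale c x) = lscale c (lproj k x)"
      by transfer (simp add: lq_rel_def fproj_scale leavitt_ideal.zero)
    fix l assume "x \<in> Mset l"
    then have "x \<in> Gset E l" using Mset by blast
    then obtain y where "y \<in> fcarrier E" "y \<in> fhom l" "x = lin E y" by (auto simp: Gset_def)
    then show "lproj k x = (if k = l then x else 0)"
      by (simp add: fproj_fhom flip: lin_fproj)
  qed
qed

text \<open>The \<open>itself\<close> parameter fixes the coefficient field, which the graph does
  not determine.\<close>

locale lpa_graph = wf_digraph E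
  for E :: "('v, 'e) pre_digraph" and ty :: "'k::field itself"

sublocale lpa_graph \<subseteq> graded_leavitt E "lscale :: 'k \<Rightarrow> ('v, 'e, 'k) lprod \<Rightarrow> ('v, 'e, 'k) lprod"
    "lP E" "lS E" "lT E" lstar lproj
  by (rule graded_leavitt_lprod) (rule wf_digraph_axioms)

context lpa_graph
begin

lemma lin_word_A:
  assumes "word_ok E w" shows "lin E (Poly_Mapping.single w (1 :: 'k)) \<in> A"
proof -
  have gen_A: "lin E (gen g) \<in> A" if "g \<in> generators E" for g
    using that by (cases g) auto
  have "gs \<noteq> [] \<Longrightarrow> set gs \<subseteq> generators E \<Longrightarrow> lin E (Poly_Mapping.single (Word gs) (1 :: 'k)) \<in> A" for gs
  proof (induction gs)
    case (Cons g gs)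
    show ?case
    proof (cases "gs = []")
      case True
      then show ?thesis using gen_A[of g] Cons.prems by (simp add: gen_def)
    next
      case False
      have "Poly_Mapping.single (Word (g # gs)) (1 :: 'k) = gen g * Poly_Mapping.single (Word gs) 1"
        by (simp add: gen_def mult_single plus_word_def)
      moreover have "lin E (Poly_Mapping.single (Word gs) (1 :: 'k)) \<in> A" using Cons False by simp
      ultimately show ?thesis using gen_A[of g] Cons.prems False by (simp add: lin_mult)
    qed
  qed simp
  from this[of "letters w"] show ?thesis using assms by (cases w) simp
qed

lemma lin_A: "x \<in> fcarrier E \<Longrightarrow> lin E x \<in> A"
proof -
  assume x: "x \<in> fcarrier E"
  have "x \<in> fcarrier E \<and> lin E x \<in> A"
  proof (induction x rule: poly_mapping_add_induct)
    case (single w c)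
    then have w: "word_ok E w" using x by (auto simp: fcarrier_iff)
    have "lin E (Poly_Mapping.single w c) = lscale c (lin E (Poly_Mapping.single w 1))"
      using w by (simp flip: lin_scale)
    then show ?case using lin_word_A[OF w] w by simp
  qed (auto simp: lin_add)
  then show ?thesis ..
qed

lemma A_eq: "A = lin E ` fcarrier E"
proof
  show "lin E ` fcarrier E \<subseteq> A" using lin_A by auto
  have pe: "pe u p \<in> lin E ` fcarrier E" if "awalk u p w" for u p w
    using that
  proof (induction p arbitrary: u)
    case (Cons e p)
    then obtain y where "y \<in> fcarrier E" "pe (head E e) p = lin E y" "e \<in> arcs E" by (auto simp: awalk_simps)
    then show ?case by (auto simp flip: lin_mult)
  qed (auto simp: awalk_simps)
  show "A \<subseteq> lin E ` fcarrier E"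
  proof
    fix x assume "x \<in> A"
    then show "x \<in> lin E ` fcarrier E"
    proof (induction rule: A_induct)
      case zero
      show ?case by (rule image_eqI[of _ _ 0]) auto
    next
      case (mono c u p v q w y)
      obtain a b d where "a \<in> fcarrier E" "pe u p = lin E a" "b \<in> fcarrier E" "pe v q = lin E b"
        "d \<in> fcarrier E" "y = lin E d" using pe[OF mono(1)] pe[OF mono(2)] mono(4) by auto
      then have "lscale c (pe u p * lstar (pe v q)) + y = lin E (scale c (a * fstar b) + d)"
        by (simp add: lin_add lin_scale lin_mult lin_fstar)
      then show ?case using \<open>a \<in> _\<close> \<open>b \<in> _\<close> \<open>d \<in> _\<close> by (auto intro!: image_eqI)
    qed
  qed
qed

end

definition preim :: "('v, 'e) pre_digraph \<Rightarrow> ('v, 'e, 'k::field) lprod \<Rightarrow> ('v, 'e, 'k) free_elem" where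
  "preim E a = (SOME x. x \<in> fcarrier E \<and> lin E x = a)"

lemma preim:
  assumes "a \<in> lin E ` fcarrier E"
  shows "preim E a \<in> fcarrier E" "lin E (preim E a) = a"
proof -
  have "\<exists>x. x \<in> fcarrier E \<and> lin E x = a" using assms by auto
  from someI_ex[OF this] show "preim E a \<in> fcarrier E" "lin E (preim E a) = a"
    by (simp_all add: preim_def)
qed

section \<open>The action of the free algebra on a branching system\<close>

definition lext :: "('x \<Rightarrow> 'y \<Rightarrow>\<^sub>0 'k::field) \<Rightarrow> ('x \<Rightarrow>\<^sub>0 'k) \<Rightarrow> ('y \<Rightarrow>\<^sub>0 'k)" where
  "lext f m = (\<Sum>x\<in>Poly_Mapping.keys m. msc (Poly_Mapping.lookup m x) (f x))"

lemma msc_simps [simp]: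
  "msc c (0 :: 'x \<Rightarrow>\<^sub>0 'k::field) = 0" "msc 0 m = 0" "msc 1 m = m"
  "msc c (Poly_Mapping.single x d) = Poly_Mapping.single x (c * d)"
  "msc c (msc d m) = msc (c * d) m"
  by (rule poly_mapping_eqI; auto simp: lookup_msc lookup_single when_def mult.assoc)+

lemma msc_add: "msc c (m + n) = msc c m + msc c n" and msc_add_left: "msc (c + d) m = msc c m + msc d m"
  by (rule poly_mapping_eqI; simp add: lookup_msc lookup_add algebra_simps)+

lemma lext_superset:
  assumes "finite K" "Poly_Mapping.keys m \<subseteq> K"
  shows "lext f m = (\<Sum>x\<in>K. msc (Poly_Mapping.lookup m x) (f x))"
  unfolding lext_def
  by (rule sum.mono_neutral_left) (use assms in \<open>auto simp: in_keys_iff\<close>)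

lemma lext_0 [simp]: "lext f 0 = 0"
  by (simp add: lext_def)

lemma lext_single [simp]: "lext f (Poly_Mapping.single x c) = msc c (f x)"
  by (subst lext_superset[of "{x}"]) auto

lemma lext_add: "lext f (m + n) = lext f m + lext f n"
proof -
  let ?K = "Poly_Mapping.keys m \<union> Poly_Mapping.keys n"
  have "lext f (m + n) = (\<Sum>x\<in>?K. msc (Poly_Mapping.lookup (m + n) x) (f x))"
    by (rule lext_superset) (use keys_add[of m n] in auto)
  also have "\<dots> = lext f m + lext f n"
    by (simp add: lext_superset[of ?K m] lext_superset[of ?K n] lookup_add msc_add_left sum.distrib)
  finally show ?thesis .
qed

lemma lext_msc: "lext f (msc c m) = msc c (lext f m)"
  by (induction m rule: poly_mapping_add_induct) (simp_all add: lext_add msc_add)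

lemma lext_fun_add: "lext (\<lambda>x. f x + g x) m = lext f m + lext g m"
  by (induction m rule: poly_mapping_add_induct) (simp_all add: lext_add msc_add)

context branching_system
begin

fun gen_map :: "('v, 'e) generator \<Rightarrow> 'x \<Rightarrow> ('x \<Rightarrow>\<^sub>0 'k::field)" where
  "gen_map (Vertex v) x = (if x \<in> X \<and> src x = v then Poly_Mapping.single x 1 else 0)"
| "gen_map (Edge e) x = (if x \<in> X \<and> src x = head E e then Poly_Mapping.single (cons e x) 1 else 0)"
| "gen_map (Ghost e) x = (if \<exists>y\<in>X. src y = head E e \<and> x = cons e y
     then Poly_Mapping.single (THE y. x = cons e y) 1 else 0)"

lemma gen_map_Ghost_cons:
  "y \<in> X \<Longrightarrow> src y = head E e \<Longrightarrow> gen_map (Ghost e) (cons e y) = Poly_Mapping.single y (1 :: 'k::field)"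
proof -
  assume "y \<in> X" "src y = head E e"
  moreover have "(THE z. cons e y = cons e z) = y" using cons_inj by blast
  ultimately show ?thesis by auto
qed

definition word_map :: "('v, 'e) generator word \<Rightarrow> ('x \<Rightarrow>\<^sub>0 'k::field) \<Rightarrow> ('x \<Rightarrow>\<^sub>0 'k)" where
  "word_map w = foldr (\<lambda>g. lext (gen_map g)) (letters w)"

definition fact :: "('v, 'e, 'k::field) free_elem \<Rightarrow> ('x \<Rightarrow>\<^sub>0 'k) \<Rightarrow> ('x \<Rightarrow>\<^sub>0 'k)" where
  "fact a m = lext (\<lambda>w. word_map w m) a"

lemma word_map_add: "word_map w (m + n) = word_map w m + word_map w n"
proof -
  have "foldr (\<lambda>g. lext (gen_map g)) gs (m + n)
      = foldr (\<lambda>g. lext (gen_map g)) gs m + foldr (\<lambda>g. lext (gen_map g)) gs n" for gs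
    by (induction gs) (simp_all add: lext_add)
  then show ?thesis by (simp add: word_map_def)
qed

lemma word_map_msc: "word_map w (msc c m) = msc c (word_map w m)"
proof -
  have "foldr (\<lambda>g. lext (gen_map g)) gs (msc c m) = msc c (foldr (\<lambda>g. lext (gen_map g)) gs m)" for gs
    by (induction gs) (simp_all add: lext_msc)
  then show ?thesis by (simp add: word_map_def)
qed

lemma word_map_plus: "word_map (u + w) m = word_map u (word_map w m)"
  by (simp add: word_map_def plus_word_def)

lemma fact_0 [simp]: "fact 0 m = 0"
  by (simp add: fact_def)

lemma fact_single: "fact (Poly_Mapping.single w c) m = msc c (word_map w m)"
  by (simp add: fact_def)

lemma fact_add: "fact (a + b) m = fact a m + fact b m"
  by (simp add: fact_def lext_add)

lemma fact_add_right: "fact a (m + n) = fact a m + fact a n"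
  by (simp add: fact_def word_map_add lext_fun_add)

lemma fact_0_right [simp]: "fact a 0 = 0"
  using fact_add_right[of a 0 0] by simp

lemma fact_diff: "fact (a - b) m = fact a m - fact b m"
  using fact_add[of "a - b" b m] by simp

lemma fact_sum: "fact (sum f K) m = (\<Sum>i\<in>K. fact (f i) m)"
  by (induction K rule: infinite_finite_induct) (simp_all add: fact_add)

lemma fact_scale: "fact (scale c a) m = msc c (fact a m)"
  by (induction a rule: poly_mapping_add_induct) (simp_all add: fact_single fact_add scale_add msc_add)

lemma fact_mult: "fact (a * b) m = fact a (fact b m)"
proof (induction a rule: poly_mapping_add_induct)
  case (single w c)
  show ?case
    by (induction b rule: poly_mapping_add_induct)
      (simp_all add: fact_single mult_single fact_add distrib_left word_map_plus word_map_msc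
        fact_add_right)
qed (simp_all add: fact_add distrib_right)

lemma fact_gen: "fact (gen g) m = lext (gen_map g) m"
  by (simp add: gen_def fact_single word_map_def)

lemma gen_map_Ghost_cases:
  obtains y where "y \<in> X" "src y = head E e" "x = cons e y" "gen_map (Ghost e) x = Poly_Mapping.single y (1 :: 'k::field)"
  | "\<forall>y\<in>X. src y = head E e \<longrightarrow> x \<noteq> cons e y" "gen_map (Ghost e) x = (0 :: 'x \<Rightarrow>\<^sub>0 'k)"
proof (cases "\<exists>y\<in>X. src y = head E e \<and> x = cons e y")
  case True
  then obtain y where y: "y \<in> X" "src y = head E e" "x = cons e y" by blast
  show thesis using that(1)[OF y] gen_map_Ghost_cons[OF y(1,2)] y(3) by simp
next
  case False
  then have "gen_map (Ghost e) x = (0 :: 'x \<Rightarrow>\<^sub>0 'k)" by (simp only: gen_map.simps if_False)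
  with False show thesis using that(2) by blast
qed

text \<open>CK2 is where \<open>uncons\<close> enters: a point over a finite emitter with at least
  one edge starts with an edge, by \<open>cons_inj\<close> with exactly one, so a single summand
  acts as the identity on it. The other relators follow from the way \<open>cons\<close> changes
  sources.\<close>

lemma fact_relator:
  fixes r :: "('v, 'e, 'k::field) free_elem"
  assumes "r \<in> leavitt_relators E" shows "fact r m = 0"
proof -
  have "fact r (Poly_Mapping.single x c) = 0" for x c
    using assms
  proof cases
    case (edge_source e)
    then show ?thesis
      by (auto simp: fact_diff fact_mult fact_gen src_cons cons_in)
  next
    case (ghost_range e)
    show ?thesis
      by (rule gen_map_Ghost_cases[of e x, where ?'k = 'k])
        (simp_all add: ghost_range fact_diff fact_mult fact_gen del: gen_map.simps(3))
  next
    case (ghost_source e)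
    show ?thesis
      by (rule gen_map_Ghost_cases[of e x, where ?'k = 'k])
        (auto simp add: ghost_source fact_diff fact_mult fact_gen cons_in src_cons
          simp del: gen_map.simps(3))
  next
    case (CK1 e f)
    show ?thesis
    proof (cases "x \<in> X \<and> src x = head E f")
      case x: True
      show ?thesis
      proof (cases "e = f")
        case True
        then show ?thesis
          using x gen_map_Ghost_cons[of x e, where ?'k = 'k]
          by (simp add: CK1 fact_diff fact_mult fact_gen del: gen_map.simps(3))
      next
        case False
        then have "\<not> (\<exists>y\<in>X. src y = head E e \<and> cons f x = cons e y)" using cons_inj by blast
        then have "gen_map (Ghost e) (cons f x) = (0 :: 'x \<Rightarrow>\<^sub>0 'k)" by (simp only: gen_map.simps if_False)
        then show ?thesis
          using x False by (simp add: CK1 fact_diff fact_mult fact_gen del: gen_map.simps(3))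
      qed
    qed (auto simp: CK1 fact_diff fact_mult fact_gen)
  next
    case (CK2 v)
    let ?s = "Poly_Mapping.single x c"
    have GS: "fact (gen (Edge e) * gen (Ghost e)) ?s
       = (if \<exists>y\<in>X. src y = head E e \<and> x = cons e y then ?s else 0)" for e
      by (rule gen_map_Ghost_cases[of e x, where ?'k = 'k]) (auto simp: fact_mult fact_gen simp del: gen_map.simps(3))
    have sum: "fact r ?s = fact (gen (Vertex v)) ?s
        - (\<Sum>e\<in>out_arcs E v. if \<exists>y\<in>X. src y = head E e \<and> x = cons e y then ?s else 0)"
      by (simp add: CK2(1) fact_diff fact_sum GS)
    show ?thesis
    proof (cases "x \<in> X \<and> src x = v")
      case True
      then obtain f y where f: "f \<in> arcs E" "y \<in> X" "src y = head E f" "x = cons f y"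
        using uncons CK2 by blast
      have "f \<in> out_arcs E v" using f True src_cons[OF f(1,2,3)] by simp
      moreover have "(\<exists>y\<in>X. src y = head E e \<and> x = cons e y) \<longleftrightarrow> e = f" for e
        using f cons_inj by blast
      ultimately show ?thesis using True CK2(3) unfolding sum by (simp add: fact_gen)
    next
      case False
      have "\<not> (\<exists>y\<in>X. src y = head E e \<and> x = cons e y)" if "e \<in> out_arcs E v" for e
        using that False src_cons cons_in by auto
      then have "(\<Sum>e\<in>out_arcs E v. if \<exists>y\<in>X. src y = head E e \<and> x = cons e y then ?s else 0) = 0"
        by (intro sum.neutral ballI) (simp only: if_False)
      then show ?thesis using False unfolding sum by (auto simp: fact_gen)
    qed
  qed (auto simp: fact_diff fact_mult fact_gen)
  then show ?thesis
    by (induction m rule: poly_mapping_add_induct) (simp_all add: fact_add_right)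
qed

lemma fact_leavitt_ideal: "r \<in> leavitt_ideal E \<Longrightarrow> fact r m = 0"
  by (induction arbitrary: m rule: leavitt_ideal.induct)
    (simp_all add: fact_relator fact_add fact_scale fact_mult)

end

text \<open>Acting through a chosen preimage is independent of the choice because
  \<open>leavitt_ideal E\<close> acts as zero.\<close>

theorem branching_module_lprod:
  fixes E :: "('v, 'e) pre_digraph" and X :: "'x set"
  assumes "branching_system E X src cons deg"
  shows "branching_module E (lscale :: 'k::field \<Rightarrow> _) (lP E) (lS E) (lT E) lstar lproj X src cons deg
    (\<lambda>a. branching_system.fact E X src cons (preim E a))"
proof -
  interpret branching_system E X src cons deg by fact
  interpret lpa_graph E "TYPE('k)" by unfold_locales
  have lin: "fact (preim E (lin E x)) m = fact x m" if "x \<in> fcarrier E" for x :: "('v, 'e, 'k) free_elem" and m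
  proof -
    have p: "preim E (lin E x) \<in> fcarrier E" "lin E (preim E (lin E x)) = lin E x"
      using preim[of "lin E x" E] that by auto
    then have "fact (preim E (lin E x) - x) m = 0"
      using that by (intro fact_leavitt_ideal) (simp add: lin_eq_iff)
    then show ?thesis by (simp add: fact_diff)
  qed
  show ?thesis
  proof unfold_locales
    fix a b :: "('v, 'e, 'k) lprod" and m n c
    show "fact (preim E a) (m + n) = fact (preim E a) m + fact (preim E a) n"
      by (rule fact_add_right)
    assume "a \<in> A"
    then obtain x where x: "x \<in> fcarrier E" "a = lin E x" by (auto simp: A_eq)
    show "fact (preim E (lscale c a)) m = msc c (fact (preim E a) m)"
      using x by (simp add: lin fact_scale flip: lin_scale)
    assume "b \<in> A"
    then obtain y where y: "y \<in> fcarrier E" "b = lin E y" by (auto simp: A_eq)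
    show "fact (preim E (a + b)) m = fact (preim E a) m + fact (preim E b) m"
      using x y by (simp add: lin fact_add flip: lin_add)
    show "fact (preim E (a * b)) m = fact (preim E a) (fact (preim E b) m)"
      using x y by (simp add: lin fact_mult flip: lin_mult)
  next
    fix v x and c :: 'k assume "v \<in> verts E" "x \<in> X"
    then show "fact (preim E (lP E v)) (Poly_Mapping.single x c)
        = (if src x = v then Poly_Mapping.single x c else 0)"
      by (simp add: lin fact_gen)
  next
    fix e x and c :: 'k assume ex: "e \<in> arcs E" "x \<in> X"
    then show "fact (preim E (lS E e)) (Poly_Mapping.single x c)
        = (if src x = head E e then Poly_Mapping.single (cons e x) c else 0)"
      by (simp add: lin fact_gen)
    {
      assume "src x = head E e"
      then show "fact (preim E (lT E e)) (Poly_Mapping.single (cons e x) c) = Poly_Mapping.single x c"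
        using ex gen_map_Ghost_cons[of x e, where ?'k = 'k] by (simp add: lin fact_gen del: gen_map.simps)
    next
      assume "\<forall>y\<in>X. src y = head E e \<longrightarrow> x \<noteq> cons e y"
      then have "\<not> (\<exists>y\<in>X. src y = head E e \<and> x = cons e y)" by blast
      then have "gen_map (Ghost e) x = (0 :: 'x \<Rightarrow>\<^sub>0 'k)" by (simp only: gen_map.simps if_False)
      then show "fact (preim E (lT E e)) (Poly_Mapping.single x c) = 0"
        using ex by (simp add: lin fact_gen del: gen_map.simps)
    }
  qed
qed

section \<open>Primitive ideals and simple modules\<close>

context graded_leavitt
begin

text \<open>The left ideal \<open>m\<close> is the annihilator of a vector \<open>n\<close> not
  killed by all of \<open>A\<close>. Since every nonzero vector generates the module,
  \<open>A / m\<close> is this module and has the same annihilator.\<close>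

lemma module_lprim:
  fixes M :: "('m, 'z) ring_scheme"
  assumes M: "abelian_group M"
    and closed: "\<And>a m. a \<in> A \<Longrightarrow> m \<in> carrier M \<Longrightarrow> \<rho> a m \<in> carrier M"
    and add_left: "\<And>a b m. a \<in> A \<Longrightarrow> b \<in> A \<Longrightarrow> m \<in> carrier M \<Longrightarrow> \<rho> (a + b) m = \<rho> a m \<oplus>\<^bsub>M\<^esub> \<rho> b m"
    and add_right: "\<And>a m n. a \<in> A \<Longrightarrow> m \<in> carrier M \<Longrightarrow> n \<in> carrier M \<Longrightarrow>
      \<rho> a (m \<oplus>\<^bsub>M\<^esub> n) = \<rho> a m \<oplus>\<^bsub>M\<^esub> \<rho> a n"
    and mult: "\<And>a b m. a \<in> A \<Longrightarrow> b \<in> A \<Longrightarrow> m \<in> carrier M \<Longrightarrow> \<rho> (a * b) m = \<rho> a (\<rho> b m)"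
    and nonzero: "\<exists>a\<in>A. \<exists>m\<in>carrier M. \<rho> a m \<noteq> \<zero>\<^bsub>M\<^esub>"
    and simple: "\<And>U. subgroup U (add_monoid M) \<Longrightarrow> (\<And>a n. a \<in> A \<Longrightarrow> n \<in> U \<Longrightarrow> \<rho> a n \<in> U) \<Longrightarrow>
      U = {\<zero>\<^bsub>M\<^esub>} \<or> U = carrier M"
  shows "lprim {a \<in> A. \<forall>m\<in>carrier M. \<rho> a m = \<zero>\<^bsub>M\<^esub>}"
proof -
  interpret M: abelian_group M by fact
  have zero_left: "\<rho> 0 m = \<zero>\<^bsub>M\<^esub>" if "m \<in> carrier M" for m
    using add_left[of 0 0 m] closed[of 0 m] that by simp
  have zero_right: "\<rho> a \<zero>\<^bsub>M\<^esub> = \<zero>\<^bsub>M\<^esub>" if "a \<in> A" for a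
    using add_right[of a "\<zero>\<^bsub>M\<^esub>" "\<zero>\<^bsub>M\<^esub>"] closed[of a "\<zero>\<^bsub>M\<^esub>"] that by simp
  have neg_left: "\<rho> (- a) m = \<ominus>\<^bsub>M\<^esub> \<rho> a m" if "a \<in> A" "m \<in> carrier M" for a m
    using add_left[of "- a" a m] that closed zero_left by (intro M.minus_equality[symmetric]) auto
  have neg_right: "\<rho> a (\<ominus>\<^bsub>M\<^esub> m) = \<ominus>\<^bsub>M\<^esub> \<rho> a m" if "a \<in> A" "m \<in> carrier M" for a m
    using add_right[of a "\<ominus>\<^bsub>M\<^esub> m" m] that closed zero_right
    by (intro M.minus_equality[symmetric]) (auto simp: M.l_neg)
  have diff_left: "\<rho> (a - b) m = \<rho> a m \<oplus>\<^bsub>M\<^esub> (\<ominus>\<^bsub>M\<^esub> \<rho> b m)" if "a \<in> A" "b \<in> A" "m \<in> carrier M" for a b m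
    using add_left[of a "- b" m] neg_left that by simp
  obtain a0 n where n: "a0 \<in> A" "n \<in> carrier M" "\<rho> a0 n \<noteq> \<zero>\<^bsub>M\<^esub>" using nonzero by blast
  \<comment> \<open>Without an identity a vector need not be among its own multiples. The vectors
    killed by all of \<open>A\<close> form a submodule, which does not contain \<open>n\<close> and
    is therefore zero.\<close>
  define K where "K = {y \<in> carrier M. \<forall>a\<in>A. \<rho> a y = \<zero>\<^bsub>M\<^esub>}"
  have "subgroup K (add_monoid M)"
  proof (unfold_locales, goal_cases)
    case (4 x)
    then have "\<ominus>\<^bsub>M\<^esub> x \<in> K" by (auto simp: K_def neg_right)
    then show ?case by (simp add: a_inv_def)
  qed (auto simp: K_def add_right zero_right)
  moreover have "\<rho> a y \<in> K" if "a \<in> A" "y \<in> K" for a y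
    using that zero_right by (simp add: K_def)
  ultimately have "K = {\<zero>\<^bsub>M\<^esub>}" using simple[of K] n by (auto simp: K_def)
  then have gen: "\<exists>a\<in>A. z = \<rho> a y" if y: "y \<in> carrier M" "y \<noteq> \<zero>\<^bsub>M\<^esub>" and z: "z \<in> carrier M" for y z
  proof -
    define U where "U = (\<lambda>a. \<rho> a y) ` A"
    have "subgroup U (add_monoid M)"
    proof (unfold_locales, goal_cases)
      case (2 x z)
      then show ?case using y A_add by (auto simp: U_def image_iff add_left[symmetric] intro: A_add)
    next
      case 3
      then show ?case using zero_left[OF y(1)] by (auto simp: U_def image_iff intro!: bexI[of _ 0])
    next
      case (4 x)
      then obtain b where "b \<in> A" "x = \<rho> b y" by (auto simp: U_def)
      then have "\<ominus>\<^bsub>M\<^esub> x = \<rho> (- b) y" using neg_left y by simp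
      then show ?case using \<open>b \<in> A\<close> by (auto simp: U_def simp flip: a_inv_def)
    qed (auto simp: U_def closed y)
    moreover have "\<rho> a u \<in> U" if "a \<in> A" "u \<in> U" for a u
      using that y by (auto simp: U_def mult[symmetric])
    moreover have "U \<noteq> {\<zero>\<^bsub>M\<^esub>}"
    proof
      assume "U = {\<zero>\<^bsub>M\<^esub>}"
      then have "y \<in> K" using y by (auto simp: K_def U_def)
      with \<open>K = {\<zero>\<^bsub>M\<^esub>}\<close> y show False by simp
    qed
    ultimately have "U = carrier M" using simple by blast
    then show ?thesis using z by (auto simp: U_def)
  qed
  define m where "m = {a \<in> A. \<rho> a n = \<zero>\<^bsub>M\<^esub>}"
  have "n \<noteq> \<zero>\<^bsub>M\<^esub>" using n zero_right by auto
  have "simple_ann m"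
    unfolding simple_ann_def
  proof (intro conjI ballI)
    show "m \<subset> A" using n by (auto simp: m_def)
    show "0 \<in> m" using n zero_left by (simp add: m_def)
    show "x - y \<in> m" if "x \<in> m" "y \<in> m" for x y using that n by (simp add: m_def diff_left)
    show "a * x \<in> m" if "a \<in> A" "x \<in> m" for a x using that n by (simp add: m_def mult zero_right)
    show "\<exists>a\<in>A. b - a * x \<in> m" if x: "x \<in> A - m" and b: "b \<in> A" for x b
    proof -
      have "\<rho> x n \<noteq> \<zero>\<^bsub>M\<^esub>" using x by (auto simp: m_def)
      then obtain a where a: "a \<in> A" "\<rho> b n = \<rho> a (\<rho> x n)"
        using gen[of "\<rho> x n" "\<rho> b n"] closed x b n by auto
      then have "b - a * x \<in> m"
        using x b n closed by (auto simp: m_def diff_left mult M.r_neg)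
      then show ?thesis using a by blast
    qed
  qed
  moreover have "{a \<in> A. \<forall>m\<in>carrier M. \<rho> a m = \<zero>\<^bsub>M\<^esub>} = {a \<in> A. \<forall>b\<in>A. a * b \<in> m}"
  proof (rule Collect_cong, rule conj_cong[OF refl])
    fix a assume a: "a \<in> A"
    show "(\<forall>m\<in>carrier M. \<rho> a m = \<zero>\<^bsub>M\<^esub>) \<longleftrightarrow> (\<forall>b\<in>A. a * b \<in> m)"
    proof
      assume *: "\<forall>b\<in>A. a * b \<in> m"
      show "\<forall>m\<in>carrier M. \<rho> a m = \<zero>\<^bsub>M\<^esub>"
      proof
        fix z assume "z \<in> carrier M"
        then obtain b where "b \<in> A" "z = \<rho> b n" using gen[OF n(2) \<open>n \<noteq> _\<close>] by blast
        then show "\<rho> a z = \<zero>\<^bsub>M\<^esub>" using * a n by (auto simp: m_def mult)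
      qed
    qed (use a n closed in \<open>auto simp: m_def mult\<close>)
  qed
  moreover have "tsi {a \<in> A. \<forall>m\<in>carrier M. \<rho> a m = \<zero>\<^bsub>M\<^esub>}"
    unfolding tsi_def by (auto simp: zero_left diff_left mult zero_right closed)
  ultimately show ?thesis unfolding lprim_def by blast
qed

lemma star_proj: "x \<in> A \<Longrightarrow> proj k (star x) = star (proj (- k) x)"
proof (induction rule: A_induct)
  case (mono c u p v q w y)
  define x where "x = pe u p * star (pe v q)"
  define l where "l = int (length p) - int (length q)"
  have x: "x \<in> Mset l" unfolding x_def l_def by (rule MsetI[OF mono(1,2) refl])
  have "proj k (star x) = star (proj (- k) x)"
    using proj_Mset[OF Mset_star[OF x], of k] proj_Mset[OF x, of "- k"] by auto
  then show ?case using mono unfolding x_def[symmetric] by (simp add: star_add star_sc proj_add proj_sc)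
qed simp

lemma graded_star: "graded I \<Longrightarrow> graded (star ` I)"
  unfolding graded_def
proof (intro conjI ballI allI)
  assume gr: "tsi I \<and> (\<forall>x\<in>I. \<forall>k. proj k x \<in> I)"
  then show "tsi (star ` I)" using tsi_star by blast
  fix x k assume "x \<in> star ` I"
  then obtain y where "y \<in> I" "x = star y" by blast
  then show "proj k x \<in> star ` I" using gr tsiD(1) star_proj by auto
qed

end

section \<open>Passage to the algebra of cosets\<close>

context lpa_graph
begin

abbreviation R :: "('k, ('v, 'e, 'k) lpa_elem) module" where "R \<equiv> lpa E"

text \<open>Restricts to an isomorphism from \<open>A\<close> onto the algebra of cosets, along
  which all statements are transported.\<close>

definition \<theta> :: "('v, 'e, 'k) lprod \<Rightarrow> ('v, 'e, 'k) lpa_elem" where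
  "\<theta> a = lpa_class E (preim E a)"

lemma relators_fcarrier: "leavitt_relators E \<subseteq> (fcarrier E :: ('v, 'e, 'k) free_elem set)"
proof
  fix x :: "('v, 'e, 'k) free_elem" assume "x \<in> leavitt_relators E"
  then show "x \<in> fcarrier E"
    by cases (auto intro!: fcarrier_diff fcarrier_mult fcarrier_sum fcarrier_gen)
qed

lemma leavitt_ideal_fcarrier: "x \<in> leavitt_ideal E \<Longrightarrow> x \<in> (fcarrier E :: ('v, 'e, 'k) free_elem set)"
  by (induction rule: leavitt_ideal.induct) (use relators_fcarrier in auto)

lemma free_algebra_simps [simp]:
  "\<zero>\<^bsub>free_algebra E\<^esub> = 0" "x \<oplus>\<^bsub>free_algebra E\<^esub> y = x + y" "x \<otimes>\<^bsub>free_algebra E\<^esub> y = x * y"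
  by (simp_all add: free_algebra_def)

lemma lpa_class_eq: "lpa_class E x = {h + x | h. h \<in> leavitt_ideal E}"
  by (auto simp: lpa_class_def a_r_coset_def')

lemma mem_lpa_class: "y \<in> lpa_class E x \<longleftrightarrow> y - x \<in> leavitt_ideal E"
  by (auto simp: lpa_class_eq) (metis diff_add_cancel)

lemma lpa_class_cong: "lpa_class E x = lpa_class E y \<longleftrightarrow> x - y \<in> (leavitt_ideal E :: ('v, 'e, 'k) free_elem set)"
proof
  assume "lpa_class E x = lpa_class E y"
  moreover have "x \<in> lpa_class E x" by (simp add: mem_lpa_class leavitt_ideal.zero)
  ultimately show "x - y \<in> leavitt_ideal E" by (simp add: mem_lpa_class)
next
  assume xy: "x - y \<in> leavitt_ideal E"
  have "z - x \<in> leavitt_ideal E \<longleftrightarrow> z - y \<in> leavitt_ideal E" for z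
  proof
    assume "z - x \<in> leavitt_ideal E"
    from leavitt_ideal.add[OF this xy] show "z - y \<in> leavitt_ideal E" by simp
  next
    assume "z - y \<in> leavitt_ideal E"
    from leavitt_ideal_diff[OF this xy] show "z - x \<in> leavitt_ideal E" by simp
  qed
  then show "lpa_class E x = lpa_class E y" by (auto simp: mem_lpa_class)
qed

lemma lpa_sel:
  "carrier R = a_rcosets\<^bsub>free_algebra E\<^esub> leavitt_ideal E"
  "\<zero>\<^bsub>R\<^esub> = leavitt_ideal E"
  "U \<oplus>\<^bsub>R\<^esub> V = U <+>\<^bsub>free_algebra E\<^esub> V"
  "U \<otimes>\<^bsub>R\<^esub> V = [mod leavitt_ideal E:] U \<Otimes>\<^bsub>free_algebra E\<^esub> V"
  "c \<odot>\<^bsub>R\<^esub> U = (\<Union>x\<in>U. lpa_class E (scale c x))"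
  by (simp_all add: lpa_def ring.defs module.defs FactRing_def)

lemma lpa_carrier: "carrier R = lpa_class E ` fcarrier E"
  by (auto simp: lpa_sel A_RCOSETS_def' lpa_class_def)

lemma lpa_zero: "\<zero>\<^bsub>R\<^esub> = lpa_class E 0"
  by (simp add: lpa_sel lpa_class_eq)

lemma lpa_add: "lpa_class E x \<oplus>\<^bsub>R\<^esub> lpa_class E y = lpa_class E (x + y)"
proof (rule Set.set_eqI)
  fix z
  show "z \<in> lpa_class E x \<oplus>\<^bsub>R\<^esub> lpa_class E y \<longleftrightarrow> z \<in> lpa_class E (x + y)"
  proof
    assume "z \<in> lpa_class E x \<oplus>\<^bsub>R\<^esub> lpa_class E y"
    then obtain a b where "a - x \<in> leavitt_ideal E" "b - y \<in> leavitt_ideal E" "z = a + b"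
      by (auto simp: lpa_sel set_add_def' mem_lpa_class)
    then show "z \<in> lpa_class E (x + y)"
      using leavitt_ideal.add[of "a - x" E "b - y"] by (simp add: mem_lpa_class algebra_simps)
  next
    assume "z \<in> lpa_class E (x + y)"
    then have "z - y \<in> lpa_class E x" "y \<in> lpa_class E y" "z = (z - y) + y"
      by (simp_all add: mem_lpa_class leavitt_ideal.zero algebra_simps)
    then show "z \<in> lpa_class E x \<oplus>\<^bsub>R\<^esub> lpa_class E y"
      by (simp only: lpa_sel set_add_def' free_algebra_simps) blast
  qed
qed

lemma lpa_mult:
  assumes "x \<in> fcarrier E" "y \<in> fcarrier E"
  shows "lpa_class E x \<otimes>\<^bsub>R\<^esub> lpa_class E y = lpa_class E (x * y :: ('v, 'e, 'k) free_elem)"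
proof -
  have "lpa_class E (a * b) = lpa_class E (x * y)" if "a \<in> lpa_class E x" "b \<in> lpa_class E y" for a b
  proof -
    have ab: "a - x \<in> leavitt_ideal E" "b - y \<in> leavitt_ideal E" using that by (simp_all add: mem_lpa_class)
    have "b \<in> fcarrier E" using leavitt_ideal_fcarrier[OF ab(2)] assms(2) fcarrier_add by fastforce
    then have "(a - x) * b + x * (b - y) \<in> leavitt_ideal E"
      using ab assms by (intro leavitt_ideal.add leavitt_ideal.mult_left leavitt_ideal.mult_right)
    then show ?thesis by (simp add: lpa_class_cong algebra_simps)
  qed
  moreover have "x \<in> lpa_class E x" "y \<in> lpa_class E y" by (simp_all add: mem_lpa_class leavitt_ideal.zero)
  ultimately show ?thesis
    unfolding lpa_sel rcoset_mult_def lpa_class_def[symmetric] free_algebra_simps by blast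
qed

lemma lpa_smult: "c \<odot>\<^bsub>R\<^esub> lpa_class E x = lpa_class E (scale c x :: ('v, 'e, 'k) free_elem)"
proof -
  have "lpa_class E (scale c a) = lpa_class E (scale c x)" if "a \<in> lpa_class E x" for a
    using leavitt_ideal.scale[of "a - x" E c] that by (simp add: lpa_class_cong mem_lpa_class scale_diff)
  moreover have "x \<in> lpa_class E x" by (simp add: mem_lpa_class leavitt_ideal.zero)
  ultimately show ?thesis unfolding lpa_sel by blast
qed

lemma \<theta>_lin: "x \<in> fcarrier E \<Longrightarrow> \<theta> (lin E x) = lpa_class E x"
  using preim[of "lin E x" E] by (simp add: \<theta>_def lpa_class_cong lin_eq_iff[symmetric])

lemma \<theta>_0: "\<theta> 0 = \<zero>\<^bsub>R\<^esub>"
  using \<theta>_lin[of 0] by (simp add: lpa_zero)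

lemma \<theta>_add: "a \<in> A \<Longrightarrow> b \<in> A \<Longrightarrow> \<theta> (a + b) = \<theta> a \<oplus>\<^bsub>R\<^esub> \<theta> b"
  by (auto simp: A_eq \<theta>_lin lpa_add simp flip: lin_add)

lemma \<theta>_mult: "a \<in> A \<Longrightarrow> b \<in> A \<Longrightarrow> \<theta> (a * b) = \<theta> a \<otimes>\<^bsub>R\<^esub> \<theta> b"
  by (auto simp: A_eq \<theta>_lin lpa_mult simp flip: lin_mult)

lemma \<theta>_sc: "a \<in> A \<Longrightarrow> \<theta> (lscale c a) = c \<odot>\<^bsub>R\<^esub> \<theta> a"
  by (auto simp: A_eq \<theta>_lin lpa_smult simp flip: lin_scale)

lemma \<theta>_inj:
  assumes "a \<in> A" "b \<in> A" shows "\<theta> a = \<theta> b \<longleftrightarrow> a = b"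
proof -
  obtain x y where "x \<in> fcarrier E" "a = lin E x" "y \<in> fcarrier E" "b = lin E y"
    using assms by (auto simp: A_eq)
  then show ?thesis by (simp add: \<theta>_lin lpa_class_cong lin_eq_iff)
qed

lemma \<theta>_carrier: "carrier R = \<theta> ` A"
  by (force simp: A_eq lpa_carrier \<theta>_lin image_iff)

lemma inj_\<theta>: "inj_on \<theta> A"
  by (simp add: inj_on_def \<theta>_inj)

lemma \<theta>_mem: "a \<in> A \<Longrightarrow> I \<subseteq> A \<Longrightarrow> \<theta> a \<in> \<theta> ` I \<longleftrightarrow> a \<in> I"
  by (auto simp: \<theta>_inj subset_iff)

lemma abelian_group_R: "abelian_group R"
proof (rule abelian_groupI)
  fix x assume "x \<in> carrier R"
  then obtain a where a: "a \<in> A" "x = \<theta> a" by (auto simp: \<theta>_carrier)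
  then have "\<theta> (- a) \<oplus>\<^bsub>R\<^esub> x = \<zero>\<^bsub>R\<^esub>" by (simp add: \<theta>_0 flip: \<theta>_add)
  then show "\<exists>y\<in>carrier R. y \<oplus>\<^bsub>R\<^esub> x = \<zero>\<^bsub>R\<^esub>" using a by (auto simp: \<theta>_carrier)
qed (auto simp: \<theta>_carrier add_ac simp flip: \<theta>_add \<theta>_0)

sublocale R: abelian_group R
  by (rule abelian_group_R)

lemma \<theta>_uminus: "a \<in> A \<Longrightarrow> \<ominus>\<^bsub>R\<^esub> \<theta> a = \<theta> (- a)"
  by (rule R.minus_equality) (auto simp: \<theta>_carrier \<theta>_0 simp flip: \<theta>_add)

lemma \<theta>_diff: "a \<in> A \<Longrightarrow> b \<in> A \<Longrightarrow> \<theta> (a - b) = \<theta> a \<ominus>\<^bsub>R\<^esub> \<theta> b"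
  using \<theta>_add[of a "- b"] by (simp add: a_minus_def \<theta>_uminus)

lemma \<theta>_sum: "(\<And>i. i \<in> K \<Longrightarrow> f i \<in> A) \<Longrightarrow> \<theta> (sum f K) = (\<Oplus>\<^bsub>R\<^esub>i\<in>K. \<theta> (f i))"
proof (induction K rule: infinite_finite_induct)
  case (insert x K)
  then show ?case by (subst R.finsum_insert) (auto simp: \<theta>_carrier \<theta>_add A_sum)
qed (simp_all add: \<theta>_0)

section \<open>Ideals in the algebra of cosets\<close>

lemma additive_subgroup_\<theta>:
  assumes "H \<subseteq> A"
  shows "additive_subgroup (\<theta> ` H) R \<longleftrightarrow> 0 \<in> H \<and> (\<forall>x\<in>H. \<forall>y\<in>H. x - y \<in> H)"
proof
  assume "additive_subgroup (\<theta> ` H) R"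
  then interpret H: additive_subgroup "\<theta> ` H" R .
  have "0 \<in> H" using H.zero_closed assms by (simp add: \<theta>_mem flip: \<theta>_0)
  moreover have "x - y \<in> H" if "x \<in> H" "y \<in> H" for x y
  proof -
    have xy: "x \<in> A" "y \<in> A" using that assms by auto
    have "\<theta> x \<oplus>\<^bsub>R\<^esub> (\<ominus>\<^bsub>R\<^esub> \<theta> y) \<in> \<theta> ` H" using that H.a_closed H.a_inv_closed by blast
    then show ?thesis using xy assms by (simp add: \<theta>_uminus \<theta>_mem flip: \<theta>_add)
  qed
  ultimately show "0 \<in> H \<and> (\<forall>x\<in>H. \<forall>y\<in>H. x - y \<in> H)" by blast
next
  assume H: "0 \<in> H \<and> (\<forall>x\<in>H. \<forall>y\<in>H. x - y \<in> H)"
  have neg: "- x \<in> H" if "x \<in> H" for x using H that by (metis diff_0)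
  have add: "x + y \<in> H" if "x \<in> H" "y \<in> H" for x y using H neg[OF that(2)] that by (metis diff_minus_eq_add)
  show "additive_subgroup (\<theta> ` H) R"
  proof (rule additive_subgroupI, unfold_locales, goal_cases)
    case (2 x y)
    then show ?case using assms add by (auto simp: subset_iff simp flip: \<theta>_add)
  next
    case (4 x)
    then obtain h where "h \<in> H" "x = \<theta> h" by blast
    then have "\<ominus>\<^bsub>R\<^esub> x = \<theta> (- h)" "- h \<in> H" using assms neg by (auto simp: \<theta>_uminus)
    then show ?case by (simp add: a_inv_def)
  qed (use H assms in \<open>auto simp: \<theta>_carrier simp flip: \<theta>_0\<close>)
qed

lemma two_sided_ideal_\<theta>:
  assumes "I \<subseteq> A" shows "two_sided_ideal (\<theta> ` I) R \<longleftrightarrow> tsi I"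
  unfolding two_sided_ideal_def tsi_def additive_subgroup_\<theta>[OF assms]
  using assms by (auto simp: \<theta>_carrier \<theta>_mem subset_iff simp flip: \<theta>_mult)

lemma two_sided_ideal_obtain:
  assumes "two_sided_ideal J R" obtains I where "tsi I" "J = \<theta> ` I"
proof -
  have "J \<subseteq> \<theta> ` A"
    using assms additive_subgroup.a_subset[of J R] by (simp add: two_sided_ideal_def \<theta>_carrier)
  then have J: "J = \<theta> ` {a \<in> A. \<theta> a \<in> J}" by auto
  then have "tsi {a \<in> A. \<theta> a \<in> J}" using assms two_sided_ideal_\<theta>[of "{a \<in> A. \<theta> a \<in> J}"] by simp
  then show thesis using J that by blast
qed

lemma tsi_subset: "tsi I \<Longrightarrow> I \<subseteq> A"
  by (simp add: tsi_def)

lemma ideal_generated_\<theta>: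
  assumes "X \<subseteq> A"
  shows "ideal_generated R (\<theta> ` X) = \<theta> ` (\<Inter>{I. tsi I \<and> X \<subseteq> I})"
proof -
  have sub: "\<theta> ` X \<subseteq> \<theta> ` I \<longleftrightarrow> X \<subseteq> I" if "I \<subseteq> A" for I
  proof
    assume XI: "\<theta> ` X \<subseteq> \<theta> ` I"
    show "X \<subseteq> I"
    proof
      fix x assume x: "x \<in> X"
      then have "\<theta> x \<in> \<theta> ` I" using XI by blast
      then show "x \<in> I" using \<theta>_mem[of x I] x assms that by blast
    qed
  qed blast
  have "{J. two_sided_ideal J R \<and> \<theta> ` X \<subseteq> J} = (`) \<theta> ` {I. tsi I \<and> X \<subseteq> I}"
  proof (intro Set.set_eqI iffI)
    fix J assume "J \<in> {J. two_sided_ideal J R \<and> \<theta> ` X \<subseteq> J}"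
    then have J: "two_sided_ideal J R" "\<theta> ` X \<subseteq> J" by simp_all
    obtain I where I: "tsi I" "J = \<theta> ` I" by (rule two_sided_ideal_obtain[OF J(1)])
    then have "X \<subseteq> I" using J(2) sub[OF tsi_subset[OF I(1)]] by simp
    then show "J \<in> (`) \<theta> ` {I. tsi I \<and> X \<subseteq> I}" using I by simp
  qed (auto simp: two_sided_ideal_\<theta> tsi_subset)
  \<comment> \<open>Injectivity lets the image pass through the intersection; \<open>A\<close>
    itself shows that the family is not empty.\<close>
  moreover have "\<Inter>((`) \<theta> ` {I. tsi I \<and> X \<subseteq> I}) = \<theta> ` (\<Inter>{I. tsi I \<and> X \<subseteq> I})"
    using image_INT[OF inj_\<theta>, of "{I. tsi I \<and> X \<subseteq> I}" "\<lambda>I. I" A] tsi_A assms tsi_subset by auto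
  ultimately show ?thesis by (simp add: ideal_generated_def)
qed

lemma lpa_gen_\<theta>: "g \<in> generators E \<Longrightarrow> lpa_gen E g = \<theta> (lin E (gen g))"
  by (simp add: lpa_gen_def \<theta>_lin)

lemma breaking_elem_\<theta>: "v \<in> verts E \<Longrightarrow> breaking_elem E H v = \<theta> (brk H v)"
proof -
  assume v: "v \<in> verts E"
  have "(\<Oplus>\<^bsub>R\<^esub>e\<in>{e \<in> out_arcs E v. head E e \<notin> H}. lpa_gen E (Edge e) \<otimes>\<^bsub>R\<^esub> lpa_gen E (Ghost e))
     = (\<Oplus>\<^bsub>R\<^esub>e\<in>{e \<in> out_arcs E v. head E e \<notin> H}. \<theta> (lS E e * lT E e))"
    by (rule R.finsum_cong') (auto simp: lpa_gen_\<theta> \<theta>_mult \<theta>_carrier intro!: imageI)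
  also have "\<dots> = \<theta> (\<Sum>e\<in>{e \<in> out_arcs E v. head E e \<notin> H}. lS E e * lT E e)"
    by (subst \<theta>_sum) auto
  finally show ?thesis
    using v unfolding breaking_elem_def brk_def by (subst \<theta>_diff) (auto simp: lpa_gen_\<theta> intro!: A_sum)
qed

lemma I_HS_\<theta>:
  assumes "H \<subseteq> verts E" "B \<subseteq> verts E" shows "I_HS E H B = \<theta> ` IHS H B"
proof -
  have "(\<lambda>v. lpa_gen E (Vertex v)) ` H = \<theta> ` lP E ` H"
    unfolding image_image by (rule image_cong) (use assms in \<open>auto simp: lpa_gen_\<theta>\<close>)
  moreover have "breaking_elem E H ` B = \<theta> ` brk H ` B"
    unfolding image_image by (rule image_cong) (use assms in \<open>auto simp: breaking_elem_\<theta>\<close>)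
  moreover have "lP E ` H \<union> brk H ` B \<subseteq> A" using assms by auto
  ultimately show ?thesis
    unfolding I_HS_def IHS_def by (simp add: ideal_generated_\<theta> flip: image_Un)
qed

section \<open>Quotients by an ideal and their simple modules\<close>

definition qc :: "('v, 'e, 'k) lprod set \<Rightarrow> ('v, 'e, 'k) lprod \<Rightarrow> ('v, 'e, 'k) lpa_elem set" where
  "qc I a = \<theta> ` I +>\<^bsub>R\<^esub> \<theta> a"

lemma qc_eq: "tsi I \<Longrightarrow> a \<in> A \<Longrightarrow> qc I a = \<theta> ` {x \<in> A. x - a \<in> I}"
proof -
  assume I: "tsi I" and a: "a \<in> A"
  have "qc I a = (\<lambda>i. \<theta> (i + a)) ` I"
    using tsiD(1)[OF I] a by (auto simp: qc_def a_r_coset_def' \<theta>_add)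
  also have "\<dots> = \<theta> ` {x \<in> A. x - a \<in> I}"
  proof (intro Set.set_eqI iffI)
    fix z assume "z \<in> (\<lambda>i. \<theta> (i + a)) ` I"
    then show "z \<in> \<theta> ` {x \<in> A. x - a \<in> I}" using tsiD(1)[OF I] a by auto
  next
    fix z assume "z \<in> \<theta> ` {x \<in> A. x - a \<in> I}"
    then obtain x where "x - a \<in> I" "z = \<theta> ((x - a) + a)" by auto
    then show "z \<in> (\<lambda>i. \<theta> (i + a)) ` I" by blast
  qed
  finally show ?thesis .
qed

lemma qc_cong:
  assumes I: "tsi I" and "a \<in> A" "b \<in> A" shows "qc I a = qc I b \<longleftrightarrow> a - b \<in> I"
proof
  assume "qc I a = qc I b"
  moreover have "\<theta> a \<in> qc I a" using assms by (simp add: qc_eq tsiD(2)[OF I])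
  ultimately have "\<theta> a \<in> \<theta> ` {x \<in> A. x - b \<in> I}" using assms by (simp add: qc_eq)
  then show "a - b \<in> I" using assms by (subst (asm) \<theta>_mem) auto
next
  assume ab: "a - b \<in> I"
  have "x - a \<in> I \<longleftrightarrow> x - b \<in> I" for x
    using tsi_add[OF I _ ab, of "x - a"] tsiD(3)[OF I _ ab, of "x - b"] by auto
  then show "qc I a = qc I b" using assms by (simp add: qc_eq)
qed

lemma Quot_carrier: "carrier (R Quot \<theta> ` I) = qc I ` A"
  by (auto simp: FactRing_def A_RCOSETS_def' qc_def \<theta>_carrier)

lemma Quot_zero:
  assumes I: "tsi I" shows "\<zero>\<^bsub>R Quot \<theta> ` I\<^esub> = qc I 0"
proof -
  have "{x \<in> A. x - 0 \<in> I} = I" using tsiD(1)[OF I] by auto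
  then show ?thesis using qc_eq[OF I, of 0] by (simp add: FactRing_def)
qed

lemma Quot_add:
  assumes I: "tsi I" and ab: "a \<in> A" "b \<in> A"
  shows "qc I a \<oplus>\<^bsub>R Quot \<theta> ` I\<^esub> qc I b = qc I (a + b)"
proof -
  have "qc I a \<oplus>\<^bsub>R Quot \<theta> ` I\<^esub> qc I b = {x \<oplus>\<^bsub>R\<^esub> y | x y. x \<in> qc I a \<and> y \<in> qc I b}"
    by (auto simp: FactRing_def set_add_def')
  also have "\<dots> = \<theta> ` {x \<in> A. x - (a + b) \<in> I}"
  proof (intro Set.set_eqI iffI)
    fix z assume "z \<in> {x \<oplus>\<^bsub>R\<^esub> y | x y. x \<in> qc I a \<and> y \<in> qc I b}"
    then obtain x y where xy: "x \<in> A" "x - a \<in> I" "y \<in> A" "y - b \<in> I" "z = \<theta> x \<oplus>\<^bsub>R\<^esub> \<theta> y"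
      using ab by (auto simp: qc_eq[OF I])
    then have "x + y - (a + b) \<in> I" using tsi_add[OF I xy(2,4)] by (simp add: algebra_simps)
    then show "z \<in> \<theta> ` {x \<in> A. x - (a + b) \<in> I}" using xy by (auto simp flip: \<theta>_add)
  next
    fix z assume "z \<in> \<theta> ` {x \<in> A. x - (a + b) \<in> I}"
    then obtain x where x: "x \<in> A" "x - (a + b) \<in> I" "z = \<theta> x" by auto
    then have "\<theta> (x - b) \<in> qc I a" "\<theta> b \<in> qc I b" "z = \<theta> (x - b) \<oplus>\<^bsub>R\<^esub> \<theta> b"
      using ab tsiD(2)[OF I] by (auto simp: qc_eq[OF I] algebra_simps simp flip: \<theta>_add intro!: imageI)
    then show "z \<in> {x \<oplus>\<^bsub>R\<^esub> y | x y. x \<in> qc I a \<and> y \<in> qc I b}" by blast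
  qed
  finally show ?thesis using ab by (simp add: qc_eq[OF I])
qed

lemma Quot_mult:
  assumes I: "tsi I" and ab: "a \<in> A" "b \<in> A"
  shows "qc I a \<otimes>\<^bsub>R Quot \<theta> ` I\<^esub> qc I b = qc I (a * b)"
proof -
  have "\<theta> ` I +>\<^bsub>R\<^esub> (x \<otimes>\<^bsub>R\<^esub> y) = qc I (a * b)" if xy: "x \<in> qc I a" "y \<in> qc I b" for x y
  proof -
    obtain x' y' where x': "x' \<in> A" "x' - a \<in> I" "x = \<theta> x'" and y': "y' \<in> A" "y' - b \<in> I" "y = \<theta> y'"
      using xy ab by (auto simp: qc_eq[OF I])
    have "(x' - a) * y' + a * (y' - b) \<in> I"
      by (intro tsi_add[OF I] tsiD(4)[OF I] tsiD(5)[OF I] x' y' ab)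
    then have "qc I (x' * y') = qc I (a * b)" using x' y' ab by (simp add: qc_cong[OF I] algebra_simps)
    then show ?thesis using x' y' by (simp add: qc_def \<theta>_mult)
  qed
  moreover have "\<theta> a \<in> qc I a" "\<theta> b \<in> qc I b"
    using ab by (auto simp: qc_eq[OF I] tsiD(2)[OF I])
  ultimately show ?thesis by (auto simp: FactRing_def rcoset_mult_def)
qed

lemma abelian_group_Quot:
  assumes I: "tsi I" shows "abelian_group (R Quot \<theta> ` I)"
proof (rule abelian_groupI)
  fix x assume "x \<in> carrier (R Quot \<theta> ` I)"
  then obtain a where a: "a \<in> A" "x = qc I a" by (auto simp: Quot_carrier)
  then have "qc I (- a) \<oplus>\<^bsub>R Quot \<theta> ` I\<^esub> x = \<zero>\<^bsub>R Quot \<theta> ` I\<^esub>"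
    by (simp add: Quot_add[OF I] Quot_zero[OF I])
  then show "\<exists>y\<in>carrier (R Quot \<theta> ` I). y \<oplus>\<^bsub>R Quot \<theta> ` I\<^esub> x = \<zero>\<^bsub>R Quot \<theta> ` I\<^esub>"
    using a by (auto simp: Quot_carrier)
qed (auto simp: Quot_carrier Quot_add[OF I] Quot_zero[OF I] add_ac)

lemma submodule_of_subgroup:
  assumes "subgroup U (add_monoid M)" "\<And>a n. a \<in> carrier Q \<Longrightarrow> n \<in> U \<Longrightarrow> a \<odot>\<^bsub>M\<^esub> n \<in> U"
  shows "submodule U Q M"
  using assms by (simp add: submodule_def submodule_axioms_def)

text \<open>Here \<open>\<sigma>\<close> is the identity for left modules and the involution for right modules.\<close>

lemma quotient_module_lprim:
  fixes M :: "(('v, 'e, 'k) lpa_elem set, 'm, 'z) module_scheme"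
  defines "Q I \<equiv> R Quot \<theta> ` I"
  assumes I: "tsi I" and M: "abelian_group M"
    and closed: "\<And>x m. x \<in> carrier (Q I) \<Longrightarrow> m \<in> carrier M \<Longrightarrow> x \<odot>\<^bsub>M\<^esub> m \<in> carrier M"
    and add_ring: "\<And>x y m. x \<in> carrier (Q I) \<Longrightarrow> y \<in> carrier (Q I) \<Longrightarrow> m \<in> carrier M \<Longrightarrow>
      (x \<oplus>\<^bsub>Q I\<^esub> y) \<odot>\<^bsub>M\<^esub> m = x \<odot>\<^bsub>M\<^esub> m \<oplus>\<^bsub>M\<^esub> y \<odot>\<^bsub>M\<^esub> m"
    and add_mod: "\<And>x m n. x \<in> carrier (Q I) \<Longrightarrow> m \<in> carrier M \<Longrightarrow> n \<in> carrier M \<Longrightarrow>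
      x \<odot>\<^bsub>M\<^esub> (m \<oplus>\<^bsub>M\<^esub> n) = x \<odot>\<^bsub>M\<^esub> m \<oplus>\<^bsub>M\<^esub> x \<odot>\<^bsub>M\<^esub> n"
    and simple: "simple_module (Q I) M" and faithful: "faithful_module (Q I) M"
    and \<sigma>: "\<And>a. a \<in> A \<Longrightarrow> \<sigma> a \<in> A" "\<And>a. \<sigma> (\<sigma> a) = a" "\<And>a b. \<sigma> (a + b) = \<sigma> a + \<sigma> b"
    and mult: "\<And>a b m. a \<in> A \<Longrightarrow> b \<in> A \<Longrightarrow> m \<in> carrier M \<Longrightarrow>
      qc I (\<sigma> (a * b)) \<odot>\<^bsub>M\<^esub> m = qc I (\<sigma> a) \<odot>\<^bsub>M\<^esub> (qc I (\<sigma> b) \<odot>\<^bsub>M\<^esub> m)"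
  shows "lprim {a \<in> A. \<sigma> a \<in> I}"
proof -
  interpret M: abelian_group M by (rule M)
  have q: "qc I a \<in> carrier (Q I)" if "a \<in> A" for a using that by (simp add: Q_def Quot_carrier)
  have qE: "\<exists>a\<in>A. x = qc I (\<sigma> a)" if x: "x \<in> carrier (Q I)" for x
  proof -
    obtain a where "a \<in> A" "x = qc I a" using x unfolding Q_def Quot_carrier by (elim imageE)
    then show ?thesis by (intro bexI[of _ "\<sigma> a"]) (simp_all add: \<sigma>(1,2))
  qed
  have "lprim {a \<in> A. \<forall>m\<in>carrier M. qc I (\<sigma> a) \<odot>\<^bsub>M\<^esub> m = \<zero>\<^bsub>M\<^esub>}"
  proof (rule module_lprim[OF M])
    obtain x m where x: "x \<in> carrier (Q I)" "m \<in> carrier M" "x \<odot>\<^bsub>M\<^esub> m \<noteq> \<zero>\<^bsub>M\<^esub>"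
      using conjunct1[OF simple[unfolded simple_module_def]] by (elim bexE)
    from qE[OF x(1)] obtain a where "a \<in> A" "x = qc I (\<sigma> a)" by (elim bexE)
    then show "\<exists>a\<in>A. \<exists>m\<in>carrier M. qc I (\<sigma> a) \<odot>\<^bsub>M\<^esub> m \<noteq> \<zero>\<^bsub>M\<^esub>" using x by blast
    show "U = {\<zero>\<^bsub>M\<^esub>} \<or> U = carrier M"
      if U: "subgroup U (add_monoid M)" "\<And>a n. a \<in> A \<Longrightarrow> n \<in> U \<Longrightarrow> qc I (\<sigma> a) \<odot>\<^bsub>M\<^esub> n \<in> U" for U
    proof -
      have "x \<odot>\<^bsub>M\<^esub> n \<in> U" if x: "x \<in> carrier (Q I)" and n: "n \<in> U" for x n
      proof -
        from qE[OF x] obtain a where "a \<in> A" "x = qc I (\<sigma> a)" by (elim bexE)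
        then show ?thesis using U(2)[OF _ n] by simp
      qed
      then have "submodule U (Q I) M" by (rule submodule_of_subgroup[OF U(1)])
      then show ?thesis using simple by (simp add: simple_module_def)
    qed
    show "qc I (\<sigma> (a + b)) \<odot>\<^bsub>M\<^esub> m = qc I (\<sigma> a) \<odot>\<^bsub>M\<^esub> m \<oplus>\<^bsub>M\<^esub> qc I (\<sigma> b) \<odot>\<^bsub>M\<^esub> m"
      if "a \<in> A" "b \<in> A" "m \<in> carrier M" for a b m
      using add_ring[OF q q, of "\<sigma> a" "\<sigma> b" m] that \<sigma> by (simp add: Q_def Quot_add[OF I])
  qed (use q \<sigma>(1) closed add_mod mult in auto)
  moreover have "(\<forall>m\<in>carrier M. qc I a \<odot>\<^bsub>M\<^esub> m = \<zero>\<^bsub>M\<^esub>) \<longleftrightarrow> a \<in> I" if a: "a \<in> A" for a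
  proof
    assume "\<forall>m\<in>carrier M. qc I a \<odot>\<^bsub>M\<^esub> m = \<zero>\<^bsub>M\<^esub>"
    then have "qc I a = \<zero>\<^bsub>Q I\<^esub>" using faithful q[OF a] by (auto simp: faithful_module_def)
    then show "a \<in> I" using qc_cong[OF I a, of 0] by (simp add: Q_def Quot_zero[OF I])
  next
    assume "a \<in> I"
    then have a0: "qc I a = qc I 0" using qc_cong[OF I a, of 0] by auto
    show "\<forall>m\<in>carrier M. qc I a \<odot>\<^bsub>M\<^esub> m = \<zero>\<^bsub>M\<^esub>"
    proof
      fix m assume m: "m \<in> carrier M"
      have "qc I 0 \<odot>\<^bsub>M\<^esub> m \<oplus>\<^bsub>M\<^esub> qc I 0 \<odot>\<^bsub>M\<^esub> m = qc I 0 \<odot>\<^bsub>M\<^esub> m"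
        using add_ring[OF q q m, of 0 0] by (simp add: Q_def Quot_add[OF I])
      then show "qc I a \<odot>\<^bsub>M\<^esub> m = \<zero>\<^bsub>M\<^esub>" using closed[OF q[of 0] m] by (simp add: a0)
    qed
  qed
  then have "{a \<in> A. \<forall>m\<in>carrier M. qc I (\<sigma> a) \<odot>\<^bsub>M\<^esub> m = \<zero>\<^bsub>M\<^esub>} = {a \<in> A. \<sigma> a \<in> I}"
    using \<sigma>(1) by blast
  ultimately show ?thesis by simp
qed

lemma left_primitive_lprim:
  assumes I: "tsi I" and lp: "left_primitive (R Quot \<theta> ` I)" shows "lprim I"
proof -
  let ?Q = "R Quot \<theta> ` I"
  obtain M :: "(('v, 'e, 'k) lpa_elem set, ('v, 'e, 'k) lpa_elem set set) module"
    where M: "left_module ?Q M" "simple_module ?Q M" "faithful_module ?Q M"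
    using lp unfolding left_primitive_def by blast
  interpret M: left_module ?Q M by (rule M)
  have "lprim {a \<in> A. a \<in> I}"
    by (rule quotient_module_lprim[OF I M.abelian_group_axioms M.act_closed M.act_add_ring M.act_add_mod
          M(2,3), of "\<lambda>a. a"])
      (auto simp: Quot_carrier M.act_mult simp flip: Quot_mult[OF I])
  moreover have "{a \<in> A. a \<in> I} = I" using tsiD(1)[OF I] by blast
  ultimately show ?thesis by simp
qed

text \<open>A right module becomes a left module when \<open>a\<close> acts as
  \<open>lstar a\<close>; this replaces the annihilator by its image under the involution.\<close>

lemma right_primitive_lprim:
  assumes I: "tsi I" and rp: "right_primitive (R Quot \<theta> ` I)" shows "lprim (lstar ` I)"
proof -
  let ?Q = "R Quot \<theta> ` I"
  obtain M :: "(('v, 'e, 'k) lpa_elem set, ('v, 'e, 'k) lpa_elem set set) module"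
    where M: "right_module ?Q M" "simple_module ?Q M" "faithful_module ?Q M"
    using rp unfolding right_primitive_def by blast
  interpret M: right_module ?Q M by (rule M)
  have "lprim {a \<in> A. lstar a \<in> I}"
    by (rule quotient_module_lprim[OF I M.abelian_group_axioms M.act_closed M.act_add_ring M.act_add_mod
          M(2,3), of lstar])
      (auto simp: Quot_carrier M.act_mult star_add star_mult simp flip: Quot_mult[OF I])
  moreover have "{a \<in> A. lstar a \<in> I} = lstar ` I"
    using tsiD(1)[OF I] A_star by (auto simp: star_image_iff)
  ultimately show ?thesis by simp
qed

text \<open>A coset acts through any of its representatives: two of them differ by an element of
  \<open>I\<close>, which is the kernel of the action.\<close>

lemma action_module:
  fixes N :: "'n::ab_group_add set" and \<rho> :: "('v, 'e, 'k) lprod \<Rightarrow> 'n \<Rightarrow> 'n"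
  assumes N: "0 \<in> N" "\<And>m n. m \<in> N \<Longrightarrow> n \<in> N \<Longrightarrow> m + n \<in> N" "\<And>m. m \<in> N \<Longrightarrow> - m \<in> N"
    and closed: "\<And>a m. a \<in> A \<Longrightarrow> m \<in> N \<Longrightarrow> \<rho> a m \<in> N"
    and add_left: "\<And>a b m. a \<in> A \<Longrightarrow> b \<in> A \<Longrightarrow> m \<in> N \<Longrightarrow> \<rho> (a + b) m = \<rho> a m + \<rho> b m"
    and add_right: "\<And>a m n. a \<in> A \<Longrightarrow> m \<in> N \<Longrightarrow> n \<in> N \<Longrightarrow> \<rho> a (m + n) = \<rho> a m + \<rho> a n"
    and nonzero: "\<exists>a\<in>A. \<exists>m\<in>N. \<rho> a m \<noteq> 0"
    and simple: "\<And>U. U \<subseteq> N \<Longrightarrow> U \<noteq> {0} \<Longrightarrow> 0 \<in> U \<Longrightarrow> (\<And>m n. m \<in> U \<Longrightarrow> n \<in> U \<Longrightarrow> m + n \<in> U) \<Longrightarrow>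
      (\<And>a m. a \<in> A \<Longrightarrow> m \<in> U \<Longrightarrow> \<rho> a m \<in> U) \<Longrightarrow> U = N"
    and I: "tsi I" and kernel: "I = {a \<in> A. \<forall>m\<in>N. \<rho> a m = 0}"
  obtains M :: "(('v, 'e, 'k) lpa_elem set, 'n) module" where
    "carrier M = N" "\<And>m n. m \<oplus>\<^bsub>M\<^esub> n = m + n" "\<And>a m. a \<in> A \<Longrightarrow> m \<in> N \<Longrightarrow> qc I a \<odot>\<^bsub>M\<^esub> m = \<rho> a m"
    "abelian_group M" "simple_module (R Quot \<theta> ` I) M" "faithful_module (R Quot \<theta> ` I) M"
proof
  define M :: "(('v, 'e, 'k) lpa_elem set, 'n) module" where
    "M = \<lparr>carrier = N, mult = undefined, one = undefined, zero = 0, add = (+),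
       smult = \<lambda>Z m. \<rho> (SOME a. a \<in> A \<and> qc I a = Z) m\<rparr>"
  show car: "carrier M = N" and add: "\<And>m n. m \<oplus>\<^bsub>M\<^esub> n = m + n" by (simp_all add: M_def)
  have zero: "\<zero>\<^bsub>M\<^esub> = 0" by (simp add: M_def)
  show smult: "qc I a \<odot>\<^bsub>M\<^esub> m = \<rho> a m" if a: "a \<in> A" and m: "m \<in> N" for a m
  proof -
    define b where "b = (SOME b. b \<in> A \<and> qc I b = qc I a)"
    have "b \<in> A \<and> qc I b = qc I a" unfolding b_def by (rule someI[of _ a]) (simp add: a)
    then have b: "b \<in> A" "b - a \<in> I" using qc_cong[OF I] a by auto
    then have "\<rho> (b - a) m = 0" using m by (auto simp: kernel)
    then have "\<rho> b m = \<rho> a m" using add_left[of "b - a" a m] a b m by simp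
    then show ?thesis by (simp add: M_def b_def)
  qed
  show ab: "abelian_group M"
  proof (rule abelian_groupI)
    fix x assume "x \<in> carrier M"
    then show "\<exists>y\<in>carrier M. y \<oplus>\<^bsub>M\<^esub> x = \<zero>\<^bsub>M\<^esub>"
      by (intro bexI[of _ "- x"]) (auto simp: car add zero N)
  qed (auto simp: car add zero N add_ac)
  show "faithful_module (R Quot \<theta> ` I) M"
    unfolding faithful_module_def Quot_carrier car zero
  proof (intro ballI impI)
    fix Z assume "Z \<in> qc I ` A" and Z: "\<forall>m\<in>N. Z \<odot>\<^bsub>M\<^esub> m = 0"
    then obtain a where a: "a \<in> A" "Z = qc I a" by blast
    then have "\<forall>m\<in>N. \<rho> a m = 0" using Z smult by auto
    then have "a \<in> I" using a by (subst kernel) simp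
    then show "Z = \<zero>\<^bsub>R Quot \<theta> ` I\<^esub>" using a qc_cong[OF I, of a 0] by (simp add: Quot_zero[OF I])
  qed
  show "simple_module (R Quot \<theta> ` I) M"
    unfolding simple_module_def Quot_carrier car zero
  proof (intro conjI allI impI)
    show "\<exists>a\<in>qc I ` A. \<exists>m\<in>N. a \<odot>\<^bsub>M\<^esub> m \<noteq> 0" using nonzero by (auto simp: smult)
    fix U assume "submodule U (R Quot \<theta> ` I) M"
    then interpret U: submodule U "R Quot \<theta> ` I" M .
    have sub: "U \<subseteq> N" using U.subset by (simp add: car)
    have zero_U: "0 \<in> U" using U.one_closed by (simp add: zero)
    have add_U: "m + n \<in> U" if "m \<in> U" "n \<in> U" for m n using U.m_closed[OF that] by (simp add: add)
    have act_U: "\<rho> a m \<in> U" if "a \<in> A" "m \<in> U" for a m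
    proof -
      have "qc I a \<odot>\<^bsub>M\<^esub> m \<in> U" by (rule U.smult_closed) (use that in \<open>auto simp: Quot_carrier\<close>)
      moreover have "m \<in> N" using that sub by blast
      ultimately show ?thesis using smult that by simp
    qed
    show "U = {0} \<or> U = N" using simple[OF sub _ zero_U add_U act_U] by (cases "U = {0}") simp_all
  qed
qed

text \<open>The same vectors form a right module when \<open>a\<close> acts as
  \<open>lstar a\<close>, and its annihilator is the image of \<open>I\<close> under the
  involution.\<close>

lemma primitive_Ann:
  fixes N :: "'n::ab_group_add set" and \<rho> :: "('v, 'e, 'k) lprod \<Rightarrow> 'n \<Rightarrow> 'n"
  assumes N: "0 \<in> N" "\<And>m n. m \<in> N \<Longrightarrow> n \<in> N \<Longrightarrow> m + n \<in> N" "\<And>m. m \<in> N \<Longrightarrow> - m \<in> N"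
    and closed: "\<And>a m. a \<in> A \<Longrightarrow> m \<in> N \<Longrightarrow> \<rho> a m \<in> N"
    and add_left: "\<And>a b m. a \<in> A \<Longrightarrow> b \<in> A \<Longrightarrow> m \<in> N \<Longrightarrow> \<rho> (a + b) m = \<rho> a m + \<rho> b m"
    and add_right: "\<And>a m n. a \<in> A \<Longrightarrow> m \<in> N \<Longrightarrow> n \<in> N \<Longrightarrow> \<rho> a (m + n) = \<rho> a m + \<rho> a n"
    and mult: "\<And>a b m. a \<in> A \<Longrightarrow> b \<in> A \<Longrightarrow> m \<in> N \<Longrightarrow> \<rho> (a * b) m = \<rho> a (\<rho> b m)"
    and nonzero: "\<exists>a\<in>A. \<exists>m\<in>N. \<rho> a m \<noteq> 0"
    and simple: "\<And>U. U \<subseteq> N \<Longrightarrow> U \<noteq> {0} \<Longrightarrow> 0 \<in> U \<Longrightarrow> (\<And>m n. m \<in> U \<Longrightarrow> n \<in> U \<Longrightarrow> m + n \<in> U) \<Longrightarrow>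
      (\<And>a m. a \<in> A \<Longrightarrow> m \<in> U \<Longrightarrow> \<rho> a m \<in> U) \<Longrightarrow> U = N"
    and I: "tsi I" and kernel: "I = {a \<in> A. \<forall>m\<in>N. \<rho> a m = 0}"
  shows "left_primitive (R Quot \<theta> ` I)" "right_primitive (R Quot \<theta> ` lstar ` I)"
proof -
  obtain M :: "(('v, 'e, 'k) lpa_elem set, 'n) module" where M:
    "carrier M = N" "\<And>m n. m \<oplus>\<^bsub>M\<^esub> n = m + n" "\<And>a m. a \<in> A \<Longrightarrow> m \<in> N \<Longrightarrow> qc I a \<odot>\<^bsub>M\<^esub> m = \<rho> a m"
    "abelian_group M" "simple_module (R Quot \<theta> ` I) M" "faithful_module (R Quot \<theta> ` I) M"
  proof (rule action_module[of N \<rho> I])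
    show "I = {a \<in> A. \<forall>m\<in>N. \<rho> a m = 0}" by (rule kernel)
    show "\<exists>a\<in>A. \<exists>m\<in>N. \<rho> a m \<noteq> 0" by (rule nonzero)
    show "U = N" if U: "U \<subseteq> N" "U \<noteq> {0}" "0 \<in> U" "\<And>m n. m \<in> U \<Longrightarrow> n \<in> U \<Longrightarrow> m + n \<in> U"
      "\<And>a m. a \<in> A \<Longrightarrow> m \<in> U \<Longrightarrow> \<rho> a m \<in> U" for U
      by (rule simple[OF U])
  qed (use N I in \<open>auto simp: closed add_left add_right\<close>)
  interpret M: abelian_group M by (rule M)
  show "left_primitive (R Quot \<theta> ` I)"
  proof (rule left_primitiveI[OF abelian_group_Quot[OF I] _ _ M(5,6)])
    show "left_module (R Quot \<theta> ` I) M"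
      by unfold_locales
        (auto simp: M(1-3) Quot_carrier Quot_add[OF I] Quot_mult[OF I] closed add_left add_right mult N)
  qed (auto simp: Quot_carrier Quot_mult[OF I])
  let ?J = "lstar ` I"
  have J: "tsi ?J" by (rule tsi_star[OF I])
  define \<sigma> where "\<sigma> a = \<rho> (lstar a)" for a
  have star_bex: "(\<exists>a\<in>A. Q a) \<longleftrightarrow> (\<exists>a\<in>A. Q (lstar a))" for Q
    by (metis A_star star_star)
  obtain M' :: "(('v, 'e, 'k) lpa_elem set, 'n) module" where M':
    "carrier M' = N" "\<And>m n. m \<oplus>\<^bsub>M'\<^esub> n = m + n" "\<And>a m. a \<in> A \<Longrightarrow> m \<in> N \<Longrightarrow> qc ?J a \<odot>\<^bsub>M'\<^esub> m = \<sigma> a m"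
    "abelian_group M'" "simple_module (R Quot \<theta> ` ?J) M'" "faithful_module (R Quot \<theta> ` ?J) M'"
  proof (rule action_module[of N \<sigma> ?J])
    show "\<exists>a\<in>A. \<exists>m\<in>N. \<sigma> a m \<noteq> 0" using nonzero unfolding \<sigma>_def by (subst (asm) star_bex)
    show "?J = {a \<in> A. \<forall>m\<in>N. \<sigma> a m = 0}"
      unfolding \<sigma>_def using A_star by (auto simp: star_image_iff kernel)
    show "U = N" if U: "U \<subseteq> N" "U \<noteq> {0}" "0 \<in> U" "\<And>m n. m \<in> U \<Longrightarrow> n \<in> U \<Longrightarrow> m + n \<in> U"
      "\<And>a m. a \<in> A \<Longrightarrow> m \<in> U \<Longrightarrow> \<sigma> a m \<in> U" for U
      by (rule simple[OF U(1-4)]) (use U(5)[of "lstar _"] in \<open>auto simp: \<sigma>_def\<close>)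
  qed (use N J in \<open>auto simp: \<sigma>_def closed add_left add_right star_add\<close>)
  interpret M': abelian_group M' by (rule M')
  show "right_primitive (R Quot \<theta> ` ?J)"
  proof (rule right_primitiveI[OF abelian_group_Quot[OF J] _ _ M'(5,6)])
    show "right_module (R Quot \<theta> ` ?J) M'"
      by unfold_locales
        (auto simp: M'(1-3) Quot_carrier Quot_add[OF J] Quot_mult[OF J] closed add_left add_right mult N
          \<sigma>_def star_add star_mult)
  qed (auto simp: Quot_carrier Quot_mult[OF J])
qed

end

section \<open>Finite and infinite paths as branching systems\<close>

context wf_digraph
begin

section \<open>Finite paths with a fixed end\<close>

definition fin_paths :: "'a \<Rightarrow> 'b list set" where
  "fin_paths v = {p. \<exists>u. awalk u p v}"

definition fin_src :: "'a \<Rightarrow> 'b list \<Rightarrow> 'a" where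
  "fin_src v p = (if p = [] then v else tail G (hd p))"

lemma fin_paths_awalk: "p \<in> fin_paths v \<longleftrightarrow> awalk (fin_src v p) p v"
  unfolding fin_paths_def fin_src_def by (cases p) (auto simp: awalk_simps)

lemma fin_src_awalk: "awalk u p v \<Longrightarrow> fin_src v p = u"
  unfolding fin_src_def by (cases p) (auto simp: awalk_simps)

text \<open>The trivial path starts with no edge, so \<open>uncons\<close> holds only because
  \<open>v\<close> is a sink or an infinite emitter. Different paths with the same end differ in an
  edge, or one is exhausted first, after their common beginning is stripped.\<close>

lemma branching_system_fin_paths:
  assumes v: "v \<in> verts G" and sing: "infinite (out_arcs G v) \<or> out_arcs G v = {}"
  shows "branching_system G (fin_paths v) (fin_src v) (#) (\<lambda>p. int (length p))"
proof unfold_locales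
  show "fin_paths v \<noteq> {}" using v by (auto simp: fin_paths_def awalk_simps intro!: exI[of _ "[]"])
  show "fin_src v x \<in> verts G" if "x \<in> fin_paths v" for x using that by (auto simp: fin_paths_awalk)
  show *: "e # x \<in> fin_paths v" if "e \<in> arcs G" "x \<in> fin_paths v" "fin_src v x = head G e" for e x
    using that by (auto simp: fin_paths_awalk) (auto simp: fin_src_def awalk_simps)
  show "fin_src v (e # x) = tail G e" for e x by (simp add: fin_src_def)
  show "\<exists>e\<in>arcs G. \<exists>y\<in>fin_paths v. fin_src v y = head G e \<and> x = e # y"
    if x: "x \<in> fin_paths v" "finite (out_arcs G (fin_src v x))" "out_arcs G (fin_src v x) \<noteq> {}" for x
  proof (cases x)
    case Nil
    then show ?thesis using x sing by (simp add: fin_src_def)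
  next
    case (Cons e y)
    then have "e \<in> arcs G" "awalk (head G e) y v" using x by (auto simp: fin_paths_def awalk_simps)
    then show ?thesis using Cons fin_src_awalk by (auto simp: fin_paths_def)
  qed
  have tail_path: "x \<in> fin_paths v \<and> fin_src v x = head G e \<and> e \<in> arcs G" if "e # x \<in> fin_paths v" for e x
  proof -
    have "e \<in> arcs G" "awalk (head G e) x v" using that by (auto simp: fin_paths_def awalk_simps)
    then show ?thesis using fin_src_awalk by (auto simp: fin_paths_def)
  qed
  show "Y = fin_paths v"
    if Y: "Y \<subseteq> fin_paths v" "Y \<noteq> {}"
      and cl: "\<And>e x. e \<in> arcs G \<Longrightarrow> x \<in> fin_paths v \<Longrightarrow> fin_src v x = head G e \<Longrightarrow> (x \<in> Y) = (e # x \<in> Y)" for Y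
  proof -
    \<comment> \<open>Stripping the edges one by one links every path to the trivial one, so all
      points form one orbit.\<close>
    have iff: "x \<in> Y \<longleftrightarrow> [] \<in> Y" if "x \<in> fin_paths v" for x
      using that by (induction x) (use tail_path cl in blast)+
    then have "[] \<in> Y" using Y by blast
    then show ?thesis using iff Y(1) by blast
  qed
  show "separated G (fin_paths v) (fin_src v) (#) x y"
    if "x \<in> fin_paths v" "y \<in> fin_paths v" "x \<noteq> y" for x y
    using that
  proof (induction x arbitrary: y)
    case Nil
    then obtain f y' where y: "y = f # y'" by (cases y) auto
    show ?case unfolding y using tail_path[of f y'] Nil y by (intro separated.right) auto
  next
    case (Cons e x)
    note t = tail_path[OF Cons.prems(1)]
    show ?case
    proof (cases "\<exists>y'. y = e # y'")
      case True
      then obtain y' where y: "y = e # y'" by blast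
      show ?thesis
        unfolding y using t tail_path[of e y'] Cons y by (intro separated.step) auto
    next
      case False
      then show ?thesis using t by (intro separated.left) auto
    qed
  qed
qed auto

section \<open>Infinite paths tail equivalent to an aperiodic one\<close>

definition inf_path :: "(nat \<Rightarrow> 'b) \<Rightarrow> bool" where
  "inf_path x \<longleftrightarrow> (\<forall>i. x i \<in> arcs G \<and> head G (x i) = tail G (x (Suc i)))"

text \<open>No two different shifts agree, which excludes eventual periodicity as well.\<close>

definition aperiodic :: "(nat \<Rightarrow> 'b) \<Rightarrow> bool" where
  "aperiodic x \<longleftrightarrow> (\<forall>n m. (\<forall>i. x (i + n) = x (i + m)) \<longrightarrow> n = m)"

definition tail_class :: "(nat \<Rightarrow> 'b) \<Rightarrow> (nat \<Rightarrow> 'b) set" where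
  "tail_class p = {x. inf_path x \<and> (\<exists>n m. \<forall>i. x (i + n) = p (i + m))}"

text \<open>The lag: the number of edges of \<open>x\<close> before a common tail, minus the number
  of edges of \<open>p\<close> before it.\<close>

definition inf_deg :: "(nat \<Rightarrow> 'b) \<Rightarrow> (nat \<Rightarrow> 'b) \<Rightarrow> int" where
  "inf_deg p x = (THE d. \<exists>n m. d = int n - int m \<and> (\<forall>i. x (i + n) = p (i + m)))"

text \<open>Two ways of cutting off a common tail would give equal shifts of \<open>p\<close> by
  \<open>m + n'\<close> and \<open>m' + n\<close>, so the lags agree.\<close>

lemma inf_deg_eq:
  assumes p: "aperiodic p" and x: "\<forall>i. x (i + n) = p (i + m)"
  shows "inf_deg p x = int n - int m"
  unfolding inf_deg_def
proof (rule the_equality)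
  fix d assume "\<exists>n' m'. d = int n' - int m' \<and> (\<forall>i. x (i + n') = p (i + m'))"
  then obtain n' m' where d: "d = int n' - int m'" "\<forall>i. x (i + n') = p (i + m')" by blast
  have "p (i + (m + n')) = p (i + (m' + n))" for i
    using x[rule_format, of "i + n'"] d(2)[rule_format, of "i + n"] by (simp add: ac_simps)
  then have "m + n' = m' + n" using p unfolding aperiodic_def by blast
  then show "d = int n - int m" using d(1) by simp
qed (use x in blast)

lemma case_nat_shift: "case_nat (x 0) (\<lambda>i. x (Suc i)) = x"
  by (rule ext) (simp split: nat.split)

lemma inf_path_case_nat:
  "inf_path (case_nat e x) \<longleftrightarrow> e \<in> arcs G \<and> head G e = tail G (x 0) \<and> inf_path x"
  by (auto simp: inf_path_def split: nat.splits)

lemma tail_class_case_nat: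
  "case_nat e x \<in> tail_class p \<longleftrightarrow> e \<in> arcs G \<and> head G e = tail G (x 0) \<and> x \<in> tail_class p"
proof -
  have "(\<exists>n m. \<forall>i. case_nat e x (i + n) = p (i + m)) \<longleftrightarrow> (\<exists>n m. \<forall>i. x (i + n) = p (i + m))"
  proof
    assume "\<exists>n m. \<forall>i. case_nat e x (i + n) = p (i + m)"
    then obtain n m where "\<forall>i. case_nat e x (i + n) = p (i + m)" by blast
    then have "case_nat e x (Suc i + n) = p (Suc i + m)" for i by blast
    then have "\<forall>i. x (i + n) = p (i + Suc m)" by simp
    then show "\<exists>n m. \<forall>i. x (i + n) = p (i + m)" by blast
  next
    assume "\<exists>n m. \<forall>i. x (i + n) = p (i + m)"
    then obtain n m where "\<forall>i. x (i + n) = p (i + m)" by blast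
    then have "\<forall>i. case_nat e x (i + Suc n) = p (i + m)" by simp
    then show "\<exists>n m. \<forall>i. case_nat e x (i + n) = p (i + m)" by blast
  qed
  then show ?thesis by (auto simp: tail_class_def inf_path_case_nat)
qed

text \<open>An infinite path always has a first edge, which gives \<open>uncons\<close> at every
  vertex. Cutting off initial segments links each point to \<open>p\<close>, and two points that
  differ at index \<open>i\<close> are separated after at most \<open>i\<close> common edges are
  stripped.\<close>

lemma branching_system_tail_class:
  assumes p: "inf_path p" "aperiodic p"
  shows "branching_system G (tail_class p) (\<lambda>x. tail G (x 0)) case_nat (inf_deg p)"
proof unfold_locales
  have pp: "p \<in> tail_class p" using p by (auto simp: tail_class_def)
  then show "tail_class p \<noteq> {}" by blast
  show "tail G (x 0) \<in> verts G" if "x \<in> tail_class p" for x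
    using that by (auto simp: tail_class_def inf_path_def)
  show "case_nat e x \<in> tail_class p" if "e \<in> arcs G" "x \<in> tail_class p" "tail G (x 0) = head G e" for e x
    using that by (simp add: tail_class_case_nat)
  show "inf_deg p (case_nat e x) = inf_deg p x + 1" if x: "x \<in> tail_class p" for e x
  proof -
    obtain n m where nm: "\<forall>i. x (i + n) = p (i + m)" using x unfolding tail_class_def by blast
    then have "\<forall>i. case_nat e x (i + Suc n) = p (i + m)" by simp
    from inf_deg_eq[OF p(2) this] inf_deg_eq[OF p(2) nm] show ?thesis by simp
  qed
  show "e = f \<and> x = y" if "case_nat e x = case_nat f y" for e f :: 'b and x y
  proof -
    have "case_nat e x i = case_nat f y i" for i by (simp only: that)
    from this[of 0] this[of "Suc _"] show ?thesis by auto
  qed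
  have dec: "x 0 \<in> arcs G \<and> head G (x 0) = tail G (x (Suc 0)) \<and> (\<lambda>i. x (Suc i)) \<in> tail_class p"
    if "x \<in> tail_class p" for x
    using that tail_class_case_nat[of "x 0" "\<lambda>i. x (Suc i)" p] by (simp add: case_nat_shift)
  show "\<exists>e\<in>arcs G. \<exists>y\<in>tail_class p. tail G (y 0) = head G e \<and> x = case_nat e y" if "x \<in> tail_class p" for x
    using dec[OF that] case_nat_shift[of x] by metis
  show "Y = tail_class p"
    if Y: "Y \<subseteq> tail_class p" "Y \<noteq> {}"
      and cl: "\<And>e x. e \<in> arcs G \<Longrightarrow> x \<in> tail_class p \<Longrightarrow> tail G (x 0) = head G e \<Longrightarrow>
        (x \<in> Y) = (case_nat e x \<in> Y)" for Y
  proof -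
    have one: "x \<in> Y \<longleftrightarrow> (\<lambda>i. x (Suc i)) \<in> Y" if "x \<in> tail_class p" for x
      using cl[of "x 0" "\<lambda>i. x (Suc i)"] dec[OF that] by (simp add: case_nat_shift)
    have shift: "(\<lambda>i. x (i + n)) \<in> tail_class p \<and> (x \<in> Y \<longleftrightarrow> (\<lambda>i. x (i + n)) \<in> Y)"
      if "x \<in> tail_class p" for x n
    proof (induction n)
      case (Suc n)
      then show ?case using one[of "\<lambda>i. x (i + n)"] dec[of "\<lambda>i. x (i + n)"] by simp
    qed (use that in simp)
    have iff: "x \<in> Y \<longleftrightarrow> p \<in> Y" if x: "x \<in> tail_class p" for x
    proof -
      obtain n m where "\<forall>i. x (i + n) = p (i + m)" using x by (auto simp: tail_class_def)
      then have "(\<lambda>i. x (i + n)) = (\<lambda>i. p (i + m))" by blast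
      then show ?thesis using shift[OF x, of n] shift[OF pp, of m] by simp
    qed
    then have "p \<in> Y" using Y by blast
    then show ?thesis using iff Y(1) by blast
  qed
  show "separated G (tail_class p) (\<lambda>x. tail G (x 0)) case_nat x y"
    if xy: "x \<in> tail_class p" "y \<in> tail_class p" "x \<noteq> y" for x y
  proof -
    have first: "separated G (tail_class p) (\<lambda>x. tail G (x 0)) case_nat x y"
      if "x \<in> tail_class p" "x 0 \<noteq> y 0" for x y
    proof -
      have "\<forall>z\<in>tail_class p. tail G (z 0) = head G (x 0) \<longrightarrow> y \<noteq> case_nat (x 0) z"
        using that(2) by auto
      then show ?thesis
        using separated.left[of "x 0" G "\<lambda>i. x (Suc i)" "tail_class p" "\<lambda>x. tail G (x 0)" y case_nat]
          dec[OF that(1)] by (simp add: case_nat_shift)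
    qed
    have "x \<in> tail_class p \<Longrightarrow> y \<in> tail_class p \<Longrightarrow> x i \<noteq> y i \<Longrightarrow>
      separated G (tail_class p) (\<lambda>x. tail G (x 0)) case_nat x y" for i
    proof (induction i arbitrary: x y)
      case 0
      then show ?case using first by blast
    next
      case (Suc i)
      show ?case
      proof (cases "x 0 = y 0")
        case True
        have *: "separated G (tail_class p) (\<lambda>x. tail G (x 0)) case_nat (\<lambda>i. x (Suc i)) (\<lambda>i. y (Suc i))"
          using Suc dec by blast
        show ?thesis
        proof -
          have "separated G (tail_class p) (\<lambda>x. tail G (x 0)) case_nat
              (case_nat (x 0) (\<lambda>i. x (Suc i))) (case_nat (x 0) (\<lambda>i. y (Suc i)))"
            by (rule separated.step)
              (use * dec[OF Suc.prems(1)] dec[OF Suc.prems(2)] True in simp_all)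
          moreover have "case_nat (x 0) (\<lambda>i. y (Suc i)) = y"
            by (simp only: True case_nat_shift)
          ultimately show ?thesis by (simp only: case_nat_shift)
        qed
      qed (use first Suc in blast)
    qed
    then show ?thesis using xy by blast
  qed
qed (auto simp: tail_class_case_nat)

text \<open>A walk to a vertex of \<open>p\<close> can be continued along \<open>p\<close>;
  conversely a tail equivalent path eventually runs through vertices of \<open>p\<close>.\<close>

lemma reach_tail_class:
  assumes "inf_path p"
  shows "(\<exists>x\<in>tail_class p. tail G (x 0) = w) \<longleftrightarrow> (\<exists>j. w \<rightarrow>\<^sup>* tail G (p j))"
proof
  assume "\<exists>x\<in>tail_class p. tail G (x 0) = w"
  then obtain x n m where x: "inf_path x" "\<forall>i. x (i + n) = p (i + m)" "tail G (x 0) = w"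
    by (auto simp: tail_class_def)
  have "tail G (x 0) \<rightarrow>\<^sup>* tail G (x k)" for k
  proof (induction k)
    case 0
    show ?case using x(1) by (auto simp: inf_path_def)
  next
    case (Suc k)
    have "awalk (tail G (x k)) [x k] (tail G (x (Suc k)))"
      using x(1) by (auto simp: inf_path_def awalk_simps)
    then show ?case using Suc reachable_trans reachable_awalkI by blast
  qed
  from this[of n] x(2)[rule_format, of 0] x(3) show "\<exists>j. w \<rightarrow>\<^sup>* tail G (p j)" by auto
next
  assume "\<exists>j. w \<rightarrow>\<^sup>* tail G (p j)"
  then obtain j r where r: "awalk w r (tail G (p j))" by (auto simp: reachable_awalk)
  from r show "\<exists>x\<in>tail_class p. tail G (x 0) = w"
  proof (induction r arbitrary: w)
    case Nil
    have "(\<lambda>i. p (i + j)) \<in> tail_class p"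
    proof -
      have "\<exists>n m. \<forall>i. p (i + n + j) = p (i + m)" by (rule exI[of _ 0], rule exI[of _ j]) simp
      then show ?thesis using assms unfolding tail_class_def inf_path_def by simp
    qed
    then show ?case using Nil by (auto simp: awalk_simps intro!: bexI[of _ "\<lambda>i. p (i + j)"])
  next
    case (Cons e r)
    then have e: "e \<in> arcs G" "tail G e = w" "awalk (head G e) r (tail G (p j))" by (auto simp: awalk_simps)
    obtain x where x: "x \<in> tail_class p" "tail G (x 0) = head G e" using Cons.IH[OF e(3)] by blast
    then have "case_nat e x \<in> tail_class p" using e by (simp add: tail_class_case_nat)
    then show ?case using e(2) by (intro bexI[of _ "case_nat e x"]) auto
  qed
qed

end

subsection \<open>An aperiodic path that the whole maximal tail reaches\<close>

locale sinkless_tail = wf_digraph E for E :: "('v, 'e) pre_digraph" +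
  fixes M :: "'v set"
  assumes mt: "maximal_tail E M" and L: "condition_L (tail_subgraph E M)"
    and no_sink: "\<And>y. y \<in> M \<Longrightarrow> \<exists>e\<in>out_arcs E y. head E e \<in> M"
begin

lemma MT1: "v \<in> verts E \<Longrightarrow> w \<in> M \<Longrightarrow> v \<rightarrow>\<^sup>*\<^bsub>E\<^esub> w \<Longrightarrow> v \<in> M"
  and MT3: "v \<in> M \<Longrightarrow> w \<in> M \<Longrightarrow> \<exists>y\<in>M. v \<rightarrow>\<^sup>*\<^bsub>E\<^esub> y \<and> w \<rightarrow>\<^sup>*\<^bsub>E\<^esub> y"
  and M_ne: "M \<noteq> {}" and M_verts: "M \<subseteq> verts E"
  using mt unfolding maximal_tail_def by blast+

lemma MT1_awalk: "awalk v p w \<Longrightarrow> w \<in> M \<Longrightarrow> v \<in> M"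
  using MT1[of v w] by (auto intro: reachable_awalkI)

lemma long_walk: "y \<in> M \<Longrightarrow> \<exists>p z. awalk y p z \<and> z \<in> M \<and> length p = n"
proof (induction n arbitrary: y)
  case 0
  then show ?case using M_verts by (intro exI[of _ "[]"]) (auto simp: awalk_simps)
next
  case (Suc n)
  obtain e where e: "e \<in> out_arcs E y" "head E e \<in> M" using no_sink[OF Suc.prems] by blast
  obtain p z where "awalk (head E e) p z" "z \<in> M" "length p = n" using Suc.IH[OF e(2)] by blast
  then show ?case using e by (intro exI[of _ "e # p"]) (auto simp: awalk_simps)
qed

lemma walk_nth:
  assumes "awalk y p z" "z \<in> M"
  shows "i < length p \<Longrightarrow> p ! i \<in> arcs E \<and> tail E (p ! i) \<in> M \<and> head E (p ! i) \<in> M \<and> awalk y (take i p) (tail E (p ! i))"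
    and "Suc i < length p \<Longrightarrow> head E (p ! i) = tail E (p ! Suc i)"
proof -
  have *: "p ! i \<in> arcs E \<and> tail E (p ! i) \<in> M \<and> head E (p ! i) \<in> M \<and> awalk y (take i p) (tail E (p ! i))
     \<and> awalk (head E (p ! i)) (drop (Suc i) p) z" if i: "i < length p" for i
  proof -
    have "awalk y (take i p @ p ! i # drop (Suc i) p) z" using assms i by (simp add: id_take_nth_drop[symmetric])
    then obtain u where u: "awalk y (take i p) u" "awalk u (p ! i # drop (Suc i) p) z"
      unfolding awalk_append_iff by blast
    moreover from MT1_awalk[OF u(2) assms(2)] have "u \<in> M" .
    ultimately show ?thesis using MT1_awalk[OF _ assms(2)] by (auto simp: awalk_simps)
  qed
  then show "i < length p \<Longrightarrow> p ! i \<in> arcs E \<and> tail E (p ! i) \<in> M \<and> head E (p ! i) \<in> M \<and> awalk y (take i p) (tail E (p ! i))"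
    by blast
  assume i: "Suc i < length p"
  then have "drop (Suc i) p = p ! Suc i # drop (Suc (Suc i)) p" by (simp add: Cons_nth_drop_Suc)
  then show "head E (p ! i) = tail E (p ! Suc i)" using *[of i] i by (auto simp: awalk_simps)
qed

text \<open>If every extension of \<open>q\<close> inside \<open>M\<close> were \<open>(m - n)\<close>-periodic from \<open>n\<close> on, then beyond
  \<open>length q + m\<close> no edge of an extension could be exchanged, which makes a cycle without exit.\<close>

lemma break_period:
  assumes q: "awalk x q y" "y \<in> M" and nm: "n < m"
  shows "\<exists>r z i. awalk y r z \<and> z \<in> M \<and> i + m < length (q @ r) \<and> (q @ r) ! (i + n) \<noteq> (q @ r) ! (i + m)"
proof (rule ccontr)
  assume "\<not> ?thesis"
  then have per: "(q @ r) ! (i + n) = (q @ r) ! (i + m)"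
    if "awalk y r z" "z \<in> M" "i + m < length (q @ r)" for r z i using that by blast
  define d where "d = m - n"
  have d: "d > 0" "m = n + d" using nm by (auto simp: d_def)
  \<comment> \<open>The length leaves room for the position \<open>j0 + d\<close>, one full period
    beyond \<open>j0\<close>.\<close>
  obtain r z where r: "awalk y r z" "z \<in> M" "length r = m + d + 1" using long_walk[OF q(2)] by blast
  define s where "s = q @ r"
  define j0 where "j0 = length q + m"
  have s: "awalk x s z" "length s = j0 + d + 1"
    using awalk_appendI[OF q(1) r(1)] r(3) by (simp_all add: s_def j0_def)
  have per_s: "s ! j = s ! (j - d)" if "j0 \<le> j" "j < length s" for j
    using per[OF r(1,2), of "j - m"] that d by (simp add: s_def j0_def)
  \<comment> \<open>Cutting \<open>s\<close> at position \<open>j\<close> and continuing with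
    \<open>f\<close> gives another extension of \<open>q\<close> inside \<open>M\<close>. Its
    periodicity forces \<open>f\<close> to be the edge \<open>d\<close> positions earlier, and by
    the periodicity of \<open>s\<close> that edge is \<open>s ! j\<close>.\<close>
  have unique: "f = s ! j"
    if j: "j0 \<le> j" "j < length s" and f: "f \<in> arcs E" "tail E f = tail E (s ! j)" "head E f \<in> M" for j f
  proof -
    define t where "t = take (j - length q) r @ [f]"
    have take_s: "take j s = q @ take (j - length q) r" using j by (simp add: s_def j0_def)
    have "awalk x (take j s) (tail E (s ! j))" using walk_nth(1)[OF s(1) r(2) j(2)] by blast
    then have "awalk y (take (j - length q) r) (tail E (s ! j))"
      using q(1) unfolding take_s by (auto elim: awalkE')
    moreover have "awalk (tail E (s ! j)) [f] (head E f)" using f by (auto simp: awalk_simps)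
    ultimately have "awalk y t (head E f)" unfolding t_def by (rule awalk_appendI)
    moreover have qt: "q @ t = take j s @ [f]" by (simp add: t_def take_s)
    moreover have "length (take j s) = j" using j by simp
    ultimately have "(take j s @ [f]) ! (j - m + n) = (take j s @ [f]) ! (j - m + m)"
      using per[of t "head E f" "j - m"] f(3) j by (simp add: qt j0_def)
    moreover have "j - m + n = j - d" "j - d < j" "j - m + m = j" using j d by (auto simp: j0_def)
    moreover have "(take j s @ [f]) ! (j - d) = s ! (j - d)"
      using \<open>j - d < j\<close> j by (simp add: nth_append)
    moreover have "(take j s @ [f]) ! j = f" using \<open>length (take j s) = j\<close> by (metis nth_append_length)
    ultimately have "s ! (j - d) = f" by simp
    then show ?thesis using per_s[OF j] by simp
  qed
  \<comment> \<open>\<open>Q t\<close> says that beyond \<open>j0\<close> some vertex of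
    \<open>s\<close> recurs after \<open>t\<close> steps. The least such \<open>t\<close> makes the
    resulting closed path simple.\<close>
  define Q where "Q t \<longleftrightarrow> 0 < t \<and> (\<exists>i. j0 \<le> i \<and> i + t < length s \<and> tail E (s ! i) = tail E (s ! (i + t)))" for t
  have "Q d"
    unfolding Q_def using d s per_s[of "j0 + d"] by (auto intro!: exI[of _ j0])
  define t where "t = (LEAST t. Q t)"
  have "Q t" unfolding t_def by (rule LeastI) fact
  then obtain i where i: "0 < t" "j0 \<le> i" "i + t < length s" "tail E (s ! i) = tail E (s ! (i + t))"
    by (auto simp: Q_def)
  define c where "c = take t (drop i s)"
  have c: "length c = t" "\<And>k. k < t \<Longrightarrow> c ! k = s ! (i + k)" using i by (auto simp: c_def)
  have "awalk x (take (i + t) s) (tail E (s ! (i + t)))" "awalk x (take i s) (tail E (s ! i))"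
    using walk_nth(1)[OF s(1) r(2), of i] walk_nth(1)[OF s(1) r(2), of "i + t"] i(1,3) by auto
  moreover have "take (i + t) s = take i s @ c" by (simp add: c_def take_add)
  ultimately have cw: "awalk (tail E (s ! i)) c (tail E (s ! i))"
    using i(4) by (auto elim: awalkE')
  have "closed_simple_path (tail_subgraph E M) c"
    unfolding closed_simple_path_def
  proof (intro conjI allI impI exI)
    show "c \<noteq> []" using c(1) i(1) by auto
    have "tail E (s ! i) \<in> M" using walk_nth(1)[OF s(1) r(2), of i] i by simp
    moreover have "\<forall>e\<in>set c. e \<in> arcs E \<and> head E e \<in> M"
      using walk_nth(1)[OF s(1) r(2)] i c by (auto simp: in_set_conv_nth)
    ultimately show "pre_digraph.awalk (tail_subgraph E M) (tail E (s ! i)) c (tail E (s ! i))"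
      using cw by (auto simp: awalk_tail_subgraph awalk_def)
    fix k assume k: "0 < k \<and> k < length c"
    have "\<not> Q k" using not_less_Least[of k Q] k c(1) by (simp add: t_def)
    then show "tail (tail_subgraph E M) (c ! k) \<noteq> tail (tail_subgraph E M) (c ! 0)"
    proof -
      have "i + k < length s" using k c(1) i(3) by simp
      then have "tail E (s ! i) \<noteq> tail E (s ! (i + k))" using \<open>\<not> Q k\<close> k i(2) unfolding Q_def by blast
      then show ?thesis using c(2)[of k] c(2)[of 0] k c(1) i(1) by (simp add: tail_subgraph_def)
    qed
  qed
  then have "has_exit (tail_subgraph E M) c" using L unfolding condition_L_def by blast
  then obtain k f where k: "k < t" "f \<in> arcs E" "head E f \<in> M" "tail E f = tail E (c ! k)" "f \<noteq> c ! k"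
    using c(1) by (auto simp: has_exit_def tail_subgraph_def out_arcs_def)
  then show False using unique[of "i + k" f] i c(2)[of k] by simp
qed

text \<open>One stage of the path construction: (MT3) provides a common successor with
  \<open>w\<close>, \<open>break_period\<close> violates the given period, and a further edge makes
  the extension nonempty.\<close>

lemma extend_walk:
  assumes q: "awalk x q y" "y \<in> M" and w: "w \<in> M"
  shows "\<exists>r z. r \<noteq> [] \<and> awalk y r z \<and> z \<in> M \<and> w \<rightarrow>\<^sup>*\<^bsub>E\<^esub> z \<and>
    (n < m \<longrightarrow> (\<exists>i. i + m < length (q @ r) \<and> (q @ r) ! (i + n) \<noteq> (q @ r) ! (i + m)))"
proof -
  obtain y1 r1 where y1: "y1 \<in> M" "awalk y r1 y1" "w \<rightarrow>\<^sup>*\<^bsub>E\<^esub> y1"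
    using MT3[OF q(2) w] by (auto simp: reachable_awalk)
  have q1: "awalk x (q @ r1) y1" by (rule awalk_appendI[OF q(1) y1(2)])
  obtain r2 y2 where r2: "awalk y1 r2 y2" "y2 \<in> M"
    "n < m \<longrightarrow> (\<exists>i. i + m < length ((q @ r1) @ r2) \<and> ((q @ r1) @ r2) ! (i + n) \<noteq> ((q @ r1) @ r2) ! (i + m))"
  proof (cases "n < m")
    case True
    from break_period[OF q1 y1(1) True] that show thesis by blast
  next
    case False
    then show thesis using that[of "[]" y1] y1 M_verts by (auto simp: awalk_simps)
  qed
  obtain e where e: "e \<in> out_arcs E y2" "head E e \<in> M" using no_sink[OF r2(2)] by blast
  have we: "awalk y2 [e] (head E e)" using e by (auto simp: awalk_simps)
  have w2: "awalk y1 (r2 @ [e]) (head E e)" by (rule awalk_appendI[OF r2(1) we])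
  show ?thesis
  proof (intro exI[of _ "r1 @ r2 @ [e]"] exI[of _ "head E e"] conjI impI)
    show "awalk y (r1 @ r2 @ [e]) (head E e)" by (rule awalk_appendI[OF y1(2) w2])
    show "w \<rightarrow>\<^sup>*\<^bsub>E\<^esub> head E e" using y1(3) reachable_awalkI[OF w2] reachable_trans by blast
    assume "n < m"
    then obtain i where i: "i + m < length ((q @ r1) @ r2)" "((q @ r1) @ r2) ! (i + n) \<noteq> ((q @ r1) @ r2) ! (i + m)"
      using r2(3) by blast
    have "(((q @ r1) @ r2) @ [e]) ! (i + n) \<noteq> (((q @ r1) @ r2) @ [e]) ! (i + m)"
      using i \<open>n < m\<close> by (simp only: nth_append) simp
    then show "\<exists>i. i + m < length (q @ r1 @ r2 @ [e]) \<and>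
        (q @ r1 @ r2 @ [e]) ! (i + n) \<noteq> (q @ r1 @ r2 @ [e]) ! (i + m)"
      using i(1) by (intro exI[of _ i]) simp
  qed (use e in auto)
qed

text \<open>Countability allows a single sequence of stages to serve all requirements: stage
  \<open>k\<close> treats the \<open>k\<close>-th vertex of \<open>M\<close> and the
  \<open>k\<close>-th pair of shifts. Later stages only append edges, so a violated period stays
  violated.\<close>

theorem aperiodic_path:
  assumes "countable M"
  obtains p where "inf_path p" "aperiodic p" "\<And>i. tail E (p i) \<in> M"
    "\<And>w. w \<in> M \<Longrightarrow> \<exists>j. w \<rightarrow>\<^sup>*\<^bsub>E\<^esub> tail E (p j)"
proof -
  define x where "x = from_nat_into M 0"
  have xM: "x \<in> M" unfolding x_def by (rule from_nat_into[OF M_ne])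
  have "\<exists>f. \<forall>k. (awalk x (fst (f k)) (snd (f k)) \<and> snd (f k) \<in> M) \<and>
     ((\<exists>r. r \<noteq> [] \<and> fst (f (Suc k)) = fst (f k) @ r) \<and> from_nat_into M k \<rightarrow>\<^sup>*\<^bsub>E\<^esub> snd (f (Suc k)) \<and>
       (fst (prod_decode k) < snd (prod_decode k) \<longrightarrow> (\<exists>i. i + snd (prod_decode k) < length (fst (f (Suc k))) \<and>
         fst (f (Suc k)) ! (i + fst (prod_decode k)) \<noteq> fst (f (Suc k)) ! (i + snd (prod_decode k)))))"
  proof (rule dependent_nat_choice)
    show "\<exists>f. awalk x (fst f) (snd f) \<and> snd f \<in> M"
      using xM M_verts by (intro exI[of _ "([], x)"]) (auto simp: awalk_simps)
    fix f :: "'e list \<times> 'v" and k assume f: "awalk x (fst f) (snd f) \<and> snd f \<in> M"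
    obtain r z where r: "r \<noteq> []" "awalk (snd f) r z" "z \<in> M" "from_nat_into M k \<rightarrow>\<^sup>*\<^bsub>E\<^esub> z"
       "fst (prod_decode k) < snd (prod_decode k) \<longrightarrow> (\<exists>i. i + snd (prod_decode k) < length (fst f @ r) \<and>
         (fst f @ r) ! (i + fst (prod_decode k)) \<noteq> (fst f @ r) ! (i + snd (prod_decode k)))"
      using extend_walk[OF conjunct1[OF f] conjunct2[OF f] from_nat_into[OF M_ne, of k],
          where n = "fst (prod_decode k)" and m = "snd (prod_decode k)"]
      by (elim exE conjE)
    then show "\<exists>g. (awalk x (fst g) (snd g) \<and> snd g \<in> M) \<and>
     ((\<exists>r. r \<noteq> [] \<and> fst g = fst f @ r) \<and> from_nat_into M k \<rightarrow>\<^sup>*\<^bsub>E\<^esub> snd g \<and>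
       (fst (prod_decode k) < snd (prod_decode k) \<longrightarrow> (\<exists>i. i + snd (prod_decode k) < length (fst g) \<and>
         fst g ! (i + fst (prod_decode k)) \<noteq> fst g ! (i + snd (prod_decode k)))))"
      using awalk_appendI[OF conjunct1[OF f] r(2)]
      by (intro exI[of _ "(fst f @ r, z)"] conjI exI[of _ r]) (simp_all only: fst_conv snd_conv simp_thms)
  qed
  then obtain f where f: "\<And>k. awalk x (fst (f k)) (snd (f k))" "\<And>k. snd (f k) \<in> M"
    "\<And>k. \<exists>r. r \<noteq> [] \<and> fst (f (Suc k)) = fst (f k) @ r"
    "\<And>k. from_nat_into M k \<rightarrow>\<^sup>*\<^bsub>E\<^esub> snd (f (Suc k))"
    "\<And>k. fst (prod_decode k) < snd (prod_decode k) \<Longrightarrow> \<exists>i. i + snd (prod_decode k) < length (fst (f (Suc k))) \<and>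
         fst (f (Suc k)) ! (i + fst (prod_decode k)) \<noteq> fst (f (Suc k)) ! (i + snd (prod_decode k))"
    by blast
  define q where "q k = fst (f k)" for k
  have len: "k \<le> length (q k)" for k
  proof (induction k)
    case (Suc k)
    obtain r where "r \<noteq> []" "q (Suc k) = q k @ r" using f(3) by (auto simp: q_def)
    then show ?case using Suc by (cases r) auto
  qed simp
  have pre: "\<exists>r. q (k + l) = q k @ r" for k l
  proof (induction l)
    case (Suc l)
    then show ?case using f(3)[of "k + l"] by (auto simp: q_def)
  qed simp
  have nth_mono: "q l ! i = q k ! i" if kl: "k \<le> l" and i: "i < length (q k)" for k l i
  proof -
    obtain r where "q l = q k @ r" using pre[of k "l - k"] kl by auto
    then show ?thesis using i by (simp add: nth_append)
  qed
  have nth_eq: "q l ! i = q k ! i" if "i < length (q k)" "i < length (q l)" for k l i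
    using nth_mono[of k l i] nth_mono[of l k i] that by (cases "k \<le> l") auto
  \<comment> \<open>Every stage adds at least one edge, so position \<open>i\<close> is settled at
    stage \<open>Suc i\<close>.\<close>
  define p where "p i = q (Suc i) ! i" for i
  have p: "p i = q k ! i" if "i < length (q k)" for i k
    unfolding p_def by (rule nth_eq) (use that len[of "Suc i"] in auto)
  have qw: "awalk x (q k) (snd (f k))" for k using f(1) by (simp add: q_def)
  show thesis
  proof
    show "inf_path p"
      unfolding inf_path_def
    proof
      fix i
      have i: "Suc i < length (q (Suc (Suc i)))" using len[of "Suc (Suc i)"] by simp
      then show "p i \<in> arcs E \<and> head E (p i) = tail E (p (Suc i))"
        using walk_nth[OF qw f(2), of i "Suc (Suc i)"] p[of i "Suc (Suc i)"] p[of "Suc i" "Suc (Suc i)"] by simp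
    qed
    show "tail E (p i) \<in> M" for i
      using walk_nth(1)[OF qw f(2), of i "Suc i"] p[of i "Suc i"] len[of "Suc i"] by simp
    have no_period: "\<not> (\<forall>i. p (i + n) = p (i + m))" if nm: "n < m" for n m
    proof -
      define k where "k = prod_encode (n, m)"
      obtain i where "i + m < length (q (Suc k))" "q (Suc k) ! (i + n) \<noteq> q (Suc k) ! (i + m)"
        using f(5)[of k] nm by (auto simp: k_def q_def)
      then have "p (i + n) \<noteq> p (i + m)" using p[of "i + n" "Suc k"] p[of "i + m" "Suc k"] nm by simp
      then show ?thesis by blast
    qed
    show "aperiodic p"
      unfolding aperiodic_def
    proof (intro allI impI, rule ccontr)
      fix n m assume *: "\<forall>i. p (i + n) = p (i + m)" "n \<noteq> m"
      then have "n < m \<or> m < n" by auto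
      then show False using no_period[of n m] no_period[of m n] *(1) by auto
    qed
    fix w assume "w \<in> M"
    then obtain k where k: "w = from_nat_into M k" using from_nat_into_surj[OF assms] by metis
    \<comment> \<open>The vertex where stage \<open>Suc k\<close> ends is the source of the first
      edge added by the next stage and therefore lies on \<open>p\<close>.\<close>
    obtain r where r: "r \<noteq> []" "q (Suc (Suc k)) = q (Suc k) @ r" using f(3) by (auto simp: q_def)
    have "awalk (snd (f (Suc k))) r (snd (f (Suc (Suc k))))"
      using qw[of "Suc (Suc k)"] qw[of "Suc k"] unfolding r(2) by (auto elim: awalkE')
    then have "tail E (r ! 0) = snd (f (Suc k))" using r(1) by (cases r) (auto simp: awalk_simps)
    moreover have "p (length (q (Suc k))) = r ! 0"
      using p[of "length (q (Suc k))" "Suc (Suc k)"] r by (simp add: nth_append)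
    ultimately show "\<exists>j. w \<rightarrow>\<^sup>*\<^bsub>E\<^esub> tail E (p j)"
      using f(4)[of k] k by (intro exI[of _ "length (q (Suc k))"]) simp
  qed
qed

end

section \<open>The classification\<close>

context lpa_graph
begin

section \<open>Components and graded ideals in the algebra of cosets\<close>

lemma path_elem_\<theta>: "awalk u p w \<Longrightarrow> path_elem E u p = \<theta> (pe u p)"
proof (induction p arbitrary: u)
  case (Cons e p)
  then have e: "e \<in> arcs E" "awalk (head E e) p w" by (auto simp: awalk_simps)
  have path_elem_base: "path_elem E x (f # q) = path_elem E y (f # q)" for x y f q
    by (induction q arbitrary: f) auto
  show ?case
  proof (cases p)
    case Nil
    then show ?thesis using e by (simp add: lpa_gen_\<theta> S_P)
  next
    case (Cons f q)
    have "path_elem E u (e # p) = lpa_gen E (Edge e) \<otimes>\<^bsub>R\<^esub> path_elem E (head E e) p"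
      unfolding Cons by (simp add: path_elem_base[of u _ _ "head E e"])
    then show ?thesis using Cons.IH[OF e(2)] e A_pe[OF e(2)] by (simp add: lpa_gen_\<theta> \<theta>_mult)
  qed
qed (auto simp: lpa_gen_\<theta> awalk_simps)

lemma ghost_path_elem_\<theta>: "awalk u p w \<Longrightarrow> ghost_path_elem E u p = \<theta> (lstar (pe u p))"
proof (induction p arbitrary: u)
  case (Cons e p)
  then have e: "e \<in> arcs E" "awalk (head E e) p w" by (auto simp: awalk_simps)
  have ghost_base: "ghost_path_elem E x (f # q) = ghost_path_elem E y (f # q)" for x y f q
    by (induction q arbitrary: f) auto
  show ?case
  proof (cases p)
    case Nil
    then show ?thesis using e by (simp add: lpa_gen_\<theta> star_mult star_P star_S P_T)
  next
    case (Cons f q)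
    have "ghost_path_elem E u (e # p) = ghost_path_elem E (head E e) p \<otimes>\<^bsub>R\<^esub> lpa_gen E (Ghost e)"
      unfolding Cons by (simp add: ghost_base[of u _ _ "head E e"])
    then show ?thesis using Cons.IH[OF e(2)] e A_pe[OF e(2)]
      by (simp add: lpa_gen_\<theta> \<theta>_mult star_mult star_S)
  qed
qed (auto simp: lpa_gen_\<theta> awalk_simps star_P)

lemma linear_span_\<theta>:
  assumes X: "X \<subseteq> A" shows "linear_span R (\<theta> ` X) = \<theta> ` span X"
proof -
  have sum: "(\<Oplus>\<^bsub>R\<^esub>x\<in>\<theta> ` t. c x \<odot>\<^bsub>R\<^esub> x) = \<theta> (\<Sum>a\<in>t. lscale (c (\<theta> a)) a)" if t: "t \<subseteq> X" for t c
  proof -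
    have tA: "t \<subseteq> A" using t X by blast
    have "(\<Oplus>\<^bsub>R\<^esub>x\<in>\<theta> ` t. c x \<odot>\<^bsub>R\<^esub> x) = (\<Oplus>\<^bsub>R\<^esub>a\<in>t. c (\<theta> a) \<odot>\<^bsub>R\<^esub> \<theta> a)"
      by (rule R.finsum_reindex) (use tA inj_on_subset[OF inj_\<theta> tA] in \<open>auto simp: \<theta>_carrier \<theta>_sc[symmetric] subset_iff\<close>)
    also have "\<dots> = (\<Oplus>\<^bsub>R\<^esub>a\<in>t. \<theta> (lscale (c (\<theta> a)) a))"
      by (rule R.finsum_cong') (use tA in \<open>auto simp: \<theta>_carrier \<theta>_sc subset_iff simp flip: \<theta>_sc\<close>)
    also have "\<dots> = \<theta> (\<Sum>a\<in>t. lscale (c (\<theta> a)) a)"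
      by (rule \<theta>_sum[symmetric]) (use tA in auto)
    finally show ?thesis .
  qed
  show ?thesis
  proof (intro Set.set_eqI iffI)
    fix z assume "z \<in> linear_span R (\<theta> ` X)"
    then obtain c Y where Y: "finite Y" "Y \<subseteq> \<theta> ` X" "z = (\<Oplus>\<^bsub>R\<^esub>x\<in>Y. c x \<odot>\<^bsub>R\<^esub> x)"
      unfolding linear_span_def by blast
    obtain t where t: "t \<subseteq> X" "finite t" "Y = \<theta> ` t" using finite_subset_image[OF Y(1,2)] by blast
    have "z = \<theta> (\<Sum>a\<in>t. lscale (c (\<theta> a)) a)" using Y(3) sum[OF t(1)] t(3) by simp
    moreover have "(\<Sum>a\<in>t. lscale (c (\<theta> a)) a) \<in> span X"
      using t(1) by (intro span_sum span_scale span_base) auto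
    ultimately show "z \<in> \<theta> ` span X" by blast
  next
    fix z assume "z \<in> \<theta> ` span X"
    then obtain t r where t: "finite t" "t \<subseteq> X" "z = \<theta> (\<Sum>a\<in>t. lscale (r a) a)"
      unfolding span_explicit by blast
    define c where "c = r \<circ> the_inv_into A \<theta>"
    have c: "c (\<theta> a) = r a" if "a \<in> t" for a
      using that t(2) X the_inv_into_f_f[OF inj_\<theta>, of a] by (auto simp: c_def)
    have "z = (\<Oplus>\<^bsub>R\<^esub>x\<in>\<theta> ` t. c x \<odot>\<^bsub>R\<^esub> x)"
      unfolding sum[OF t(2)] t(3) using c by (simp cong: sum.cong)
    then show "z \<in> linear_span R (\<theta> ` X)"
      unfolding linear_span_def using t(1,2) by blast
  qed
qed

lemma lpa_component_\<theta>: "lpa_component E k = \<theta> ` AK k"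
proof -
  have "{path_elem E u p \<otimes>\<^bsub>R\<^esub> ghost_path_elem E v q | u p v q w.
        awalk u p w \<and> awalk v q w \<and> int (length p) - int (length q) = k} = \<theta> ` Mset k"
  proof (intro Set.set_eqI iffI)
    fix z assume "z \<in> {path_elem E u p \<otimes>\<^bsub>R\<^esub> ghost_path_elem E v q | u p v q w.
        awalk u p w \<and> awalk v q w \<and> int (length p) - int (length q) = k}"
    then obtain u p v q w where z: "z = path_elem E u p \<otimes>\<^bsub>R\<^esub> ghost_path_elem E v q"
      "awalk u p w" "awalk v q w" "int (length p) - int (length q) = k" by blast
    then have "z = \<theta> (pe u p * lstar (pe v q))"
      using A_pe[OF z(2)] A_pe[OF z(3)] by (simp add: path_elem_\<theta>[OF z(2)] ghost_path_elem_\<theta>[OF z(3)] \<theta>_mult)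
    then show "z \<in> \<theta> ` Mset k" using MsetI[OF z(2-4)] by blast
  next
    fix z assume "z \<in> \<theta> ` Mset k"
    then obtain u p v q w where z: "z = \<theta> (pe u p * lstar (pe v q))"
      "awalk u p w" "awalk v q w" "int (length p) - int (length q) = k" unfolding Mset_def by blast
    then have "z = path_elem E u p \<otimes>\<^bsub>R\<^esub> ghost_path_elem E v q"
      using A_pe[OF z(2)] A_pe[OF z(3)] by (simp add: path_elem_\<theta>[OF z(2)] ghost_path_elem_\<theta>[OF z(3)] \<theta>_mult)
    then show "z \<in> {path_elem E u p \<otimes>\<^bsub>R\<^esub> ghost_path_elem E v q | u p v q w.
        awalk u p w \<and> awalk v q w \<and> int (length p) - int (length q) = k}" using z(2-4) by blast
  qed
  moreover have "Mset k \<subseteq> A" using Mset_A by blast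
  ultimately show ?thesis
    unfolding lpa_component_def AK_def by (simp only: linear_span_\<theta>)
qed

text \<open>By \<open>decomp\<close> any decomposition into homogeneous summands is the one given by
  \<open>lproj\<close>. So uniqueness is automatic, and existence inside \<open>I\<close> means that
  the projections preserve \<open>I\<close>.\<close>

lemma graded_ideal_\<theta>:
  assumes IA: "I \<subseteq> A" shows "graded_ideal E (\<theta> ` I) \<longleftrightarrow> graded I"
proof (cases "tsi I")
  case False
  then show ?thesis using two_sided_ideal_\<theta>[OF IA] by (simp add: graded_ideal_def graded_def)
next
  case I: True
  have C: "\<theta> ` I \<inter> lpa_component E k = \<theta> ` (I \<inter> AK k)" for k
    unfolding lpa_component_\<theta> using inj_on_image_Int[OF inj_\<theta> IA, of "AK k"] AK_A by blast
  have sub: "additive_subgroup (\<theta> ` (I \<inter> AK k)) R \<and> \<theta> ` (I \<inter> AK k) \<subseteq> \<theta> ` I" for k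
    using additive_subgroup_\<theta>[of "I \<inter> AK k"] IA tsiD(2,3)[OF I] AK_closed by auto
  have decomp: "lproj k x = g k"
    if x: "x = (\<Sum>k\<in>K. g k)" and g: "\<And>k. g k \<in> AK k" and K: "finite K" "\<And>k. k \<notin> K \<Longrightarrow> g k = 0" for x g K k
  proof -
    have "lproj k x = (\<Sum>l\<in>K. if l = k then g k else 0)"
      unfolding x by (subst proj_sum, rule sum.cong) (auto simp: proj_AK[OF g])
    then show ?thesis using K by simp
  qed
  have choose_preimage: "\<exists>g. \<forall>k. g k \<in> I \<inter> AK k \<and> f k = \<theta> (g k)"
    if "\<forall>k. f k \<in> \<theta> ` (I \<inter> AK k)" for f
    by (rule choice) (use that in blast)
  have sumform: "(\<Oplus>\<^bsub>R\<^esub>k\<in>{k. \<theta> (g k) \<noteq> \<zero>\<^bsub>R\<^esub>}. \<theta> (g k)) = \<theta> (\<Sum>k\<in>{k. g k \<noteq> 0}. g k)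
     \<and> {k. \<theta> (g k) \<noteq> \<zero>\<^bsub>R\<^esub>} = {k. g k \<noteq> 0}" if "\<And>k. g k \<in> A" for g :: "int \<Rightarrow> _"
  proof -
    have "{k. \<theta> (g k) \<noteq> \<zero>\<^bsub>R\<^esub>} = {k. g k \<noteq> 0}" using that by (simp add: \<theta>_inj flip: \<theta>_0)
    then show ?thesis using \<theta>_sum[of "{k. g k \<noteq> 0}" g] that by simp
  qed
  show ?thesis
  proof
    assume gr: "graded_ideal E (\<theta> ` I)"
    show "graded I"
      unfolding graded_def
    proof (intro conjI ballI allI)
      show "tsi I" by (rule I)
      fix x k assume x: "x \<in> I"
      have "\<forall>z\<in>\<theta> ` I. \<exists>!f. (\<forall>k. f k \<in> \<theta> ` (I \<inter> AK k)) \<and> finite {k. f k \<noteq> \<zero>\<^bsub>R\<^esub>} \<and>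
          z = (\<Oplus>\<^bsub>R\<^esub>k\<in>{k. f k \<noteq> \<zero>\<^bsub>R\<^esub>}. f k)"
        using gr unfolding graded_ideal_def internal_direct_sum_def C by (elim conjE)
      from bspec[OF this imageI[OF x]]
      obtain f where f: "\<forall>k. f k \<in> \<theta> ` (I \<inter> AK k)" "finite {k. f k \<noteq> \<zero>\<^bsub>R\<^esub>}"
        "\<theta> x = (\<Oplus>\<^bsub>R\<^esub>k\<in>{k. f k \<noteq> \<zero>\<^bsub>R\<^esub>}. f k)"
        by (elim ex1E conjE)
      obtain g where "\<forall>k. g k \<in> I \<inter> AK k \<and> f k = \<theta> (g k)" using choose_preimage[of f] f(1) by blast
      then have g: "\<And>k. g k \<in> I \<inter> AK k" "\<And>k. f k = \<theta> (g k)" by simp_all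
      have gA: "g k \<in> A" for k using g(1)[of k] IA by auto
      have f': "f = (\<lambda>k. \<theta> (g k))" using g(2) by blast
      have "\<theta> x = \<theta> (\<Sum>k\<in>{k. g k \<noteq> 0}. g k)" by (rule trans[OF f(3)[unfolded f'] conjunct1[OF sumform[of g, OF gA]]])
      then have "x = (\<Sum>k\<in>{k. g k \<noteq> 0}. g k)" using x IA gA by (subst (asm) \<theta>_inj) (auto intro!: A_sum)
      moreover have "finite {k. g k \<noteq> 0}" using f(2) sumform[of g, OF gA] unfolding f' by simp
      ultimately have "lproj k x = g k" using g(1) by (intro decomp[of x g "{k. g k \<noteq> 0}"]) auto
      then show "lproj k x \<in> I" using g(1) by simp
    qed
  next
    assume gr: "graded I"
    show "graded_ideal E (\<theta> ` I)"
      unfolding graded_ideal_def internal_direct_sum_def C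
    proof (intro conjI allI ballI)
      show "two_sided_ideal (\<theta> ` I) R" using I two_sided_ideal_\<theta>[OF IA] by simp
      fix z assume "z \<in> \<theta> ` I"
      then obtain x where x: "x \<in> I" "z = \<theta> x" by blast
      then have xA: "x \<in> A" using IA by blast
      have pA: "lproj k x \<in> A" for k using proj_in_AK[OF xA] AK_A by blast
      show "\<exists>!f. (\<forall>k. f k \<in> \<theta> ` (I \<inter> AK k)) \<and> finite {k. f k \<noteq> \<zero>\<^bsub>R\<^esub>} \<and>
          z = (\<Oplus>\<^bsub>R\<^esub>k\<in>{k. f k \<noteq> \<zero>\<^bsub>R\<^esub>}. f k)"
      proof (rule ex1I[of _ "\<lambda>k. \<theta> (lproj k x)"])
        show "(\<forall>k. \<theta> (lproj k x) \<in> \<theta> ` (I \<inter> AK k)) \<and> finite {k. \<theta> (lproj k x) \<noteq> \<zero>\<^bsub>R\<^esub>} \<and>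
          z = (\<Oplus>\<^bsub>R\<^esub>k\<in>{k. \<theta> (lproj k x) \<noteq> \<zero>\<^bsub>R\<^esub>}. \<theta> (lproj k x))"
          using sumform[of "\<lambda>k. lproj k x", OF pA] proj_decomp[OF xA] proj_in_AK[OF xA] gr x
          by (auto simp: graded_def)
        fix f assume f: "(\<forall>k. f k \<in> \<theta> ` (I \<inter> AK k)) \<and> finite {k. f k \<noteq> \<zero>\<^bsub>R\<^esub>} \<and>
          z = (\<Oplus>\<^bsub>R\<^esub>k\<in>{k. f k \<noteq> \<zero>\<^bsub>R\<^esub>}. f k)"
        then obtain g where "\<forall>k. g k \<in> I \<inter> AK k \<and> f k = \<theta> (g k)" using choose_preimage[of f] by blast
        then have g: "\<And>k. g k \<in> I \<inter> AK k" "\<And>k. f k = \<theta> (g k)" by simp_all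
        have gA: "g k \<in> A" for k using g(1)[of k] IA by auto
        have f': "f = (\<lambda>k. \<theta> (g k))" using g(2) by blast
        have "\<theta> x = \<theta> (\<Sum>k\<in>{k. g k \<noteq> 0}. g k)" using trans[OF f[unfolded f', THEN conjunct2, THEN conjunct2] conjunct1[OF sumform[of g, OF gA]]]
          by (simp only: x(2))
        then have "x = (\<Sum>k\<in>{k. g k \<noteq> 0}. g k)" using xA gA by (subst (asm) \<theta>_inj) (auto intro!: A_sum)
        moreover have "finite {k. g k \<noteq> 0}" using f sumform[of g, OF gA] unfolding f' by simp
        ultimately have "lproj k x = g k" for k using g(1) by (intro decomp[of x g "{k. g k \<noteq> 0}"]) auto
        then show "f = (\<lambda>k. \<theta> (lproj k x))" unfolding f' by simp
      qed
    qed (use sub in auto)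
  qed
qed

lemma branching_system_primitive:
  assumes bs: "branching_system E X src cons deg"
    and H: "H = {v \<in> verts E. \<forall>x\<in>X. src x \<noteq> v}"
    and B: "B = {v \<in> B_set E H. \<forall>x\<in>X. src x = v \<longrightarrow> (\<exists>e\<in>arcs E. \<exists>y\<in>X. src y = head E e \<and> x = cons e y)}"
  shows "graded_ideal E (I_HS E H B :: ('v, 'e, 'k) lpa_elem set)"
    "left_primitive_ideal (I_HS E H B) R" "right_primitive_ideal (I_HS E H B) R"
proof -
  interpret branching_module E "lscale :: 'k \<Rightarrow> _" "lP E" "lS E" "lT E" lstar lproj X src cons deg
    "\<lambda>a. branching_system.fact E X src cons (preim E a)"
    by (rule branching_module_lprod[OF bs])
  let ?act = "\<lambda>a. branching_system.fact E X src cons (preim E a)"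
  have HB: "H \<subseteq> verts E" "B \<subseteq> verts E" by (auto simp: H B B_set_def)
  have eq: "Ann = IHS H B" unfolding H B by (rule Ann_eq_IHS)
  have tsi: "tsi Ann" using Ann_graded by (simp add: graded_def)
  have img: "I_HS E H B = \<theta> ` Ann" using I_HS_\<theta>[OF HB] eq by simp
  show "graded_ideal E (I_HS E H B :: ('v, 'e, 'k) lpa_elem set)"
    unfolding img using graded_ideal_\<theta>[OF tsi_subset[OF tsi]] Ann_graded by simp
  have id: "two_sided_ideal (\<theta> ` Ann) R" using two_sided_ideal_\<theta>[OF tsi_subset[OF tsi]] tsi by simp
  obtain x where x: "x \<in> X" using X_ne by blast
  have nonzero: "\<exists>a\<in>A. \<exists>m\<in>N. ?act a m \<noteq> 0"
    using act_P[OF src_in[OF x] x, of 1] single_one_neq_0[of x] A_P[OF src_in[OF x]] N_single[OF x, of 1]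
    by (intro bexI[of _ "lP E (src x)"] bexI[of _ "Poly_Mapping.single x 1"]) auto
  have star: "lstar ` Ann = Ann" unfolding eq by (rule star_IHS[OF HB])
  have "left_primitive (R Quot \<theta> ` Ann)" "right_primitive (R Quot \<theta> ` lstar ` Ann)"
  proof -
    have N: "0 \<in> N" "\<And>m n. m \<in> N \<Longrightarrow> n \<in> N \<Longrightarrow> m + n \<in> N" "\<And>m. m \<in> N \<Longrightarrow> - m \<in> N"
      by (simp_all add: N_add N_uminus)
    show "left_primitive (R Quot \<theta> ` Ann)" "right_primitive (R Quot \<theta> ` lstar ` Ann)"
      by (rule primitive_Ann[where N = N and \<rho> = ?act];
          (rule N act_N act_add act_add_right act_mult nonzero N_simple tsi Ann_def; assumption?)?)+
  qed
  then show "left_primitive_ideal (I_HS E H B) R" "right_primitive_ideal (I_HS E H B) R"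
    using id star by (simp_all add: left_primitive_ideal_def right_primitive_ideal_def img)
qed

lemma M_gamma_primitive:
  assumes M: "M \<in> M_gamma E" and count: "countable (verts E)"
  defines "J \<equiv> I_HS E (Omega E M) (B_set E (Omega E M)) :: ('v, 'e, 'k) lpa_elem set"
  shows "graded_ideal E J \<and> left_primitive_ideal J R \<and> right_primitive_ideal J R"
proof -
  have mt: "maximal_tail E M" and L: "condition_L (tail_subgraph E M)" using M by (auto simp: M_gamma_def)
  have Mv: "M \<subseteq> verts E" using mt by (simp add: maximal_tail_def)
  have MT1: "v \<in> M" if "v \<in> verts E" "w \<in> M" "v \<rightarrow>\<^sup>*\<^bsub>E\<^esub> w" for v w
    using mt that unfolding maximal_tail_def by blast
  have MT2: "\<forall>v\<in>M. finite (out_arcs E v) \<and> out_arcs E v \<noteq> {} \<longrightarrow> (\<exists>e\<in>out_arcs E v. head E e \<in> M)"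
    using mt unfolding maximal_tail_def by (elim conjE)
  have MT3: "\<forall>v\<in>M. \<forall>w\<in>M. \<exists>y\<in>M. v \<rightarrow>\<^sup>*\<^bsub>E\<^esub> y \<and> w \<rightarrow>\<^sup>*\<^bsub>E\<^esub> y"
    using mt unfolding maximal_tail_def by (elim conjE)
  have Om: "Omega E M = verts E - M" using MT1 by (auto simp: Omega_def)
  show ?thesis
  proof (cases "\<exists>y\<in>M. \<forall>e\<in>out_arcs E y. head E e \<notin> M")
    case True
    then obtain y where y: "y \<in> M" "\<forall>e\<in>out_arcs E y. head E e \<notin> M" by blast
    have sing: "infinite (out_arcs E y) \<or> out_arcs E y = {}"
      using MT2 y by blast
    \<comment> \<open>Any longer walk from \<open>y\<close> to a vertex of \<open>M\<close> would
      have its first edge ending in \<open>M\<close>, by (MT1). So the common successor that (MT3)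
      gives for \<open>y\<close> and any vertex is \<open>y\<close> itself.\<close>
    have stuck: "z = y" if z: "z \<in> M" "y \<rightarrow>\<^sup>*\<^bsub>E\<^esub> z" for z
    proof -
      obtain p where p: "awalk y p z" using z(2) by (auto simp: reachable_awalk)
      show ?thesis
      proof (cases p)
        case (Cons e q)
        then have e: "e \<in> out_arcs E y" "awalk (head E e) q z" using p by (auto simp: awalk_simps)
        then have "head E e \<in> M" using MT1[OF _ z(1), of "head E e"] by (auto intro: reachable_awalkI)
        then show ?thesis using y(2) e(1) by blast
      qed (use p in \<open>auto simp: awalk_simps\<close>)
    qed
    have reach: "w \<rightarrow>\<^sup>*\<^bsub>E\<^esub> y" if w: "w \<in> M" for w
    proof -
      obtain z where "z \<in> M" "w \<rightarrow>\<^sup>*\<^bsub>E\<^esub> z" "y \<rightarrow>\<^sup>*\<^bsub>E\<^esub> z"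
        using MT3[rule_format, OF w y(1)] by blast
      then show ?thesis using stuck by blast
    qed
    have yv: "y \<in> verts E" using y Mv by blast
    have ex: "(\<exists>x\<in>fin_paths y. fin_src y x = v) \<longleftrightarrow> v \<in> M" if "v \<in> verts E" for v
    proof
      assume "\<exists>x\<in>fin_paths y. fin_src y x = v"
      then have "v \<rightarrow>\<^sup>*\<^bsub>E\<^esub> y" by (auto simp: fin_paths_awalk reachable_awalk)
      then show "v \<in> M" by (rule MT1[OF that y(1)])
    next
      assume "v \<in> M"
      then obtain p where "awalk v p y" using reach by (auto simp: reachable_awalk)
      then show "\<exists>x\<in>fin_paths y. fin_src y x = v"
        using fin_src_awalk by (auto simp: fin_paths_def)
    qed
    have H: "Omega E M = {v \<in> verts E. \<forall>x\<in>fin_paths y. fin_src y x \<noteq> v}"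
      unfolding Om using ex by blast
    \<comment> \<open>All edges at \<open>y\<close> end in \<open>Omega E M\<close>, so
      \<open>y\<close> is not a breaking vertex and its trivial path is no obstacle to having all
      breaking elements in the annihilator.\<close>
    have "y \<notin> B_set E (Omega E M)"
      using y(2) by (auto simp: B_set_def Om)
    then have B: "B_set E (Omega E M) = {v \<in> B_set E (Omega E M). \<forall>x\<in>fin_paths y. fin_src y x = v \<longrightarrow>
       (\<exists>e\<in>arcs E. \<exists>z\<in>fin_paths y. fin_src y z = head E e \<and> x = e # z)}"
    proof -
      have "\<exists>e\<in>arcs E. \<exists>z\<in>fin_paths y. fin_src y z = head E e \<and> x = e # z"
        if "x \<in> fin_paths y" "fin_src y x \<noteq> y" for x
      proof (cases x)
        case (Cons e z)
        then have "e \<in> arcs E" "awalk (head E e) z y" using that by (auto simp: fin_paths_def awalk_simps)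
        then show ?thesis using Cons fin_src_awalk by (auto simp: fin_paths_def)
      qed (use that in \<open>simp add: fin_src_def\<close>)
      then have "\<forall>x\<in>fin_paths y. fin_src y x = v \<longrightarrow>
          (\<exists>e\<in>arcs E. \<exists>z\<in>fin_paths y. fin_src y z = head E e \<and> x = e # z)"
        if "v \<in> B_set E (Omega E M)" for v
        using that \<open>y \<notin> B_set E (Omega E M)\<close> by metis
      then show ?thesis by blast
    qed
    show ?thesis
      using branching_system_primitive[OF branching_system_fin_paths[OF yv sing] H B] unfolding J_def by blast
  next
    case False
    interpret sinkless_tail E M by unfold_locales (use mt L False in auto)
    obtain p where p: "inf_path p" "aperiodic p" "\<And>i. tail E (p i) \<in> M"
      "\<And>w. w \<in> M \<Longrightarrow> \<exists>j. w \<rightarrow>\<^sup>*\<^bsub>E\<^esub> tail E (p j)"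
      using aperiodic_path countable_subset[OF Mv count] by blast
    have bs: "branching_system E (tail_class p) (\<lambda>x. tail E (x 0)) case_nat (inf_deg p)"
      by (rule branching_system_tail_class[OF p(1,2)])
    have ex: "(\<exists>x\<in>tail_class p. tail E (x 0) = v) \<longleftrightarrow> v \<in> M" if "v \<in> verts E" for v
      unfolding reach_tail_class[OF p(1)] using p(3,4) MT1[OF that] by blast
    have H: "Omega E M = {v \<in> verts E. \<forall>x\<in>tail_class p. tail E (x 0) \<noteq> v}"
      unfolding Om using ex by blast
    \<comment> \<open>Each infinite path starts with an edge, so every breaking element annihilates
      the module.\<close>
    have "\<exists>e\<in>arcs E. \<exists>z\<in>tail_class p. tail E (z 0) = head E e \<and> x = case_nat e z"
      if "x \<in> tail_class p" for x
      using that tail_class_case_nat[of "x 0" "\<lambda>i. x (Suc i)" p] case_nat_shift[of x]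
      by (intro bexI[of _ "x 0"] bexI[of _ "\<lambda>i. x (Suc i)"]) auto
    then have B: "B_set E (Omega E M) = {v \<in> B_set E (Omega E M). \<forall>x\<in>tail_class p. tail E (x 0) = v \<longrightarrow>
       (\<exists>e\<in>arcs E. \<exists>z\<in>tail_class p. tail E (z 0) = head E e \<and> x = case_nat e z)}" by blast
    show ?thesis using branching_system_primitive[OF bs H B] unfolding J_def by blast
  qed
qed

text \<open>The only path ending at \<open>v\<close> that starts with no edge is the trivial one, so
  the breaking element at \<open>v\<close> is the only one that acts as nonzero.\<close>

lemma BV_primitive:
  assumes v: "v \<in> BV E"
  defines "J \<equiv> I_HS E (Omega E {v}) (B_set E (Omega E {v}) - {v}) :: ('v, 'e, 'k) lpa_elem set"
  shows "graded_ideal E J \<and> left_primitive_ideal J R \<and> right_primitive_ideal J R"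
proof -
  have vv: "v \<in> verts E" "infinite (out_arcs E v) \<or> out_arcs E v = {}" using v by (auto simp: BV_def)
  have H: "Omega E {v} = {w \<in> verts E. \<forall>x\<in>fin_paths v. fin_src v x \<noteq> w}"
  proof -
    have "(\<exists>x\<in>fin_paths v. fin_src v x = w) \<longleftrightarrow> w \<rightarrow>\<^sup>*\<^bsub>E\<^esub> v" for w
      unfolding reachable_awalk using fin_src_awalk by (auto simp: fin_paths_def)
    moreover have "v \<rightarrow>\<^sup>*\<^bsub>E\<^esub> v" using vv by simp
    ultimately show ?thesis by (auto simp: Omega_def)
  qed
  have "(\<forall>x\<in>fin_paths v. fin_src v x = w \<longrightarrow>
      (\<exists>e\<in>arcs E. \<exists>z\<in>fin_paths v. fin_src v z = head E e \<and> x = e # z)) \<longleftrightarrow> w \<noteq> v" for w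
  proof
    assume *: "\<forall>x\<in>fin_paths v. fin_src v x = w \<longrightarrow>
      (\<exists>e\<in>arcs E. \<exists>z\<in>fin_paths v. fin_src v z = head E e \<and> x = e # z)"
    have "[] \<in> fin_paths v" "fin_src v [] = v" using vv by (auto simp: fin_paths_def fin_src_def awalk_simps)
    then show "w \<noteq> v" using * by blast
  next
    assume "w \<noteq> v"
    show "\<forall>x\<in>fin_paths v. fin_src v x = w \<longrightarrow>
      (\<exists>e\<in>arcs E. \<exists>z\<in>fin_paths v. fin_src v z = head E e \<and> x = e # z)"
    proof (intro ballI impI)
      fix x assume x: "x \<in> fin_paths v" "fin_src v x = w"
      show "\<exists>e\<in>arcs E. \<exists>z\<in>fin_paths v. fin_src v z = head E e \<and> x = e # z"
      proof (cases x)
        case (Cons e z)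
        then have "e \<in> arcs E" "awalk (head E e) z v" using x by (auto simp: fin_paths_def awalk_simps)
        then show ?thesis using Cons fin_src_awalk by (auto simp: fin_paths_def)
      qed (use x \<open>w \<noteq> v\<close> in \<open>simp add: fin_src_def\<close>)
    qed
  qed
  then have B: "B_set E (Omega E {v}) - {v} = {w \<in> B_set E (Omega E {v}). \<forall>x\<in>fin_paths v. fin_src v x = w \<longrightarrow>
      (\<exists>e\<in>arcs E. \<exists>z\<in>fin_paths v. fin_src v z = head E e \<and> x = e # z)}" by blast
  show ?thesis
    using branching_system_primitive[OF branching_system_fin_paths[OF vv] H B] unfolding J_def by blast
qed

lemma primitive_graded_form:
  assumes gr: "graded_ideal E (J :: ('v, 'e, 'k) lpa_elem set)"
    and prim: "left_primitive_ideal J R \<or> right_primitive_ideal J R"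
  shows "(\<exists>M\<in>M_gamma E. J = I_HS E (Omega E M) (B_set E (Omega E M))) \<or>
     (\<exists>v\<in>BV E. J = I_HS E (Omega E {v}) (B_set E (Omega E {v}) - {v}))"
proof -
  have "two_sided_ideal J R" using gr by (simp add: graded_ideal_def)
  then obtain I where I: "tsi I" "J = \<theta> ` I" by (rule two_sided_ideal_obtain)
  have grI: "graded I" using gr graded_ideal_\<theta>[OF tsi_subset[OF I(1)]] I(2) by simp
  have Om: "Omega E Y \<subseteq> verts E" "B_set E (Omega E Y) \<subseteq> verts E" "B_set E (Omega E Y) - Z \<subseteq> verts E" for Y Z
    by (auto simp: Omega_def B_set_def)
  have "(\<exists>M\<in>M_gamma E. I = IHS (Omega E M) (B_set E (Omega E M))) \<or>
     (\<exists>v\<in>BV E. I = IHS (Omega E {v}) (B_set E (Omega E {v}) - {v}))"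
    using prim
  proof
    assume "left_primitive_ideal J R"
    then have "lprim I" using left_primitive_lprim[OF I(1)] I(2) by (simp add: left_primitive_ideal_def)
    then show ?thesis using lprim_graded_form grI by blast
  next
    assume "right_primitive_ideal J R"
    then have "lprim (lstar ` I)" using right_primitive_lprim[OF I(1)] I(2) by (simp add: right_primitive_ideal_def)
    from lprim_graded_form[OF this graded_star[OF grI]]
    have "(\<exists>M\<in>M_gamma E. lstar ` I = lstar ` IHS (Omega E M) (B_set E (Omega E M))) \<or>
     (\<exists>v\<in>BV E. lstar ` I = lstar ` IHS (Omega E {v}) (B_set E (Omega E {v}) - {v}))"
      using star_IHS[OF Om(1,2)] star_IHS[OF Om(1,3)] by simp
    moreover have "inj (lstar :: ('v, 'e, 'k) lprod \<Rightarrow> _)" by (rule injI) (metis star_star)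
    ultimately show ?thesis by (simp add: inj_image_eq_iff)
  qed
  then show ?thesis using I_HS_\<theta>[OF Om(1,2)] I_HS_\<theta>[OF Om(1,3)] I(2) by metis
qed

end

theorem proposition6p9:
  fixes E :: "('v, 'e) pre_digraph"
  assumes "wf_digraph E" and "countable (verts E)" and "countable (arcs E)"
  shows
    "{I :: ('v, 'e, 'k::field) lpa_elem set. graded_ideal E I \<and> left_primitive_ideal I (lpa E)} =
       {I_HS E (Omega E M) (B_set E (Omega E M)) | M. M \<in> M_gamma E} \<union>
       {I_HS E (Omega E {v}) (B_set E (Omega E {v}) - {v}) | v. v \<in> BV E}
     \<and>
     {I :: ('v, 'e, 'k) lpa_elem set. graded_ideal E I \<and> right_primitive_ideal I (lpa E)} =
       {I_HS E (Omega E M) (B_set E (Omega E M)) | M. M \<in> M_gamma E} \<union>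
       {I_HS E (Omega E {v}) (B_set E (Omega E {v}) - {v}) | v. v \<in> BV E}"
proof -
  interpret wf_digraph E by fact
  interpret lpa_graph E "TYPE('k)" by unfold_locales
  show ?thesis
    using primitive_graded_form M_gamma_primitive[OF _ assms(2)] BV_primitive by fast
qed

end
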